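(* Let $k\ge 2$ be an integer and let $T:\widetilde{\mathcal W}_k\to\mathbb R$ be a bounded function that is continuous on the metric space $(\widetilde{\mathcal W}_k,\delta_\square)$. For $n\ge1$ let $$\psi_n:=\frac1{n^2}\log\sum_{\mathscr X\in\mathcal C_n^k}\exp\{n^2T(\widetilde{\mathbf W}^{\mathscr X})\}.$$ Then $$\lim_{n\to\infty}\psi_n=\sup_{\widetilde{\mathbf W}\in\widetilde{\mathcal W}_k}\Big(T(\widetilde{\mathbf W})-\tfrac12\mathcal I(\widetilde{\mathbf W})\Big).$$
   Context: Let $[k]=\{1,\dots,k\}$ and $\Delta_k=\{\mu\in[0,1]^k:\sum_a\mu_a=1\}$. A $k$-colored probability graphon is a measurable symmetric map $\mathbf W=(W_1,\dots,W_k):[0,1]^2\to\Delta_k$; $\mathcal W_k$ is the set of these. For a bounded measurable $U:[0,1]^2\to\mathbb R$, $\|U\|_\square=\sup_{S,T\subset[0,1]}|\int_{S\times T}U|$ (measurable $S,T$); for vector-valued $\mathbf U=(U_1,\dots,U_k)$, $\|\mathbf U\|_\square=\sum_a\|U_a\|_\square$. Cut distance: $\delta_\square(\mathbf U,\mathbf W)=\inf_\phi\|\mathbf U-\mathbf W^\phi\|_\square$ over measure-preserving bijections $\phi$ of $[0,1]$ (modulo null sets), where $\mathbf W^\phi(x,y)=\mathbf W(\phi(x),\phi(y))$. $\widetilde{\mathcal W}_k$ is the quotient of $\mathcal W_k$ by the relation $\delta_\square=0$, with the induced metric $\delta_\square$; $\widetilde{\mathbf W}$ is the class of $\mathbf W$.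 $\mathcal C_n^k$ is the set of all maps $\mathscr X$ from the edge set of the complete graph $K_n$ on $\{1,\dots,n\}$ to $[k]$. The empirical graphon $\mathbf W^{\mathscr X}\in\mathcal W_k$ has $W^{\mathscr X}_a(x,y)=\mathbf 1\{\mathscr X(\{u,v\})=a\}$ for $(x,y)\in(\frac{u-1}n,\frac un]\times(\frac{v-1}n,\frac vn]$, $u\ne v$, and $\mathbf W^{\mathscr X}=(\frac1k,\dots,\frac1k)$ on the diagonal blocks $u=v$. $\mathcal I(\mathbf W)=\sum_{a=1}^k\int_{[0,1]^2}W_a\log W_a\,dx\,dy$ (with $0\log0=0$); it depends only on the class $\widetilde{\mathbf W}$ and so is regarded as a functional on $\widetilde{\mathcal W}_k$. *)

theory Defs
  imports "HOL-Analysis.Analysis"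
begin

text \<open>
  The interval \<open>[0,1]\<close> carries its Borel sigma-algebra and Lebesgue measure, and
  ``measurable'' means Borel measurable.  Every Lebesgue measurable graphon agrees almost
  everywhere with a Borel measurable one, so the quotient metric space defined below is the
  same for either reading.
\<close>

definition unit_measure :: "real measure" where
  "unit_measure = restrict_space lborel {0..1}"

abbreviation square_measure :: "(real \<times> real) measure" where
  "square_measure \<equiv> unit_measure \<Otimes>\<^sub>M unit_measure"

definition prob_simplex :: "nat \<Rightarrow> (nat \<Rightarrow> real) set" where
  "prob_simplex k = {\<mu>. (\<forall>a\<in>{1..k}. \<mu> a \<in> {0..1}) \<and> (\<Sum>a=1..k. \<mu> a) = 1}"

text \<open>
  A \<open>k\<close>-colored graphon is given by its components \<open>W a\<close>, \<open>a \<in> {1..k}\<close>.  The values of \<open>W\<close> at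
  other indices, or off the unit square, play no role; such differences disappear in the quotient.
\<close>

type_synonym kernel = "nat \<Rightarrow> real \<times> real \<Rightarrow> real"

definition graphons :: "nat \<Rightarrow> kernel set" where
  "graphons k = {W. (\<forall>a\<in>{1..k}. W a \<in> borel_measurable square_measure) \<and>
     (\<forall>x\<in>{0..1}. \<forall>y\<in>{0..1}.
        (\<lambda>a. W a (x, y)) \<in> prob_simplex k \<and> (\<forall>a\<in>{1..k}. W a (x, y) = W a (y, x)))}"

definition cut_norm :: "(real \<times> real \<Rightarrow> real) \<Rightarrow> real" where
  "cut_norm U = (SUP (S, T) \<in> sets unit_measure \<times> sets unit_measure.
     \<bar>set_lebesgue_integral square_measure (S \<times> T) U\<bar>)"

definition vec_cut_norm :: "nat \<Rightarrow> kernel \<Rightarrow> real" where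
  "vec_cut_norm k U = (\<Sum>a=1..k. cut_norm (U a))"

text \<open>
  Measure-preserving bijections modulo null sets: measure-preserving maps that have a
  measure-preserving inverse almost everywhere.
\<close>

definition mp_maps :: "(real \<Rightarrow> real) set" where
  "mp_maps = {\<phi> \<in> measurable unit_measure unit_measure. distr unit_measure unit_measure \<phi> = unit_measure}"

definition mp_bijections :: "(real \<Rightarrow> real) set" where
  "mp_bijections = {\<phi> \<in> mp_maps. \<exists>\<psi>\<in>mp_maps.
     (AE x in unit_measure. \<psi> (\<phi> x) = x) \<and> (AE x in unit_measure. \<phi> (\<psi> x) = x)}"

definition relabel :: "(real \<Rightarrow> real) \<Rightarrow> kernel \<Rightarrow> kernel" where
  "relabel \<phi> W = (\<lambda>a (x, y). W a (\<phi> x, \<phi> y))"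

definition cut_dist :: "nat \<Rightarrow> kernel \<Rightarrow> kernel \<Rightarrow> real" where
  "cut_dist k U W = (INF \<phi>\<in>mp_bijections. vec_cut_norm k (\<lambda>a p. U a p - relabel \<phi> W a p))"

definition cut_rel :: "nat \<Rightarrow> (kernel \<times> kernel) set" where
  "cut_rel k = {(U, W). U \<in> graphons k \<and> W \<in> graphons k \<and> cut_dist k U W = 0}"

definition graphon_space :: "nat \<Rightarrow> kernel set set" where
  "graphon_space k = graphons k // cut_rel k"

definition graphon_class :: "nat \<Rightarrow> kernel \<Rightarrow> kernel set" where
  "graphon_class k W = cut_rel k `` {W}"

definition representative :: "kernel set \<Rightarrow> kernel" where
  "representative A = (SOME W. W \<in> A)"

text \<open>
  The induced metric; its independence of the representatives is proved below.  The value 0 off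
  \<open>graphon_space k\<close> serves only to meet the locale \<open>Metric_space\<close>, which demands
  nonnegativity and symmetry on the whole type.
\<close>

definition class_dist :: "nat \<Rightarrow> kernel set \<Rightarrow> kernel set \<Rightarrow> real" where
  "class_dist k A B = (if A \<in> graphon_space k \<and> B \<in> graphon_space k
     then cut_dist k (representative A) (representative B) else 0)"

definition graphon_topology :: "nat \<Rightarrow> kernel set topology" where
  "graphon_topology k = Metric_space.mtopology (graphon_space k) (class_dist k)"

text \<open>The convention \<open>0 log 0 = 0\<close> holds automatically.\<close>

definition entropy :: "nat \<Rightarrow> kernel \<Rightarrow> real" where
  "entropy k W = (\<Sum>a=1..k. \<integral>p. W a p * ln (W a p) \<partial>square_measure)"

text \<open>
  \<open>entropy\<close> takes the same value on all members of a class (it is lower semicontinuous and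
  invariant under relabelling), so the choice of representative is immaterial.
\<close>

definition class_entropy :: "nat \<Rightarrow> kernel set \<Rightarrow> real" where
  "class_entropy k A = entropy k (representative A)"

definition complete_edges :: "nat \<Rightarrow> nat set set" where
  "complete_edges n = {e. e \<subseteq> {1..n} \<and> card e = 2}"

definition colorings :: "nat \<Rightarrow> nat \<Rightarrow> (nat set \<Rightarrow> nat) set" where
  "colorings k n = complete_edges n \<rightarrow>\<^sub>E {1..k}"

text \<open>
  For \<open>n \<ge> 1\<close> and \<open>u \<in> {1..n}\<close>, \<open>x\<close> lies in \<open>((u-1)/n, u/n]\<close> iff \<open>\<lceil>n x\<rceil> = u\<close>.
  The half-open blocks miss the null set where \<open>x = 0\<close> or \<open>y = 0\<close>; there the graphon is given the
  uniform value, as on the diagonal blocks.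
\<close>

definition empirical_graphon :: "nat \<Rightarrow> nat \<Rightarrow> (nat set \<Rightarrow> nat) \<Rightarrow> kernel" where
  "empirical_graphon k n X = (\<lambda>a (x, y).
     let u = nat \<lceil>real n * x\<rceil>; v = nat \<lceil>real n * y\<rceil>
     in if u \<in> {1..n} \<and> v \<in> {1..n} \<and> u \<noteq> v then of_bool (X {u, v} = a) else 1 / real k)"

definition log_partition :: "nat \<Rightarrow> (kernel set \<Rightarrow> real) \<Rightarrow> nat \<Rightarrow> real" where
  "log_partition k T n = 1 / (real n)\<^sup>2 *
     ln (\<Sum>X\<in>colorings k n. exp ((real n)\<^sup>2 * T (graphon_class k (empirical_graphon k n X))))"

lemma space_unit_measure [simp]: "space unit_measure = {0..1}"
  by (simp add: unit_measure_def space_restrict_space)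

lemma unit_interval_sets [simp]: "{0..1} \<in> sets unit_measure"
  using sets.top[of unit_measure] by simp

lemma prob_space_unit: "emeasure unit_measure (space unit_measure) = 1"
  by (simp add: unit_measure_def emeasure_restrict_space space_restrict_space)

interpretation UM: finite_measure unit_measure
  by (rule finite_measureI) (simp only: prob_space_unit, simp)

interpretation UP: pair_sigma_finite unit_measure unit_measure ..

interpretation SM: finite_measure square_measure
proof (rule finite_measureI)
  have "emeasure square_measure (space square_measure) =
      emeasure unit_measure (space unit_measure) * emeasure unit_measure (space unit_measure)"
    unfolding space_pair_measure by (rule UM.emeasure_pair_measure_Times) auto
  then show "emeasure square_measure (space square_measure) \<noteq> \<infinity>"
    by (simp only: prob_space_unit) simp
qed

definition bounded_kernel :: "(real \<times> real \<Rightarrow> real) \<Rightarrow> bool" where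
  "bounded_kernel F \<longleftrightarrow> F \<in> borel_measurable square_measure \<and>
     (\<exists>B. \<forall>p\<in>space square_measure. \<bar>F p\<bar> \<le> B)"

lemma bounded_kernel_integrable:
  assumes "bounded_kernel F" shows "integrable square_measure F"
proof -
  obtain B where "\<forall>p\<in>space square_measure. \<bar>F p\<bar> \<le> B" "F \<in> borel_measurable square_measure"
    using assms unfolding bounded_kernel_def by auto
  then show ?thesis
    by (intro SM.integrable_const_bound[where B = B]) auto
qed

lemma bounded_kernel_set_integrable:
  assumes "bounded_kernel F" "S \<in> sets unit_measure" "T \<in> sets unit_measure"
  shows "set_integrable square_measure (S \<times> T) F"
  using bounded_kernel_integrable[OF assms(1)] assms
  unfolding set_integrable_def by (intro integrable_mult_indicator) auto

lemma bounded_kernel_diff: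
  assumes "bounded_kernel F" "bounded_kernel G" shows "bounded_kernel (\<lambda>p. F p - G p)"
proof -
  obtain B C where "\<forall>p\<in>space square_measure. \<bar>F p\<bar> \<le> B" "\<forall>p\<in>space square_measure. \<bar>G p\<bar> \<le> C"
    using assms unfolding bounded_kernel_def by auto
  then have "\<forall>p\<in>space square_measure. \<bar>F p - G p\<bar> \<le> B + C"
    by (metis abs_triangle_ineq4 add_mono order_trans)
  then show ?thesis using assms unfolding bounded_kernel_def by auto
qed

lemma cut_norm_bdd:
  assumes "bounded_kernel F"
  shows "bdd_above ((\<lambda>(S, T). \<bar>set_lebesgue_integral square_measure (S \<times> T) F\<bar>) `
    (sets unit_measure \<times> sets unit_measure))"
proof (rule bdd_aboveI2, clarify)
  fix S T assume "S \<in> sets unit_measure" "T \<in> sets unit_measure"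
  have "\<bar>set_lebesgue_integral square_measure (S \<times> T) F\<bar>
      \<le> (\<integral>p. norm (indicator (S \<times> T) p *\<^sub>R F p) \<partial>square_measure)"
    unfolding set_lebesgue_integral_def real_norm_def[symmetric] by (rule integral_norm_bound)
  also have "\<dots> \<le> (\<integral>p. norm (F p) \<partial>square_measure)"
    using bounded_kernel_integrable[OF assms] \<open>S \<in> _\<close> \<open>T \<in> _\<close>
    by (intro integral_mono integrable_norm integrable_mult_indicator)
      (auto simp: indicator_def)
  finally show "\<bar>set_lebesgue_integral square_measure (S \<times> T) F\<bar> \<le> (\<integral>p. norm (F p) \<partial>square_measure)" .
qed

lemma cut_norm_upper:
  assumes "bounded_kernel F" "S \<in> sets unit_measure" "T \<in> sets unit_measure"
  shows "\<bar>set_lebesgue_integral square_measure (S \<times> T) F\<bar> \<le> cut_norm F"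
  unfolding cut_norm_def using cSUP_upper[OF _ cut_norm_bdd[OF assms(1)], of "(S, T)"] assms by auto

lemma cut_norm_least:
  assumes "\<And>S T. S \<in> sets unit_measure \<Longrightarrow> T \<in> sets unit_measure \<Longrightarrow>
    \<bar>set_lebesgue_integral square_measure (S \<times> T) F\<bar> \<le> c"
  shows "cut_norm F \<le> c"
  unfolding cut_norm_def by (rule cSUP_least) (use assms in auto)

lemma cut_norm_nonneg: "bounded_kernel F \<Longrightarrow> 0 \<le> cut_norm F"
  using cut_norm_upper[of F "{}" "{}"] by auto

lemma cut_norm_zero: "cut_norm (\<lambda>p. 0) = 0"
proof (rule antisym)
  show "cut_norm (\<lambda>p. 0) \<le> 0"
    by (rule cut_norm_least) (simp add: set_lebesgue_integral_def)
  show "0 \<le> cut_norm (\<lambda>p. 0)"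
    by (rule cut_norm_nonneg) (auto simp: bounded_kernel_def)
qed

lemma cut_norm_triangle:
  assumes F: "bounded_kernel F" and G: "bounded_kernel G" and H: "H = (\<lambda>p. F p - G p)"
  shows "cut_norm H \<le> cut_norm F + cut_norm G"
proof (rule cut_norm_least)
  fix S T assume S: "S \<in> sets unit_measure" "T \<in> sets unit_measure"
  have "set_lebesgue_integral square_measure (S \<times> T) H =
     set_lebesgue_integral square_measure (S \<times> T) F - set_lebesgue_integral square_measure (S \<times> T) G"
    unfolding H using bounded_kernel_set_integrable[OF F S] bounded_kernel_set_integrable[OF G S]
    by (rule set_integral_diff)
  with cut_norm_upper[OF F S] cut_norm_upper[OF G S]
  show "\<bar>set_lebesgue_integral square_measure (S \<times> T) H\<bar> \<le> cut_norm F + cut_norm G"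
    by linarith
qed

lemma mp_mapsD:
  assumes "\<phi> \<in> mp_maps"
  shows "\<phi> \<in> measurable unit_measure unit_measure" "distr unit_measure unit_measure \<phi> = unit_measure"
  using assms unfolding mp_maps_def by auto

lemma mp_maps_AE:
  assumes "\<phi> \<in> mp_maps" "AE x in unit_measure. P x"
  shows "AE x in unit_measure. P (\<phi> x)"
proof (rule AE_distrD[OF mp_mapsD(1)[OF assms(1)]])
  show "AE x in distr unit_measure unit_measure \<phi>. P x"
    unfolding mp_mapsD(2)[OF assms(1)] by (rule assms(2))
qed

lemma mp_maps_comp:
  assumes "\<phi> \<in> mp_maps" "\<psi> \<in> mp_maps" shows "\<phi> \<circ> \<psi> \<in> mp_maps"
proof -
  have "distr unit_measure unit_measure (\<phi> \<circ> \<psi>) =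
      distr (distr unit_measure unit_measure \<psi>) unit_measure \<phi>"
    using assms by (intro distr_distr[symmetric]) (auto dest: mp_mapsD)
  then show ?thesis
    using assms unfolding mp_maps_def by (auto intro: measurable_comp)
qed

lemma mp_bijections_id: "id \<in> mp_bijections"
proof -
  have "id \<in> mp_maps" unfolding mp_maps_def by (auto simp: id_def distr_id)
  then show ?thesis unfolding mp_bijections_def by (auto intro!: bexI[of _ id])
qed

lemma mp_bijections_comp:
  assumes "\<phi> \<in> mp_bijections" "\<psi> \<in> mp_bijections" shows "\<phi> \<circ> \<psi> \<in> mp_bijections"
proof -
  obtain \<phi>' where p: "\<phi> \<in> mp_maps" "\<phi>' \<in> mp_maps" "AE x in unit_measure. \<phi>' (\<phi> x) = x"
      "AE x in unit_measure. \<phi> (\<phi>' x) = x"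
    using assms(1) unfolding mp_bijections_def by auto
  obtain \<psi>' where q: "\<psi> \<in> mp_maps" "\<psi>' \<in> mp_maps" "AE x in unit_measure. \<psi>' (\<psi> x) = x"
      "AE x in unit_measure. \<psi> (\<psi>' x) = x"
    using assms(2) unfolding mp_bijections_def by auto
  have "AE x in unit_measure. (\<psi>' \<circ> \<phi>') ((\<phi> \<circ> \<psi>) x) = x"
    using mp_maps_AE[OF q(1) p(3)] q(3) by eventually_elim simp
  moreover have "AE x in unit_measure. (\<phi> \<circ> \<psi>) ((\<psi>' \<circ> \<phi>') x) = x"
    using mp_maps_AE[OF p(2) q(4)] p(4) by eventually_elim simp
  ultimately show ?thesis
    using mp_maps_comp[OF p(1) q(1)] mp_maps_comp[OF q(2) p(2)]
    unfolding mp_bijections_def by blast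
qed

lemma AE_square:
  assumes "AE x in unit_measure. P x"
  shows "AE p in square_measure. P (fst p) \<and> P (snd p)"
proof -
  obtain N where N: "{x \<in> space unit_measure. \<not> P x} \<subseteq> N" "N \<in> null_sets unit_measure"
    using assms unfolding eventually_ae_filter by auto
  have "N \<times> space unit_measure \<in> null_sets square_measure"
       "space unit_measure \<times> N \<in> null_sets square_measure"
    using N(2) UM.emeasure_pair_measure_Times[of N unit_measure "space unit_measure"]
      UM.emeasure_pair_measure_Times[of "space unit_measure" unit_measure N]
    by (auto simp: null_sets_def)
  then have "(N \<times> space unit_measure) \<union> (space unit_measure \<times> N) \<in> null_sets square_measure"
    by auto
  moreover have "{p \<in> space square_measure. \<not> (P (fst p) \<and> P (snd p))}
      \<subseteq> (N \<times> space unit_measure) \<union> (space unit_measure \<times> N)"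
    using N(1) by (auto simp: space_pair_measure)
  ultimately show ?thesis by (rule AE_I')
qed

lemma distr_square:
  assumes "\<phi> \<in> mp_maps"
  shows "distr square_measure square_measure (\<lambda>(x, y). (\<phi> x, \<phi> y)) = square_measure"
  using pair_measure_distr[OF mp_mapsD(1)[OF assms] mp_mapsD(1)[OF assms]] mp_mapsD(2)[OF assms]
    UM.sigma_finite_measure_axioms by simp

lemma measurable_square:
  assumes "\<phi> \<in> mp_maps"
  shows "(\<lambda>(x, y). (\<phi> x, \<phi> y)) \<in> measurable square_measure square_measure"
  using mp_mapsD(1)[OF assms] by measurable

lemma bounded_kernel_comp:
  assumes "bounded_kernel F" "\<phi> \<in> mp_maps"
  shows "bounded_kernel (\<lambda>(x, y). F (\<phi> x, \<phi> y))"
proof -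
  have m: "(\<lambda>(x, y). F (\<phi> x, \<phi> y)) = F \<circ> (\<lambda>(x, y). (\<phi> x, \<phi> y))" by auto
  obtain B where B: "\<forall>p\<in>space square_measure. \<bar>F p\<bar> \<le> B" and F: "F \<in> borel_measurable square_measure"
    using assms unfolding bounded_kernel_def by auto
  have "\<forall>p\<in>space square_measure. \<bar>(F \<circ> (\<lambda>(x, y). (\<phi> x, \<phi> y))) p\<bar> \<le> B"
    using B measurable_space[OF measurable_square[OF assms(2)]] by auto
  then show ?thesis
    unfolding m bounded_kernel_def using measurable_comp[OF measurable_square[OF assms(2)] F] by blast
qed

lemma cut_norm_cong_AE:
  assumes "F \<in> borel_measurable square_measure" "G \<in> borel_measurable square_measure"
    "AE p in square_measure. F p = G p"
  shows "cut_norm F = cut_norm G"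
proof -
  have "set_lebesgue_integral square_measure (S \<times> T) F = set_lebesgue_integral square_measure (S \<times> T) G"
    if "S \<in> sets unit_measure" "T \<in> sets unit_measure" for S T
  proof -
    have "S \<times> T \<in> sets square_measure" using that by auto
    then show ?thesis
      unfolding set_lebesgue_integral_def using assms
      by (intro integral_cong_AE) (auto intro!: borel_measurable_indicator)
  qed
  then show ?thesis unfolding cut_norm_def by (intro SUP_cong) auto
qed

lemma cut_norm_comp_le:
  assumes F: "bounded_kernel F" and \<phi>: "\<phi> \<in> mp_bijections"
  shows "cut_norm (\<lambda>(x, y). F (\<phi> x, \<phi> y)) \<le> cut_norm F"
proof (rule cut_norm_least)
  fix S T assume S: "S \<in> sets unit_measure" and T: "T \<in> sets unit_measure"
  obtain \<psi> where p: "\<phi> \<in> mp_maps" "\<psi> \<in> mp_maps" "AE x in unit_measure. \<psi> (\<phi> x) = x"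
    using \<phi> unfolding mp_bijections_def by auto
  define S' where "S' = \<psi> -` S \<inter> space unit_measure"
  define T' where "T' = \<psi> -` T \<inter> space unit_measure"
  have S': "S' \<in> sets unit_measure" and T': "T' \<in> sets unit_measure"
    unfolding S'_def T'_def using measurable_sets[OF mp_mapsD(1)[OF p(2)]] S T by blast+
  let ?g = "\<lambda>(x, y). (\<phi> x, \<phi> y)"
  have Fm: "F \<in> borel_measurable square_measure" using F unfolding bounded_kernel_def by auto
  have ST: "S \<times> T \<in> sets square_measure" "S' \<times> T' \<in> sets square_measure" using S T S' T' by auto
  have Hm: "(\<lambda>p. indicator (S' \<times> T') p *\<^sub>R F p) \<in> borel_measurable square_measure"
    using Fm ST by auto
  have Fg: "(\<lambda>(x, y). F (\<phi> x, \<phi> y)) \<in> borel_measurable square_measure"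
    using bounded_kernel_comp[OF F p(1)] unfolding bounded_kernel_def by auto
  have "set_lebesgue_integral square_measure (S \<times> T) (\<lambda>(x, y). F (\<phi> x, \<phi> y)) =
     (\<integral>p. indicator (S' \<times> T') (?g p) *\<^sub>R F (?g p) \<partial>square_measure)"
    unfolding set_lebesgue_integral_def
  proof (rule integral_cong_AE)
    show "(\<lambda>p. indicat_real (S \<times> T) p *\<^sub>R (\<lambda>(x, y). F (\<phi> x, \<phi> y)) p) \<in> borel_measurable square_measure"
      using Fg ST(1) by (intro borel_measurable_scaleR borel_measurable_indicator) auto
    show "(\<lambda>p. indicat_real (S' \<times> T') (?g p) *\<^sub>R F (?g p)) \<in> borel_measurable square_measure"
      using measurable_comp[OF measurable_square[OF p(1)] Hm] by (simp add: comp_def)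
    show "AE q in square_measure. indicat_real (S \<times> T) q *\<^sub>R (\<lambda>(x, y). F (\<phi> x, \<phi> y)) q =
        indicat_real (S' \<times> T') (?g q) *\<^sub>R F (?g q)"
      using AE_square[OF p(3)] AE_space
    proof eventually_elim
      case (elim q)
      obtain x y where q: "q = (x, y)" by (cases q)
      have "x \<in> {0..1}" "y \<in> {0..1}" using elim(2) q by (auto simp: space_pair_measure)
      then have "\<phi> x \<in> {0..1}" "\<phi> y \<in> {0..1}"
        using measurable_space[OF mp_mapsD(1)[OF p(1)]] by auto
      then have "q \<in> S \<times> T \<longleftrightarrow> ?g q \<in> S' \<times> T'"
        using elim(1) q unfolding S'_def T'_def by auto
      then show ?case by (auto simp: indicator_def q)
    qed
  qed
  also have "\<dots> = (\<integral>p. indicator (S' \<times> T') p *\<^sub>R F p \<partial>distr square_measure square_measure ?g)"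
    by (rule integral_distr[OF measurable_square[OF p(1)] Hm, symmetric])
  also have "\<dots> = set_lebesgue_integral square_measure (S' \<times> T') F"
    unfolding distr_square[OF p(1)] set_lebesgue_integral_def ..
  finally show "\<bar>set_lebesgue_integral square_measure (S \<times> T) (\<lambda>(x, y). F (\<phi> x, \<phi> y))\<bar> \<le> cut_norm F"
    using cut_norm_upper[OF F S' T'] by simp
qed

lemma graphon_bounded:
  assumes "W \<in> graphons k" "a \<in> {1..k}" shows "bounded_kernel (W a)"
  unfolding bounded_kernel_def
proof (intro conjI exI[of _ 1] ballI)
  show "W a \<in> borel_measurable square_measure" using assms unfolding graphons_def by auto
  fix p assume "p \<in> space square_measure"
  then obtain x y where "p = (x, y)" "x \<in> {0..1}" "y \<in> {0..1}" by (auto simp: space_pair_measure)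
  then show "\<bar>W a p\<bar> \<le> 1" using assms unfolding graphons_def prob_simplex_def by fastforce
qed

lemma relabel_bounded:
  assumes "W \<in> graphons k" "a \<in> {1..k}" "\<phi> \<in> mp_bijections" shows "bounded_kernel (relabel \<phi> W a)"
  using bounded_kernel_comp[OF graphon_bounded[OF assms(1,2)]] assms(3)
  unfolding relabel_def mp_bijections_def by auto

lemma vec_cut_norm_diff_nonneg:
  assumes "U \<in> graphons k" "W \<in> graphons k" "\<phi> \<in> mp_bijections"
  shows "0 \<le> vec_cut_norm k (\<lambda>a p. U a p - relabel \<phi> W a p)"
  unfolding vec_cut_norm_def
  by (intro sum_nonneg cut_norm_nonneg bounded_kernel_diff graphon_bounded[OF assms(1)]
      relabel_bounded[OF assms(2) _ assms(3)])

lemma cut_dist_lower: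
  assumes "U \<in> graphons k" "W \<in> graphons k" "\<phi> \<in> mp_bijections"
  shows "cut_dist k U W \<le> vec_cut_norm k (\<lambda>a p. U a p - relabel \<phi> W a p)"
  unfolding cut_dist_def
  by (rule cINF_lower[OF _ assms(3)]) (rule bdd_belowI2, rule vec_cut_norm_diff_nonneg[OF assms(1,2)])

lemma cut_dist_greatest:
  assumes "\<And>\<phi>. \<phi> \<in> mp_bijections \<Longrightarrow> c \<le> vec_cut_norm k (\<lambda>a p. U a p - relabel \<phi> W a p)"
  shows "c \<le> cut_dist k U W"
  unfolding cut_dist_def by (rule cINF_greatest) (use mp_bijections_id assms in auto)

lemma cut_dist_nonneg: "U \<in> graphons k \<Longrightarrow> W \<in> graphons k \<Longrightarrow> 0 \<le> cut_dist k U W"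
  by (intro cut_dist_greatest vec_cut_norm_diff_nonneg)

lemma cut_dist_refl:
  assumes "W \<in> graphons k" shows "cut_dist k W W = 0"
proof -
  have "vec_cut_norm k (\<lambda>a p. W a p - relabel id W a p) = 0"
    by (simp add: relabel_def vec_cut_norm_def cut_norm_zero)
  then show ?thesis
    using cut_dist_lower[OF assms assms mp_bijections_id] cut_dist_nonneg[OF assms assms] by simp
qed

lemma cut_dist_sym_le:
  assumes U: "U \<in> graphons k" and W: "W \<in> graphons k"
  shows "cut_dist k W U \<le> cut_dist k U W"
proof (rule cut_dist_greatest)
  fix \<phi> assume \<phi>: "\<phi> \<in> mp_bijections"
  then obtain \<psi> where p: "\<phi> \<in> mp_maps" "\<psi> \<in> mp_maps" "AE x in unit_measure. \<psi> (\<phi> x) = x"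
      "AE x in unit_measure. \<phi> (\<psi> x) = x"
    unfolding mp_bijections_def by auto
  then have \<psi>: "\<psi> \<in> mp_bijections" unfolding mp_bijections_def by auto
  have "cut_norm (\<lambda>p. W a p - relabel \<psi> U a p) \<le> cut_norm (\<lambda>p. U a p - relabel \<phi> W a p)"
    if a: "a \<in> {1..k}" for a
  proof -
    let ?D = "\<lambda>p. U a p - relabel \<phi> W a p" and ?E = "\<lambda>p. W a p - relabel \<psi> U a p"
    note bU = graphon_bounded[OF U a] and bW = graphon_bounded[OF W a]
    have D: "bounded_kernel ?D" by (rule bounded_kernel_diff[OF bU relabel_bounded[OF W a \<phi>]])
    have E: "bounded_kernel ?E" by (rule bounded_kernel_diff[OF bW relabel_bounded[OF U a \<psi>]])
    have D': "bounded_kernel (\<lambda>(x, y). ?D (\<psi> x, \<psi> y))" by (rule bounded_kernel_comp[OF D p(2)])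
    have Z: "bounded_kernel (\<lambda>p. 0)" by (auto simp: bounded_kernel_def)
    have N: "bounded_kernel (\<lambda>p. 0 - (\<lambda>(x, y). ?D (\<psi> x, \<psi> y)) p)" by (rule bounded_kernel_diff[OF Z D'])
    have "AE p in square_measure. ?E p = 0 - (\<lambda>(x, y). ?D (\<psi> x, \<psi> y)) p"
      using AE_square[OF p(4)] by eventually_elim (auto simp: relabel_def split: prod.splits)
    then have "cut_norm ?E = cut_norm (\<lambda>p. 0 - (\<lambda>(x, y). ?D (\<psi> x, \<psi> y)) p)"
      using E N by (intro cut_norm_cong_AE) (auto simp: bounded_kernel_def)
    also have "\<dots> \<le> cut_norm (\<lambda>p. 0) + cut_norm (\<lambda>(x, y). ?D (\<psi> x, \<psi> y))"
      by (rule cut_norm_triangle[OF Z D']) simp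
    also have "\<dots> \<le> cut_norm ?D"
      using cut_norm_comp_le[OF D \<psi>] by (simp add: cut_norm_zero)
    finally show ?thesis .
  qed
  then have "vec_cut_norm k (\<lambda>a p. W a p - relabel \<psi> U a p) \<le> vec_cut_norm k (\<lambda>a p. U a p - relabel \<phi> W a p)"
    unfolding vec_cut_norm_def by (rule sum_mono)
  with cut_dist_lower[OF W U \<psi>]
  show "cut_dist k W U \<le> vec_cut_norm k (\<lambda>a p. U a p - relabel \<phi> W a p)" by simp
qed

lemma cut_dist_sym:
  "U \<in> graphons k \<Longrightarrow> W \<in> graphons k \<Longrightarrow> cut_dist k U W = cut_dist k W U"
  by (simp add: antisym cut_dist_sym_le)

lemma cut_dist_triangle:
  assumes U: "U \<in> graphons k" and V: "V \<in> graphons k" and W: "W \<in> graphons k"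
  shows "cut_dist k U W \<le> cut_dist k U V + cut_dist k V W"
proof -
  have *: "cut_dist k U W \<le> vec_cut_norm k (\<lambda>a p. U a p - relabel \<phi> V a p)
      + vec_cut_norm k (\<lambda>a p. V a p - relabel \<psi> W a p)"
    if \<phi>: "\<phi> \<in> mp_bijections" and \<psi>: "\<psi> \<in> mp_bijections" for \<phi> \<psi>
  proof -
    have \<phi>m: "\<phi> \<in> mp_maps" using \<phi> unfolding mp_bijections_def by auto
    have c: "\<psi> \<circ> \<phi> \<in> mp_bijections" by (rule mp_bijections_comp[OF \<psi> \<phi>])
    have "cut_norm (\<lambda>p. U a p - relabel (\<psi> \<circ> \<phi>) W a p) \<le>
        cut_norm (\<lambda>p. U a p - relabel \<phi> V a p) + cut_norm (\<lambda>p. V a p - relabel \<psi> W a p)"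
      if a: "a \<in> {1..k}" for a
    proof -
      let ?D = "\<lambda>p. V a p - relabel \<psi> W a p"
      have Z: "bounded_kernel (\<lambda>p. 0)" by (auto simp: bounded_kernel_def)
      have D: "bounded_kernel ?D"
        by (rule bounded_kernel_diff[OF graphon_bounded[OF V a] relabel_bounded[OF W a \<psi>]])
      have D': "bounded_kernel (\<lambda>(x, y). ?D (\<phi> x, \<phi> y))" by (rule bounded_kernel_comp[OF D \<phi>m])
      have F: "bounded_kernel (\<lambda>p. U a p - relabel \<phi> V a p)"
        by (rule bounded_kernel_diff[OF graphon_bounded[OF U a] relabel_bounded[OF V a \<phi>]])
      have G: "bounded_kernel (\<lambda>p. 0 - (\<lambda>(x, y). ?D (\<phi> x, \<phi> y)) p)" by (rule bounded_kernel_diff[OF Z D'])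
      have "cut_norm (\<lambda>p. U a p - relabel (\<psi> \<circ> \<phi>) W a p) \<le>
          cut_norm (\<lambda>p. U a p - relabel \<phi> V a p) + cut_norm (\<lambda>p. 0 - (\<lambda>(x, y). ?D (\<phi> x, \<phi> y)) p)"
        by (rule cut_norm_triangle[OF F G]) (auto simp: relabel_def fun_eq_iff)
      also have "cut_norm (\<lambda>p. 0 - (\<lambda>(x, y). ?D (\<phi> x, \<phi> y)) p)
          \<le> cut_norm (\<lambda>p. 0) + cut_norm (\<lambda>(x, y). ?D (\<phi> x, \<phi> y))"
        by (rule cut_norm_triangle[OF Z D']) simp
      also have "\<dots> \<le> cut_norm ?D" using cut_norm_comp_le[OF D \<phi>] by (simp add: cut_norm_zero)
      finally show ?thesis by simp
    qed
    then have "vec_cut_norm k (\<lambda>a p. U a p - relabel (\<psi> \<circ> \<phi>) W a p) \<le>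
        vec_cut_norm k (\<lambda>a p. U a p - relabel \<phi> V a p) + vec_cut_norm k (\<lambda>a p. V a p - relabel \<psi> W a p)"
      unfolding vec_cut_norm_def sum.distrib[symmetric] by (rule sum_mono)
    with cut_dist_lower[OF U W c] show ?thesis by simp
  qed
  have "cut_dist k U W - vec_cut_norm k (\<lambda>a p. V a p - relabel \<psi> W a p) \<le> cut_dist k U V"
    if "\<psi> \<in> mp_bijections" for \<psi>
    by (rule cut_dist_greatest) (use *[OF _ that] in \<open>simp add: algebra_simps\<close>)
  then have "cut_dist k U W - cut_dist k U V \<le> cut_dist k V W"
    by (intro cut_dist_greatest) (simp add: algebra_simps)
  then show ?thesis by simp
qed

lemma equiv_cut_rel: "equiv (graphons k) (cut_rel k)"
proof (rule equivI)
  show "refl_on (graphons k) (cut_rel k)"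
    unfolding refl_on_def cut_rel_def using cut_dist_refl by auto
  show "sym (cut_rel k)" unfolding sym_def cut_rel_def using cut_dist_sym by auto
  show "cut_rel k \<subseteq> graphons k \<times> graphons k" unfolding cut_rel_def by auto
  show "trans (cut_rel k)"
  proof (rule transI)
    fix U V W assume "(U, V) \<in> cut_rel k" "(V, W) \<in> cut_rel k"
    then show "(U, W) \<in> cut_rel k"
      using cut_dist_triangle[of U k V W] cut_dist_nonneg[of U k W] unfolding cut_rel_def by auto
  qed
qed

lemma graphon_class_in: "W \<in> graphons k \<Longrightarrow> graphon_class k W \<in> graphon_space k"
  unfolding graphon_class_def graphon_space_def by (rule quotientI)

lemma representative_in:
  assumes "A \<in> graphon_space k"
  shows "representative A \<in> A" "representative A \<in> graphons k" "graphon_class k (representative A) = A"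
proof -
  obtain W where W: "W \<in> graphons k" "A = cut_rel k `` {W}"
    using assms unfolding graphon_space_def by (rule quotientE)
  have "W \<in> A" using equiv_class_self[OF equiv_cut_rel W(1)] W(2) by simp
  then show r: "representative A \<in> A" unfolding representative_def by (rule someI[where P = "\<lambda>W. W \<in> A"])
  then show "representative A \<in> graphons k" using W(2) unfolding cut_rel_def by auto
  have "(W, representative A) \<in> cut_rel k" using r W(2) by auto
  then show "graphon_class k (representative A) = A"
    unfolding graphon_class_def W(2)[symmetric]
    using equiv_class_eq[OF equiv_cut_rel] W(2) by metis
qed

lemma representative_class:
  assumes "W \<in> graphons k" shows "cut_dist k W (representative (graphon_class k W)) = 0"
  using representative_in(1)[OF graphon_class_in[OF assms]] unfolding graphon_class_def cut_rel_def by auto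

lemma class_dist_class:
  assumes U: "U \<in> graphons k" and W: "W \<in> graphons k"
  shows "class_dist k (graphon_class k U) (graphon_class k W) = cut_dist k U W"
proof -
  let ?U = "representative (graphon_class k U)" and ?W = "representative (graphon_class k W)"
  have g: "?U \<in> graphons k" "?W \<in> graphons k"
    using representative_in(2) graphon_class_in U W by auto
  note z = representative_class[OF U] representative_class[OF W]
  note s = cut_dist_sym[OF U g(1)] cut_dist_sym[OF W g(2)]
  have "cut_dist k ?U ?W = cut_dist k U W"
    using z s cut_dist_triangle[OF g(1) U g(2)] cut_dist_triangle[OF U W g(2)]
      cut_dist_triangle[OF U g(1) W] cut_dist_triangle[OF g(1) g(2) W]
    by linarith
  then show ?thesis
    unfolding class_dist_def using graphon_class_in[OF U] graphon_class_in[OF W] by simp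
qed

lemma Metric_space_graphons: "Metric_space (graphon_space k) (class_dist k)"
proof
  fix A B :: "kernel set"
  show "0 \<le> class_dist k A B"
    unfolding class_dist_def using representative_in(2) cut_dist_nonneg by auto
  show "class_dist k A B = class_dist k B A"
    unfolding class_dist_def using representative_in(2) cut_dist_sym by auto
next
  fix A B assume A: "A \<in> graphon_space k" and B: "B \<in> graphon_space k"
  note r = representative_in[OF A] representative_in[OF B]
  have "class_dist k A B = 0 \<longleftrightarrow> (representative A, representative B) \<in> cut_rel k"
    unfolding class_dist_def cut_rel_def using A B r by auto
  also have "\<dots> \<longleftrightarrow> graphon_class k (representative A) = graphon_class k (representative B)"
    unfolding graphon_class_def by (rule eq_equiv_class_iff[OF equiv_cut_rel r(2,5), symmetric])
  also have "\<dots> \<longleftrightarrow> A = B" using r(3,6) by simp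
  finally show "class_dist k A B = 0 \<longleftrightarrow> A = B" .
next
  fix A B C assume "A \<in> graphon_space k" "B \<in> graphon_space k" "C \<in> graphon_space k"
  then show "class_dist k A C \<le> class_dist k A B + class_dist k B C"
    unfolding class_dist_def using representative_in(2) cut_dist_triangle by auto
qed

lemma empirical_graphon_in:
  assumes k: "k \<ge> 1" and X: "X \<in> colorings k n"
  shows "empirical_graphon k n X \<in> graphons k"
proof -
  have ins: "{u, v} \<in> complete_edges n" if "u \<in> {1..n}" "v \<in> {1..n}" "u \<noteq> v" for u v
    using that unfolding complete_edges_def by auto
  have col: "X {u, v} \<in> {1..k}" if "u \<in> {1..n}" "v \<in> {1..n}" "u \<noteq> v" for u v
    using X ins[OF that] unfolding colorings_def by auto
  have b: "nat \<lceil>real n * x\<rceil> \<le> n" if "x \<in> {0..1}" for x :: real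
    using that mult_left_le[of x "real n"] by (simp add: ceiling_le_iff)
  have m: "(\<lambda>x. nat \<lceil>real n * x\<rceil>) \<in> measurable unit_measure (count_space UNIV)"
  proof -
    have "(\<lambda>x::real. nat \<lceil>real n * x\<rceil>) \<in> measurable borel (count_space UNIV)" by measurable
    then show ?thesis unfolding unit_measure_def by (intro measurable_restrict_space1) simp
  qed
  have "(\<lambda>a. empirical_graphon k n X a (x, y)) \<in> prob_simplex k" for x y
  proof -
    define u v where "u = nat \<lceil>real n * x\<rceil>" and "v = nat \<lceil>real n * y\<rceil>"
    show ?thesis
    proof (cases "u \<in> {1..n} \<and> v \<in> {1..n} \<and> u \<noteq> v")
      case True
      then have "(\<lambda>a. empirical_graphon k n X a (x, y)) = (\<lambda>a. of_bool (X {u, v} = a))"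
        unfolding empirical_graphon_def u_def v_def by (auto simp: Let_def)
      moreover have "(\<Sum>a=1..k. of_bool (X {u, v} = a) :: real) = 1"
        using col[of u v] True by (simp add: of_bool_def)
      ultimately show ?thesis unfolding prob_simplex_def by auto
    next
      case False
      then have "(\<lambda>a. empirical_graphon k n X a (x, y)) = (\<lambda>a. 1 / real k)"
        unfolding empirical_graphon_def u_def v_def by (auto simp: Let_def)
      then show ?thesis using k unfolding prob_simplex_def by auto
    qed
  qed
  moreover have "empirical_graphon k n X a \<in> borel_measurable square_measure" for a
  proof -
    let ?g = "\<lambda>(u, v). if u \<in> {1..n} \<and> v \<in> {1..n} \<and> u \<noteq> v then of_bool (X {u, v} = a) else 1 / real k"
    have e: "empirical_graphon k n X a = ?g \<circ> (\<lambda>(x, y). (nat \<lceil>real n * x\<rceil>, nat \<lceil>real n * y\<rceil>))"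
      by (auto simp: empirical_graphon_def Let_def fun_eq_iff)
    have "(\<lambda>(x, y). (nat \<lceil>real n * x\<rceil>, nat \<lceil>real n * y\<rceil>))
        \<in> measurable square_measure (count_space UNIV \<Otimes>\<^sub>M count_space UNIV)"
      using m by measurable
    then have "(\<lambda>(x, y). (nat \<lceil>real n * x\<rceil>, nat \<lceil>real n * y\<rceil>))
        \<in> measurable square_measure (count_space UNIV)"
      by (simp add: pair_measure_countable)
    then show ?thesis unfolding e by (rule measurable_comp) simp
  qed
  moreover have "empirical_graphon k n X a (x, y) = empirical_graphon k n X a (y, x)" for a x y
    unfolding empirical_graphon_def by (auto simp: Let_def insert_commute)
  ultimately show ?thesis unfolding graphons_def by blast
qed

end

theory Submission
  imports Defs
begin

text \<open>
  Upper bound.  Weak regularity splits the colourings into \<open>e\<^bsup>O(n)\<^esup>\<close> cells whose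
  empirical graphons are uniformly close in cut norm.  One cell \<open>B\<close> carries the sum up to
  a factor \<open>e\<^bsup>O(n)\<^esup>\<close>, and subadditivity of Shannon entropy gives
  \<open>ln |B| \<le> - n\<^sup>2/2 \<cdot> I(V)\<close> for the average \<open>V\<close> of the empirical graphons over \<open>B\<close>,
  which is close to each of them.  Empirical graphons are totally bounded for the cut distance,
  and the space of classes is complete, so as \<open>n \<rightarrow> \<infinity>\<close> a subsequence converges to a class
  whose entropy is controlled by lower semicontinuity.

  Lower bound.  Given \<open>W\<close>, colour the edges independently, with the averages of \<open>W\<close> over the
  blocks of the \<open>n \<times> n\<close> grid as probabilities.  The Gibbs variational principle bounds
  \<open>n\<^sup>2 \<psi>\<^sub>n\<close> below by \<open>n\<^sup>2\<close> times the mean of \<open>T\<close> plus the entropy of this product measure, which is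
  at least \<open>- n\<^sup>2/2 \<cdot> I(W) - O(n)\<close> by convexity; a Chernoff and union bound shows that the
  sampled graphon is close to \<open>W\<close>.
\<close>

section \<open>Step kernels and the cut norm\<close>

text \<open>No modulus of continuity of \<open>T\<close> is available, so errors are measured in cut
  norm and sent to zero before \<open>T\<close> is evaluated at a limit. For this reason the upper
  bound keeps, for each \<eta>, one colouring and one average graphon: \<open>T\<close> is taken at
  the former, the entropy at the latter, and only a common limit point brings them together. The
  entropy is merely lower semicontinuous, which is the direction that an upper bound requires.

  Regularity is affordable because a cell is described by a class map of the vertices and a
  coefficient table from a finite set independent of n; their number is invisible on the scale exp
  (n^2). The same gap of scales lets a deviation probability exp (- c n^2) beat the 4^n pairs of
  vertex sets.

  The factor 1/2 reflects that an edge fills two blocks of the square, while the n diagonal blocks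
  have total area 1/n. Young's inequality for x ln x serves both bounds: as duality behind
  semicontinuity and as the source of Jensen's inequality for block averages.\<close>

definition cell_index :: "nat \<Rightarrow> real \<Rightarrow> nat" where
  "cell_index n x = nat \<lceil>real n * x\<rceil>"

text \<open>For n \<ge> 1 the cell with index 0 is the single point 0, a null set. Hence sums run
  over \<open>{1..n}\<close> and most identities below hold only almost everywhere.\<close>

definition block :: "nat \<Rightarrow> nat \<Rightarrow> real set" where
  "block n u = {x \<in> {0..1}. cell_index n x = u}"

definition step_kernel :: "nat \<Rightarrow> (nat \<Rightarrow> nat \<Rightarrow> real) \<Rightarrow> real \<times> real \<Rightarrow> real" where
  "step_kernel n R = (\<lambda>(x, y). R (cell_index n x) (cell_index n y))"

lemma cell_index_le: "x \<in> {0..1} \<Longrightarrow> cell_index n x \<le> n"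
  using mult_left_le[of x "real n"] by (simp add: cell_index_def ceiling_le_iff)

lemma cell_index_pos: "n \<ge> 1 \<Longrightarrow> 0 < x \<Longrightarrow> 1 \<le> cell_index n x"
  by (simp add: cell_index_def Suc_le_eq)

lemma cell_index_measurable [measurable]:
  "cell_index n \<in> measurable unit_measure (count_space UNIV)"
proof -
  have "(\<lambda>x::real. nat \<lceil>real n * x\<rceil>) \<in> measurable borel (count_space UNIV)" by measurable
  then show ?thesis unfolding unit_measure_def cell_index_def[abs_def] by (intro measurable_restrict_space1) simp
qed

lemma block_sets [measurable, simp]: "block n u \<in> sets unit_measure"
proof -
  have "block n u = cell_index n -` {u} \<inter> space unit_measure"
    by (auto simp: block_def)
  then show ?thesis using measurable_sets[OF cell_index_measurable, of "{u}" n] by simp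
qed

lemma block_eq:
  assumes "u \<in> {1..n}"
  shows "block n u = {(real u - 1) / real n <.. real u / real n}"
proof -
  have n: "real n > 0" using assms by auto
  have "x \<in> block n u \<longleftrightarrow> (real u - 1) / real n < x \<and> x \<le> real u / real n" for x
  proof -
    have "(real u - 1) / real n < x \<and> x \<le> real u / real n \<longleftrightarrow> \<lceil>real n * x\<rceil> = int u"
      unfolding ceiling_eq_iff pos_divide_less_eq[OF n] pos_le_divide_eq[OF n] by (simp add: mult.commute)
    moreover have "\<lceil>real n * x\<rceil> = int u \<longleftrightarrow> cell_index n x = u"
      using assms by (auto simp: cell_index_def)
    moreover have "x \<in> {0..1}" if "(real u - 1) / real n < x" "x \<le> real u / real n"
    proof -
      have "0 \<le> (real u - 1) / real n" "real u / real n \<le> 1" using assms by auto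
      then show ?thesis using that unfolding atLeastAtMost_iff by linarith
    qed
    ultimately show ?thesis unfolding block_def by blast
  qed
  then show ?thesis by (simp add: set_eq_iff)
qed

lemma block_subset: "block n u \<subseteq> {0..1}"
  by (auto simp: block_def)

lemma measure_unit_eq:
  assumes "A \<in> sets unit_measure" shows "measure unit_measure A = measure lborel A"
  using assms unfolding unit_measure_def
  by (auto simp: measure_restrict_space sets_restrict_space)

lemma measure_block:
  assumes "u \<in> {1..n}" shows "measure unit_measure (block n u) = 1 / real n"
proof -
  have "(real u - 1) / real n \<le> real u / real n" by (simp add: divide_right_mono)
  then have "measure lborel (block n u) = real u / real n - (real u - 1) / real n"
    unfolding block_eq[OF assms] by (subst measure_lborel_Ioc) auto
  then show ?thesis using measure_unit_eq[OF block_sets, of n u] by (simp add: diff_divide_distrib)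
qed

lemma AE_unit_pos: "AE x in unit_measure. 0 < x"
proof (rule AE_I')
  show "{0} \<in> null_sets unit_measure"
    unfolding unit_measure_def by (subst null_sets_restrict_space) auto
qed auto

lemma AE_cell_index:
  assumes "n \<ge> 1" shows "AE x in unit_measure. cell_index n x \<in> {1..n}"
  using AE_unit_pos AE_space
  by eventually_elim (use cell_index_le cell_index_pos[OF assms] in auto)

lemma measure_rect:
  assumes "S \<in> sets unit_measure" "T \<in> sets unit_measure"
  shows "measure square_measure (S \<times> T) = measure unit_measure S * measure unit_measure T"
  using UM.emeasure_pair_measure_Times[OF assms] by (simp add: measure_def enn2real_mult)

lemma measure_square_space: "measure square_measure (space square_measure) = 1"
  unfolding space_pair_measure
  by (subst measure_rect) (use prob_space_unit in \<open>auto simp: measure_def\<close>)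

lemma integral_square_const [simp]: "(\<integral>p. c \<partial>square_measure) = (c::real)"
  using measure_square_space by simp

lemma step_kernel_measurable [measurable]: "step_kernel n R \<in> borel_measurable square_measure"
proof -
  have e: "step_kernel n R = (\<lambda>(u, v). R u v) \<circ> (\<lambda>(x, y). (cell_index n x, cell_index n y))"
    by (auto simp: step_kernel_def fun_eq_iff)
  have "(\<lambda>(x, y). (cell_index n x, cell_index n y))
      \<in> measurable square_measure (count_space UNIV \<Otimes>\<^sub>M count_space UNIV)"
    by measurable
  then have "(\<lambda>(x, y). (cell_index n x, cell_index n y))
      \<in> measurable square_measure (count_space UNIV)"
    by (simp add: pair_measure_countable)
  then show ?thesis unfolding e by (rule measurable_comp) simp
qed

text \<open>The matrix \<open>R\<close> is arbitrary, but on the unit square only its entries with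
  indices up to n are read, and the sum of their absolute values bounds the kernel.\<close>

lemma step_kernel_bounded: "bounded_kernel (step_kernel n R)"
  unfolding bounded_kernel_def
proof (intro conjI step_kernel_measurable exI ballI)
  fix p assume "p \<in> space square_measure"
  then obtain x y where p: "p = (x, y)" "x \<in> {0..1}" "y \<in> {0..1}" by (auto simp: space_pair_measure)
  have "\<bar>R (cell_index n x) (cell_index n y)\<bar> \<le> (\<Sum>v\<le>n. \<bar>R (cell_index n x) v\<bar>)"
    using cell_index_le[OF p(3)] by (intro member_le_sum) auto
  also have "\<dots> \<le> (\<Sum>u\<le>n. \<Sum>v\<le>n. \<bar>R u v\<bar>)"
    using cell_index_le[OF p(2)] by (intro member_le_sum[where f = "\<lambda>u. \<Sum>v\<le>n. \<bar>R u v\<bar>"]) (auto intro: sum_nonneg)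
  finally show "\<bar>step_kernel n R p\<bar> \<le> (\<Sum>u\<le>n. \<Sum>v\<le>n. \<bar>R u v\<bar>)"
    by (simp add: step_kernel_def p)
qed

lemma step_kernel_diff: "step_kernel n (\<lambda>u v. R u v - Q u v) = (\<lambda>p. step_kernel n R p - step_kernel n Q p)"
  by (auto simp: step_kernel_def)

lemma integral_blocks:
  assumes n: "n \<ge> 1" and f: "integrable square_measure (f :: real \<times> real \<Rightarrow> real)"
  shows "integral\<^sup>L square_measure f =
    (\<Sum>u=1..n. \<Sum>v=1..n. set_lebesgue_integral square_measure (block n u \<times> block n v) f)"
proof -
  have i: "set_integrable square_measure (block n u \<times> block n v) f" for u v
    unfolding set_integrable_def using f by (intro integrable_mult_indicator) auto
  have "AE p in square_measure.
      f p = (\<Sum>u=1..n. \<Sum>v=1..n. indicator (block n u \<times> block n v) p *\<^sub>R f p)"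
    using AE_square[OF AE_cell_index[OF n]] AE_space
  proof eventually_elim
    case (elim p)
    obtain x y where p: "p = (x, y)" by (cases p)
    have xy: "x \<in> {0..1}" "y \<in> {0..1}" using elim(2) p by (auto simp: space_pair_measure)
    have "(\<Sum>u=1..n. \<Sum>v=1..n. indicator (block n u \<times> block n v) p *\<^sub>R f p) =
       (\<Sum>u=1..n. \<Sum>v=1..n. if v = cell_index n y then if u = cell_index n x then f p else 0 else 0)"
      by (intro sum.cong) (use xy in \<open>auto simp: p block_def indicator_def\<close>)
    also have "\<dots> = f p" using elim(1) p by (auto simp: sum.delta)
    finally show ?case by simp
  qed
  then have "integral\<^sup>L square_measure f =
     (\<integral>p. (\<Sum>u=1..n. \<Sum>v=1..n. indicator (block n u \<times> block n v) p *\<^sub>R f p) \<partial>square_measure)"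
    using f i by (intro integral_cong_AE) (auto simp: set_integrable_def)
  also have "\<dots> = (\<Sum>u=1..n. \<integral>p. (\<Sum>v=1..n. indicator (block n u \<times> block n v) p *\<^sub>R f p) \<partial>square_measure)"
    using i unfolding set_integrable_def by (intro Bochner_Integration.integral_sum Bochner_Integration.integrable_sum)
  also have "\<dots> = (\<Sum>u=1..n. \<Sum>v=1..n. set_lebesgue_integral square_measure (block n u \<times> block n v) f)"
    unfolding set_lebesgue_integral_def
    using i unfolding set_integrable_def by (intro sum.cong refl Bochner_Integration.integral_sum)
  finally show ?thesis .
qed

text \<open>The integral over a rectangle becomes a bilinear form in two vectors of slice measures
  with entries in [0, 1/n]. This reduces the cut norm of a step kernel to a finite problem.\<close>

lemma set_integral_step_kernel:
  assumes n: "n \<ge> 1" and S: "S \<in> sets unit_measure" "T \<in> sets unit_measure"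
  shows "set_lebesgue_integral square_measure (S \<times> T) (step_kernel n R) =
    (\<Sum>u=1..n. \<Sum>v=1..n. R u v * (measure unit_measure (S \<inter> block n u) * measure unit_measure (T \<inter> block n v)))"
proof -
  let ?f = "\<lambda>p. indicator (S \<times> T) p *\<^sub>R step_kernel n R p"
  have "integrable square_measure ?f"
    using bounded_kernel_set_integrable[OF step_kernel_bounded S] by (simp add: set_integrable_def)
  then have "set_lebesgue_integral square_measure (S \<times> T) (step_kernel n R) =
     (\<Sum>u=1..n. \<Sum>v=1..n. set_lebesgue_integral square_measure (block n u \<times> block n v) ?f)"
    unfolding set_lebesgue_integral_def[of _ "S \<times> T"] by (rule integral_blocks[OF n])
  also have "\<dots> = (\<Sum>u=1..n. \<Sum>v=1..n. R u v * (measure unit_measure (S \<inter> block n u) * measure unit_measure (T \<inter> block n v)))"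
  proof (intro sum.cong refl)
    fix u v
    have "(\<lambda>p. indicat_real (block n u \<times> block n v) p *\<^sub>R ?f p) =
       (\<lambda>p. R u v * indicat_real ((S \<inter> block n u) \<times> (T \<inter> block n v)) p)"
      by (auto simp: fun_eq_iff indicator_def step_kernel_def block_def)
    moreover have m: "(S \<inter> block n u) \<times> (T \<inter> block n v) \<in> sets square_measure" using S by auto
    moreover have "measure square_measure ((S \<inter> block n u) \<times> (T \<inter> block n v)) =
        measure unit_measure (S \<inter> block n u) * measure unit_measure (T \<inter> block n v)"
      using S by (intro measure_rect) auto
    ultimately show "set_lebesgue_integral square_measure (block n u \<times> block n v) ?f =
        R u v * (measure unit_measure (S \<inter> block n u) * measure unit_measure (T \<inter> block n v))"
      unfolding set_lebesgue_integral_def by (simp add: sets.Int_space_eq2)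
  qed
  finally show ?thesis .
qed

lemma integral_step_kernel:
  assumes n: "n \<ge> 1"
  shows "(\<integral>p. step_kernel n R p \<partial>square_measure) = (\<Sum>u=1..n. \<Sum>v=1..n. R u v) / (real n)\<^sup>2"
proof -
  have "(\<integral>p. step_kernel n R p \<partial>square_measure) =
     set_lebesgue_integral square_measure ({0..1} \<times> {0..1}) (step_kernel n R)"
    unfolding set_lebesgue_integral_def
    by (intro Bochner_Integration.integral_cong) (auto simp: space_pair_measure)
  also have "\<dots> = (\<Sum>u=1..n. \<Sum>v=1..n. R u v * (1 / real n * (1 / real n)))"
    unfolding set_integral_step_kernel[OF n unit_interval_sets unit_interval_sets]
    by (intro sum.cong refl) (simp add: Int_absorb1[OF block_subset] measure_block del: One_nat_def)
  also have "\<dots> = (\<Sum>u=1..n. \<Sum>v=1..n. R u v) / (real n)\<^sup>2"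
    by (simp add: sum_divide_distrib power2_eq_square)
  finally show ?thesis .
qed

text \<open>A linear form on a box is extremal at a vertex: the terms with positive and those with
  nonpositive coefficients have opposite signs, so one of the two groups alone dominates the sum,
  and raising its coordinates to \<open>b\<close> only enlarges it.\<close>

lemma linear_form_vertex:
  fixes c s :: "'a \<Rightarrow> real"
  assumes "finite U" and s: "\<And>u. u \<in> U \<Longrightarrow> 0 \<le> s u \<and> s u \<le> b"
  shows "\<exists>V\<subseteq>U. \<bar>\<Sum>u\<in>U. c u * s u\<bar> \<le> \<bar>\<Sum>u\<in>V. c u\<bar> * b"
proof (cases "U = {}")
  case False
  then have b: "0 \<le> b" using s by force
  let ?P = "{u \<in> U. c u > 0}" and ?N = "{u \<in> U. c u \<le> 0}"
  have U: "(\<Sum>u\<in>U. c u * s u) = (\<Sum>u\<in>?P. c u * s u) + (\<Sum>u\<in>?N. c u * s u)"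
    using assms(1) by (subst sum.union_disjoint[symmetric]) (auto intro!: sum.cong)
  have P: "0 \<le> (\<Sum>u\<in>?P. c u * s u)" "(\<Sum>u\<in>?P. c u * s u) \<le> (\<Sum>u\<in>?P. c u * b)"
    using s by (auto intro!: sum_nonneg sum_mono mult_left_mono)
  have N: "(\<Sum>u\<in>?N. c u * s u) \<le> 0" "(\<Sum>u\<in>?N. c u * s u) \<ge> (\<Sum>u\<in>?N. c u * b)"
    using s by (auto intro!: sum_nonpos sum_mono mult_left_mono_neg simp: mult_nonpos_nonneg)
  have pb: "(\<Sum>u\<in>?P. c u * b) = (\<Sum>u\<in>?P. c u) * b" "(\<Sum>u\<in>?N. c u * b) = (\<Sum>u\<in>?N. c u) * b"
    by (simp_all add: sum_distrib_right)
  have "\<bar>\<Sum>u\<in>U. c u * s u\<bar> \<le> \<bar>\<Sum>u\<in>?P. c u\<bar> * b \<or> \<bar>\<Sum>u\<in>U. c u * s u\<bar> \<le> \<bar>\<Sum>u\<in>?N. c u\<bar> * b"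
  proof -
    have e: "\<bar>x\<bar> * b = \<bar>x * b\<bar>" for x using b by (simp add: abs_mult)
    show ?thesis using P N unfolding e pb[symmetric] U by linarith
  qed
  then show ?thesis
  proof
    assume "\<bar>\<Sum>u\<in>U. c u * s u\<bar> \<le> \<bar>\<Sum>u\<in>?P. c u\<bar> * b" then show ?thesis by (intro exI[of _ ?P]) simp
  next
    assume "\<bar>\<Sum>u\<in>U. c u * s u\<bar> \<le> \<bar>\<Sum>u\<in>?N. c u\<bar> * b" then show ?thesis by (intro exI[of _ ?N]) simp
  qed
qed auto

text \<open>The bilinear form is rounded to a vertex in the variables \<open>s\<close>, then, with
  that vertex set fixed, in the variables \<open>t\<close>. Each rounding contributes a factor 1/n,
  and together they cancel the n^2 of the hypothesis.\<close>

lemma cut_norm_step_kernel_le: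
  assumes n: "n \<ge> 1" and R: "\<And>S T. S \<subseteq> {1..n} \<Longrightarrow> T \<subseteq> {1..n} \<Longrightarrow> \<bar>\<Sum>u\<in>S. \<Sum>v\<in>T. R u v\<bar> \<le> c * (real n)\<^sup>2"
  shows "cut_norm (step_kernel n R) \<le> c"
proof (rule cut_norm_least)
  fix S T assume S: "S \<in> sets unit_measure" and T: "T \<in> sets unit_measure"
  define s where "s u = measure unit_measure (S \<inter> block n u)" for u
  define t where "t v = measure unit_measure (T \<inter> block n v)" for v
  have s: "0 \<le> s u \<and> s u \<le> 1 / real n" if "u \<in> {1..n}" for u
    unfolding s_def measure_block[OF that, symmetric] using S
    by (auto intro!: UM.finite_measure_mono)
  have t: "0 \<le> t u \<and> t u \<le> 1 / real n" if "u \<in> {1..n}" for u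
    unfolding t_def measure_block[OF that, symmetric] using T
    by (auto intro!: UM.finite_measure_mono)
  obtain V where V: "V \<subseteq> {1..n}" "\<bar>\<Sum>u\<in>{1..n}. (\<Sum>v=1..n. R u v * t v) * s u\<bar> \<le> \<bar>\<Sum>u\<in>V. \<Sum>v=1..n. R u v * t v\<bar> * (1 / real n)"
    using linear_form_vertex[of "{1..n}" s "1 / real n" "\<lambda>u. \<Sum>v=1..n. R u v * t v"] s by auto
  obtain V' where V': "V' \<subseteq> {1..n}" "\<bar>\<Sum>v\<in>{1..n}. (\<Sum>u\<in>V. R u v) * t v\<bar> \<le> \<bar>\<Sum>v\<in>V'. \<Sum>u\<in>V. R u v\<bar> * (1 / real n)"
    using linear_form_vertex[of "{1..n}" t "1 / real n" "\<lambda>v. \<Sum>u\<in>V. R u v"] t by auto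
  have "\<bar>set_lebesgue_integral square_measure (S \<times> T) (step_kernel n R)\<bar> = \<bar>\<Sum>u\<in>{1..n}. (\<Sum>v=1..n. R u v * t v) * s u\<bar>"
    unfolding set_integral_step_kernel[OF n S T] s_def t_def
    by (simp add: sum_distrib_left sum_distrib_right mult_ac)
  also note V(2)
  also have "(\<Sum>u\<in>V. \<Sum>v=1..n. R u v * t v) = (\<Sum>v\<in>{1..n}. (\<Sum>u\<in>V. R u v) * t v)"
    by (subst sum.swap) (simp add: sum_distrib_right)
  also have "\<bar>\<dots>\<bar> * (1 / real n) \<le> \<bar>\<Sum>v\<in>V'. \<Sum>u\<in>V. R u v\<bar> * (1 / real n) * (1 / real n)"
    using V'(2) by (intro mult_right_mono) auto
  also have "(\<Sum>v\<in>V'. \<Sum>u\<in>V. R u v) = (\<Sum>u\<in>V. \<Sum>v\<in>V'. R u v)" by (rule sum.swap)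
  also have "\<bar>\<dots>\<bar> * (1 / real n) * (1 / real n) \<le> c * (real n)\<^sup>2 * (1 / real n) * (1 / real n)"
    using R[OF V(1) V'(1)] by (intro mult_right_mono) auto
  also have "\<dots> = c" using n by (simp add: power2_eq_square)
  finally show "\<bar>set_lebesgue_integral square_measure (S \<times> T) (step_kernel n R)\<bar> \<le> c" .
qed

lemma cut_norm_le_L1:
  assumes "integrable square_measure F"
  shows "cut_norm F \<le> (\<integral>p. \<bar>F p\<bar> \<partial>square_measure)"
proof (rule cut_norm_least)
  fix S T assume "S \<in> sets unit_measure" "T \<in> sets unit_measure"
  have "\<bar>set_lebesgue_integral square_measure (S \<times> T) F\<bar>
      \<le> (\<integral>p. norm (indicator (S \<times> T) p *\<^sub>R F p) \<partial>square_measure)"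
    unfolding set_lebesgue_integral_def real_norm_def[symmetric] by (rule integral_norm_bound)
  also have "\<dots> \<le> (\<integral>p. \<bar>F p\<bar> \<partial>square_measure)"
    using assms \<open>S \<in> _\<close> \<open>T \<in> _\<close>
    by (intro integral_mono integrable_norm integrable_mult_indicator)
      (auto simp: indicator_def)
  finally show "\<bar>set_lebesgue_integral square_measure (S \<times> T) F\<bar> \<le> (\<integral>p. \<bar>F p\<bar> \<partial>square_measure)" .
qed

section \<open>Weak regularity\<close>

text \<open>Without the range test of \<open>empirical_graphon\<close> the two kernels can differ
  only where a coordinate has cell index 0, hence on a null set.\<close>

definition color_matrix :: "nat \<Rightarrow> (nat set \<Rightarrow> nat) \<Rightarrow> nat \<Rightarrow> nat \<Rightarrow> nat \<Rightarrow> real" where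
  "color_matrix k X a u v = (if u \<noteq> v then of_bool (X {u, v} = a) else 1 / real k)"

lemma color_matrix_bounds: "0 \<le> color_matrix k X a u v" "color_matrix k X a u v \<le> 1"
  by (auto simp: color_matrix_def of_bool_def divide_le_eq)

lemma color_matrix_abs: "\<bar>color_matrix k X a u v\<bar> \<le> 1"
  using color_matrix_bounds[of k X a u v] by linarith

lemma empirical_graphon_eq_step:
  "empirical_graphon k n X a =
    step_kernel n (\<lambda>u v. if u \<in> {1..n} \<and> v \<in> {1..n} \<and> u \<noteq> v then of_bool (X {u, v} = a) else 1 / real k)"
  by (auto simp: empirical_graphon_def step_kernel_def cell_index_def Let_def fun_eq_iff)

lemma empirical_graphon_measurable [measurable]:
  "empirical_graphon k n X a \<in> borel_measurable square_measure"
  unfolding empirical_graphon_eq_step by (rule step_kernel_measurable)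

lemma empirical_graphon_AE:
  assumes "n \<ge> 1"
  shows "AE p in square_measure. empirical_graphon k n X a p = step_kernel n (color_matrix k X a) p"
  using AE_square[OF AE_cell_index[OF assms]]
proof eventually_elim
  case (elim p)
  then show ?case
    by (cases p) (simp add: empirical_graphon_def step_kernel_def color_matrix_def cell_index_def Let_def)
qed

lemma cut_norm_empirical_minus_step:
  assumes n: "n \<ge> 1"
  shows "cut_norm (\<lambda>z. empirical_graphon k n X a z - step_kernel n Q z) =
    cut_norm (step_kernel n (\<lambda>u v. color_matrix k X a u v - Q u v))"
proof (rule cut_norm_cong_AE)
  show "AE z in square_measure. empirical_graphon k n X a z - step_kernel n Q z =
      step_kernel n (\<lambda>u v. color_matrix k X a u v - Q u v) z"
    unfolding step_kernel_diff using empirical_graphon_AE[OF n, of k X a] by eventually_elim simp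
qed measurable

text \<open>Removing a rectangle with the fixed coefficient \<open>\<plusminus>\<epsilon>\<close>, rather than with the optimal one, still
  lowers the energy by \<open>\<epsilon>\<^sup>2 n\<^sup>2\<close> and leaves only finitely many possible coefficients.\<close>

lemma energy_decrement:
  fixes R :: "nat \<Rightarrow> nat \<Rightarrow> real"
  assumes S: "S \<subseteq> {1..n}" "T \<subseteq> {1..n}" and "\<epsilon> > 0"
    and s: "\<sigma> \<in> {-1, 1}" "\<sigma> * (\<Sum>u\<in>S. \<Sum>v\<in>T. R u v) \<ge> \<epsilon> * (real n)\<^sup>2"
  shows "(\<Sum>u=1..n. \<Sum>v=1..n. (R u v - \<epsilon> * (\<sigma> * of_bool (u \<in> S \<and> v \<in> T)))\<^sup>2)
    \<le> (\<Sum>u=1..n. \<Sum>v=1..n. (R u v)\<^sup>2) - \<epsilon>\<^sup>2 * (real n)\<^sup>2"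
proof -
  let ?b = "\<lambda>u v. of_bool (u \<in> S \<and> v \<in> T) :: real"
  \<comment> \<open>\<open>\<sigma>\<close> squares to 1 and the indicator to itself, so the
    quadratic term is just \<open>\<epsilon>\<^sup>2\<close> on the rectangle.\<close>
  have e: "(R u v - \<epsilon> * (\<sigma> * ?b u v))\<^sup>2 = (R u v)\<^sup>2 - 2 * \<epsilon> * \<sigma> * (R u v * ?b u v) + \<epsilon>\<^sup>2 * ?b u v" for u v
    using s(1) by (auto simp: power2_eq_square algebra_simps)
  have ind: "(\<Sum>u=1..n. \<Sum>v=1..n. f u v * ?b u v) = (\<Sum>u\<in>S. \<Sum>v\<in>T. f u v)" for f :: "nat \<Rightarrow> nat \<Rightarrow> real"
  proof -
    have "(\<Sum>u\<in>S. \<Sum>v\<in>T. f u v) = (\<Sum>u\<in>S. \<Sum>v=1..n. f u v * ?b u v)"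
      using S finite_subset[OF S(2)]
      by (intro sum.cong refl sum.mono_neutral_cong_left) auto
    also have "\<dots> = (\<Sum>u=1..n. \<Sum>v=1..n. f u v * ?b u v)"
      using S finite_subset[OF S(1)] by (intro sum.mono_neutral_left) auto
    finally show ?thesis by simp
  qed
  have "(\<Sum>u=1..n. \<Sum>v=1..n. ?b u v) = (\<Sum>u\<in>S. \<Sum>v\<in>T. 1)"
    using ind[of "\<lambda>_ _. 1"] by (simp del: sum_constant)
  also have "\<dots> \<le> (real n)\<^sup>2"
  proof -
    have "card S \<le> n" "card T \<le> n" using card_mono[OF _ S(1)] card_mono[OF _ S(2)] by auto
    then show ?thesis by (simp add: power2_eq_square mult_mono)
  qed
  finally have b: "\<epsilon>\<^sup>2 * (\<Sum>u=1..n. \<Sum>v=1..n. ?b u v) \<le> \<epsilon>\<^sup>2 * (real n)\<^sup>2" by (intro mult_left_mono) auto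
  have c: "2 * \<epsilon> * (\<epsilon> * (real n)\<^sup>2) \<le> 2 * \<epsilon> * (\<sigma> * (\<Sum>u\<in>S. \<Sum>v\<in>T. R u v))"
    using s(2) \<open>\<epsilon> > 0\<close> by (intro mult_left_mono) auto
  have "(\<Sum>u=1..n. \<Sum>v=1..n. (R u v - \<epsilon> * (\<sigma> * ?b u v))\<^sup>2) =
     (\<Sum>u=1..n. \<Sum>v=1..n. (R u v)\<^sup>2) - 2 * \<epsilon> * \<sigma> * (\<Sum>u=1..n. \<Sum>v=1..n. R u v * ?b u v)
       + \<epsilon>\<^sup>2 * (\<Sum>u=1..n. \<Sum>v=1..n. ?b u v)"
    unfolding e by (simp only: sum.distrib sum_subtractf sum_distrib_left)
  also have "\<dots> \<le> (\<Sum>u=1..n. \<Sum>v=1..n. (R u v)\<^sup>2) - \<epsilon>\<^sup>2 * (real n)\<^sup>2"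
    unfolding ind using b c by (simp add: power2_eq_square algebra_simps)
  finally show ?thesis .
qed

text \<open>Energy argument: the energy starts at no more than n^2 and every rectangle that violates
  the bound lowers it by \<epsilon>^2 n^2. With r \<epsilon>^2 > 1 it would be negative after
  \<open>r\<close> such removals, so the process must reach a small remainder by then.\<close>

lemma cut_decomposition:
  fixes F :: "nat \<Rightarrow> nat \<Rightarrow> real"
  assumes F: "\<And>u v. \<bar>F u v\<bar> \<le> 1" and \<epsilon>: "\<epsilon> > 0" and r: "real r * \<epsilon>\<^sup>2 > 1" and n: "n \<ge> 1"
  shows "\<exists>\<sigma> S T. (\<forall>i. \<sigma> i \<in> {-1, 0, 1}) \<and>
    (\<forall>S' T'. S' \<subseteq> {1..n} \<longrightarrow> T' \<subseteq> {1..n} \<longrightarrow>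
      \<bar>\<Sum>u\<in>S'. \<Sum>v\<in>T'. F u v - \<epsilon> * (\<Sum>i<r. \<sigma> i * of_bool (u \<in> S i \<and> v \<in> T i))\<bar> \<le> \<epsilon> * (real n)\<^sup>2)"
proof -
  define res where "res m \<sigma> S T u v = F u v - \<epsilon> * (\<Sum>i<m. \<sigma> i * of_bool (u \<in> S i \<and> v \<in> T i))"
    for m and \<sigma> :: "nat \<Rightarrow> real" and S T :: "nat \<Rightarrow> nat set" and u v
  define small where "small m \<sigma> S T \<longleftrightarrow> (\<forall>S' T'. S' \<subseteq> {1..n} \<longrightarrow> T' \<subseteq> {1..n} \<longrightarrow>
      \<bar>\<Sum>u\<in>S'. \<Sum>v\<in>T'. res m \<sigma> S T u v\<bar> \<le> \<epsilon> * (real n)\<^sup>2)" for m \<sigma> S T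
  define energy where "energy m \<sigma> S T = (\<Sum>u=1..n. \<Sum>v=1..n. (res m \<sigma> S T u v)\<^sup>2)" for m \<sigma> S T
  have upd: "res (Suc m) (\<sigma>(m := c)) (S(m := A)) (T(m := B)) u v =
      res m \<sigma> S T u v - \<epsilon> * (c * of_bool (u \<in> A \<and> v \<in> B))" for m \<sigma> c S A T B u v
    unfolding res_def by (simp add: algebra_simps)
  have "\<exists>\<sigma> S T. (\<forall>i. \<sigma> i \<in> {-1, 0, 1}) \<and>
      (small m \<sigma> S T \<or> energy m \<sigma> S T \<le> (real n)\<^sup>2 - real m * \<epsilon>\<^sup>2 * (real n)\<^sup>2)" for m
  proof (induction m)
    case 0
    have "(F u v)\<^sup>2 \<le> 1" for u v using F[of u v] by (simp add: abs_square_le_1)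
    then have "energy 0 (\<lambda>_. 0) (\<lambda>_. {}) (\<lambda>_. {}) \<le> (\<Sum>u=1..n. \<Sum>v=1..n. 1)"
      unfolding energy_def res_def by (intro sum_mono) simp
    then show ?case by (intro exI[of _ "\<lambda>_. 0"] exI[of _ "\<lambda>_. {}"]) (simp add: power2_eq_square)
  next
    case (Suc m)
    then obtain \<sigma> S T where s: "\<forall>i. \<sigma> i \<in> {-1, 0, 1}"
      and d: "small m \<sigma> S T \<or> energy m \<sigma> S T \<le> (real n)\<^sup>2 - real m * \<epsilon>\<^sup>2 * (real n)\<^sup>2" by blast
    show ?case
    proof (cases "small m \<sigma> S T")
      case True
      \<comment> \<open>Once the remainder is small, further slots are filled with sign 0, so that
        the number of rectangles is always exactly \<open>r\<close>.\<close>
      then have "small (Suc m) (\<sigma>(m := 0)) (S(m := {})) (T(m := {}))"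
        unfolding small_def upd by simp
      moreover have "\<forall>i. (\<sigma>(m := 0)) i \<in> {-1, 0, 1}" using s by auto
      ultimately show ?thesis by blast
    next
      case False
      then obtain A B where AB: "A \<subseteq> {1..n}" "B \<subseteq> {1..n}"
          "\<bar>\<Sum>u\<in>A. \<Sum>v\<in>B. res m \<sigma> S T u v\<bar> > \<epsilon> * (real n)\<^sup>2"
        unfolding small_def by (auto simp: not_le)
      define c :: real where "c = (if (\<Sum>u\<in>A. \<Sum>v\<in>B. res m \<sigma> S T u v) \<ge> 0 then 1 else -1)"
      have c: "c \<in> {-1, 1}" "c * (\<Sum>u\<in>A. \<Sum>v\<in>B. res m \<sigma> S T u v) \<ge> \<epsilon> * (real n)\<^sup>2"
        using AB(3) by (auto simp: c_def)
      have "energy (Suc m) (\<sigma>(m := c)) (S(m := A)) (T(m := B)) \<le> energy m \<sigma> S T - \<epsilon>\<^sup>2 * (real n)\<^sup>2"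
        unfolding energy_def upd by (rule energy_decrement[OF AB(1,2) \<epsilon> c])
      also have "\<dots> \<le> (real n)\<^sup>2 - real (Suc m) * \<epsilon>\<^sup>2 * (real n)\<^sup>2"
        using d False by (simp add: algebra_simps)
      finally have "energy (Suc m) (\<sigma>(m := c)) (S(m := A)) (T(m := B)) \<le> (real n)\<^sup>2 - real (Suc m) * \<epsilon>\<^sup>2 * (real n)\<^sup>2" .
      moreover have "\<forall>i. (\<sigma>(m := c)) i \<in> {-1, 0, 1}" using s c by auto
      ultimately show ?thesis by blast
    qed
  qed
  then obtain \<sigma> S T where s: "\<forall>i. \<sigma> i \<in> {-1, 0, 1}"
    and d: "small r \<sigma> S T \<or> energy r \<sigma> S T \<le> (real n)\<^sup>2 - real r * \<epsilon>\<^sup>2 * (real n)\<^sup>2" by blast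
  have "energy r \<sigma> S T \<ge> 0" unfolding energy_def by (intro sum_nonneg) auto
  moreover have "(real n)\<^sup>2 - real r * \<epsilon>\<^sup>2 * (real n)\<^sup>2 < 0"
    using r n by (simp add: mult_less_cancel_right1)
  ultimately have "small r \<sigma> S T" using d by auto
  then show ?thesis using s unfolding small_def res_def by blast
qed

text \<open>\<open>q\<close> and \<open>\<G>\<close> are chosen before n and the colouring, so the
  pairs of a class map and a table number q^(n+1) times \<open>card \<G>\<close>. The domain
  \<open>{..n}\<close> includes index 0 because step kernels are read there as well.\<close>

definition weak_regular :: "nat \<Rightarrow> real \<Rightarrow> nat \<Rightarrow> (nat \<Rightarrow> nat \<Rightarrow> nat \<Rightarrow> real) set \<Rightarrow> bool" where
  "weak_regular k \<epsilon> q \<G> \<longleftrightarrow> finite \<G> \<and> (\<forall>n\<ge>1. \<forall>X. \<exists>p\<in>{..n} \<rightarrow>\<^sub>E {..<q}. \<exists>G\<in>\<G>. \<forall>a\<in>{1..k}.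
     cut_norm (\<lambda>z. empirical_graphon k n X a z - step_kernel n (\<lambda>u v. G a (p u) (p v)) z) \<le> \<epsilon>)"

text \<open>One partition serves all \<open>k\<close> colours: the class of a vertex records which
  sides of the rectangles in the \<open>k\<close> decompositions contain it. The coefficient of a
  pair of vertices then depends only on their two classes and on the signs, and there are finitely
  many sign patterns.\<close>

lemma weak_regularity:
  assumes \<epsilon>: "\<epsilon> > 0"
  shows "\<exists>q \<G>. weak_regular k \<epsilon> q \<G>"
proof -
  obtain r where r: "real r * \<epsilon>\<^sup>2 > 1"
    using reals_Archimedean3[of "\<epsilon>\<^sup>2"] \<epsilon> by auto
  \<comment> \<open>A label names a colour, a rectangle and one of its two sides,
    \<open>True\<close> for the side in \<open>S\<close> and \<open>False\<close> for the side in
    \<open>T\<close>. Classes are subsets of \<open>J\<close>, numbered by \<open>h\<close>.\<close>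
  define J where "J = {1..k} \<times> {..<r} \<times> (UNIV :: bool set)"
  have fJ: "finite (Pow J)" unfolding J_def by auto
  define q where "q = card (Pow J)"
  obtain h where h: "bij_betw h (Pow J) {..<q}"
    using ex_bij_betw_finite_nat[OF fJ] unfolding q_def by (auto simp: lessThan_atLeast0)
  define dec where "dec = the_inv_into (Pow J) h"
  have dec: "dec (h c) = c" if "c \<subseteq> J" for c
    unfolding dec_def using that h by (intro the_inv_into_f_f) (auto simp: bij_betw_def)
  define mk where "mk \<sigma> a c c' = \<epsilon> * (\<Sum>i<r. \<sigma> (a, i) * of_bool ((a, i, True) \<in> dec c \<and> (a, i, False) \<in> dec c'))"
    for \<sigma> :: "nat \<times> nat \<Rightarrow> real" and a c c' :: nat
  define \<G> where "\<G> = mk ` (({1..k} \<times> {..<r}) \<rightarrow>\<^sub>E {-1, 0, 1})"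
  have "finite \<G>" unfolding \<G>_def by (intro finite_imageI finite_PiE) auto
  moreover have "\<exists>p\<in>{..n} \<rightarrow>\<^sub>E {..<q}. \<exists>G\<in>\<G>. \<forall>a\<in>{1..k}.
     cut_norm (\<lambda>z. empirical_graphon k n X a z - step_kernel n (\<lambda>u v. G a (p u) (p v)) z) \<le> \<epsilon>"
    if n: "n \<ge> 1" for n X
  proof -
    define Q where "Q a \<sigma> S T \<longleftrightarrow> (\<forall>i. \<sigma> i \<in> {-1, 0, 1 :: real}) \<and>
      (\<forall>S' T'. S' \<subseteq> {1..n} \<longrightarrow> T' \<subseteq> {1..n} \<longrightarrow>
        \<bar>\<Sum>u\<in>S'. \<Sum>v\<in>T'. color_matrix k X a u v - \<epsilon> * (\<Sum>i<r. \<sigma> i * of_bool (u \<in> S i \<and> v \<in> T i))\<bar> \<le> \<epsilon> * (real n)\<^sup>2)"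
      for a \<sigma> and S T :: "nat \<Rightarrow> nat set"
    have "\<exists>\<sigma> S T. Q a \<sigma> S T" for a
      unfolding Q_def by (rule cut_decomposition[OF color_matrix_abs \<epsilon> r n])
    then obtain \<sigma> S T where "\<And>a. Q a (\<sigma> a) (S a) (T a)" by metis
    then have s: "\<And>a i. \<sigma> a i \<in> {-1, 0, 1 :: real}"
      and c: "\<And>a S' T'. S' \<subseteq> {1..n} \<Longrightarrow> T' \<subseteq> {1..n} \<Longrightarrow>
        \<bar>\<Sum>u\<in>S'. \<Sum>v\<in>T'. color_matrix k X a u v - \<epsilon> * (\<Sum>i<r. \<sigma> a i * of_bool (u \<in> S a i \<and> v \<in> T a i))\<bar> \<le> \<epsilon> * (real n)\<^sup>2"
      unfolding Q_def by blast+
    define code where "code u = {(a, i, b) \<in> J. if b then u \<in> S a i else u \<in> T a i}" for u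
    have code: "code u \<subseteq> J" for u unfolding code_def by (auto simp: J_def)
    define p where "p = restrict (h \<circ> code) {..n}"
    have p: "p \<in> {..n} \<rightarrow>\<^sub>E {..<q}"
      unfolding p_def using bij_betwE[OF h] code by auto
    define \<sigma>' where "\<sigma>' = restrict (\<lambda>(a, i). \<sigma> a i) ({1..k} \<times> {..<r})"
    have "\<sigma>' \<in> ({1..k} \<times> {..<r}) \<rightarrow>\<^sub>E {-1, 0, 1}" unfolding \<sigma>'_def using s by (intro restrict_PiE_iff[THEN iffD2]) auto
    then have G: "mk \<sigma>' \<in> \<G>" unfolding \<G>_def by blast
    have "cut_norm (\<lambda>z. empirical_graphon k n X a z - step_kernel n (\<lambda>u v. mk \<sigma>' a (p u) (p v)) z) \<le> \<epsilon>"
      if a: "a \<in> {1..k}" for a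
    proof -
      have mk: "mk \<sigma>' a (p u) (p v) = \<epsilon> * (\<Sum>i<r. \<sigma> a i * of_bool (u \<in> S a i \<and> v \<in> T a i))"
        if "u \<le> n" "v \<le> n" for u v
        unfolding mk_def using that a
        by (intro arg_cong[of _ _ "\<lambda>x. \<epsilon> * x"] sum.cong refl)
          (simp add: \<sigma>'_def p_def dec[OF code], simp add: code_def J_def)
      have "cut_norm (step_kernel n (\<lambda>u v. color_matrix k X a u v - mk \<sigma>' a (p u) (p v))) \<le> \<epsilon>"
      proof (rule cut_norm_step_kernel_le[OF n])
        fix S' T' assume ST: "S' \<subseteq> {1..n}" "T' \<subseteq> {1..n}"
        have "(\<Sum>u\<in>S'. \<Sum>v\<in>T'. color_matrix k X a u v - mk \<sigma>' a (p u) (p v)) =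
          (\<Sum>u\<in>S'. \<Sum>v\<in>T'. color_matrix k X a u v - \<epsilon> * (\<Sum>i<r. \<sigma> a i * of_bool (u \<in> S a i \<and> v \<in> T a i)))"
          using ST by (intro sum.cong refl) (subst mk, auto)
        then show "\<bar>\<Sum>u\<in>S'. \<Sum>v\<in>T'. color_matrix k X a u v - mk \<sigma>' a (p u) (p v)\<bar> \<le> \<epsilon> * (real n)\<^sup>2"
          using c[OF ST, of a] by simp
      qed
      then show ?thesis unfolding cut_norm_empirical_minus_step[OF n] .
    qed
    then show ?thesis using p G by blast
  qed
  ultimately show ?thesis unfolding weak_regular_def by blast
qed

section \<open>Total boundedness of the empirical graphons\<close>

lemma cut_norm_minus_commute: "cut_norm (\<lambda>p. F p - G p) = cut_norm (\<lambda>p. G p - F p)"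
proof -
  have "set_lebesgue_integral square_measure A (\<lambda>p. F p - G p) = - set_lebesgue_integral square_measure A (\<lambda>p. G p - F p)" for A
    unfolding set_lebesgue_integral_def integral_minus[symmetric]
    by (intro Bochner_Integration.integral_cong) (auto simp: algebra_simps)
  then show ?thesis unfolding cut_norm_def by simp
qed

lemma cut_norm_triangle_diff:
  assumes "bounded_kernel F" "bounded_kernel G" "bounded_kernel H"
  shows "cut_norm (\<lambda>p. F p - H p) \<le> cut_norm (\<lambda>p. F p - G p) + cut_norm (\<lambda>p. G p - H p)"
proof -
  have "cut_norm (\<lambda>p. F p - H p) \<le> cut_norm (\<lambda>p. F p - G p) + cut_norm (\<lambda>p. H p - G p)"
    using assms by (intro cut_norm_triangle bounded_kernel_diff) auto
  then show ?thesis by (simp only: cut_norm_minus_commute[of H G])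
qed

section \<open>Vertex permutations as measure-preserving maps of the interval\<close>

lemma measure_blocks:
  assumes n: "n \<ge> 1" and S: "S \<in> sets unit_measure"
  shows "measure unit_measure S = (\<Sum>u=1..n. measure unit_measure (S \<inter> block n u))"
proof -
  have "AE x in unit_measure. x \<in> S \<longleftrightarrow> x \<in> (\<Union>u\<in>{1..n}. S \<inter> block n u)"
    using AE_cell_index[OF n] AE_space by eventually_elim (auto simp: block_def)
  then have "measure unit_measure S = measure unit_measure (\<Union>u\<in>{1..n}. S \<inter> block n u)"
    using S by (intro UM.finite_measure_eq_AE sets.finite_UN sets.Int block_sets) auto
  also have "\<dots> = (\<Sum>u=1..n. measure unit_measure (S \<inter> block n u))"
  proof (rule UM.finite_measure_finite_Union)
    show "disjoint_family_on (\<lambda>u. S \<inter> block n u) {1..n}" by (auto simp: disjoint_family_on_def block_def)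
  qed (use S in auto)
  finally show ?thesis .
qed

definition block_perm :: "nat \<Rightarrow> (nat \<Rightarrow> nat) \<Rightarrow> real \<Rightarrow> real" where
  "block_perm n \<pi> x = (let u = cell_index n x in
     if u \<in> {1..n} then x + (real (\<pi> u) - real u) / real n else x)"

lemma block_shift:
  assumes "u \<in> {1..n}" "v \<in> {1..n}"
  shows "x + (real v - real u) / real n \<in> block n v \<longleftrightarrow> x \<in> block n u"
proof -
  have "(real v - real u) / real n = real v / real n - real u / real n"
       "(real v - 1) / real n = real v / real n - 1 / real n"
       "(real u - 1) / real n = real u / real n - 1 / real n"
    by (simp_all add: diff_divide_distrib)
  moreover have "(V - d < x + (V - U) \<and> x + (V - U) \<le> V) \<longleftrightarrow> (U - d < x \<and> x \<le> U)" for U V d :: real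
    by auto
  ultimately show ?thesis
    unfolding block_eq[OF assms(1)] block_eq[OF assms(2)] greaterThanAtMost_iff by simp
qed

lemma block_perm_block:
  assumes \<pi>: "bij_betw \<pi> {1..n} {1..n}" and u: "cell_index n x \<in> {1..n}" and x: "x \<in> {0..1}"
  shows "block_perm n \<pi> x \<in> block n (\<pi> (cell_index n x))"
proof -
  have "\<pi> (cell_index n x) \<in> {1..n}" using bij_betwE[OF \<pi>] u by auto
  moreover have "x \<in> block n (cell_index n x)" using x by (simp add: block_def)
  ultimately show ?thesis using block_shift[OF u] u by (simp add: block_perm_def Let_def)
qed

lemma cell_index_block_perm:
  assumes "bij_betw \<pi> {1..n} {1..n}" "cell_index n x \<in> {1..n}" "x \<in> {0..1}"
  shows "cell_index n (block_perm n \<pi> x) = \<pi> (cell_index n x)"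
  using block_perm_block[OF assms] by (simp add: block_def)

lemma block_perm_measurable:
  assumes "bij_betw \<pi> {1..n} {1..n}"
  shows "block_perm n \<pi> \<in> measurable unit_measure unit_measure"
proof -
  have id: "(\<lambda>x. x) \<in> borel_measurable unit_measure"
    unfolding unit_measure_def by (intro measurable_restrict_space1) simp
  have "(\<lambda>x. real (\<pi> (cell_index n x))) \<in> borel_measurable unit_measure"
    by (rule measurable_compose[OF cell_index_measurable]) simp
  moreover have "(\<lambda>x. real (cell_index n x)) \<in> borel_measurable unit_measure"
    by (rule measurable_compose[OF cell_index_measurable]) simp
  moreover have "Measurable.pred unit_measure (\<lambda>x. cell_index n x \<in> {1..n})"
    by (rule measurable_compose[OF cell_index_measurable]) simp
  ultimately have "block_perm n \<pi> \<in> borel_measurable unit_measure"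
    unfolding block_perm_def[abs_def] Let_def using id by (intro measurable_If) (auto simp: pred_def)
  moreover have "block_perm n \<pi> x \<in> {0..1}" if "x \<in> {0..1}" for x
    using block_perm_block[OF assms _ that] block_subset that by (force simp: block_perm_def Let_def)
  ultimately show ?thesis
    by (subst (2) unit_measure_def) (auto intro!: measurable_restrict_space2)
qed

text \<open>On every block the map is a translation, so translation invariance of Lebesgue measure
  matches preimages block by block; summing over the blocks and reindexing by \<open>\<pi>\<close>
  gives the whole measure.\<close>

lemma block_perm_mp:
  assumes \<pi>: "bij_betw \<pi> {1..n} {1..n}" and n: "n \<ge> 1"
  shows "block_perm n \<pi> \<in> mp_maps"
proof -
  let ?\<phi> = "block_perm n \<pi>"
  note m = block_perm_measurable[OF \<pi>]
  have "distr unit_measure unit_measure ?\<phi> = unit_measure"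
  proof (rule measure_eqI)
    fix B assume "B \<in> sets (distr unit_measure unit_measure ?\<phi>)"
    then have B: "B \<in> sets unit_measure" by simp
    define A where "A = ?\<phi> -` B \<inter> space unit_measure"
    have A: "A \<in> sets unit_measure" unfolding A_def using m B by (rule measurable_sets)
    have "measure unit_measure (A \<inter> block n u) = measure unit_measure (B \<inter> block n (\<pi> u))"
      if u: "u \<in> {1..n}" for u
    proof -
      have v: "\<pi> u \<in> {1..n}" using bij_betwE[OF \<pi>] u by auto
      define c where "c = (real (\<pi> u) - real u) / real n"
      have BB: "B \<inter> block n (\<pi> u) \<in> sets unit_measure" using B by auto
      then have Bb: "B \<inter> block n (\<pi> u) \<in> sets borel"
        by (auto simp: unit_measure_def sets_restrict_space)
      have "A \<inter> block n u = (+) c -` (B \<inter> block n (\<pi> u))"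
      proof -
        have "x \<in> A \<inter> block n u \<longleftrightarrow> c + x \<in> B \<inter> block n (\<pi> u)" for x
          using block_shift[OF u v, of x] u
          by (auto simp: A_def block_perm_def block_def Let_def c_def add.commute)
        then show ?thesis by auto
      qed
      moreover have "A \<inter> block n u \<in> sets unit_measure" using A by auto
      ultimately have "measure unit_measure (A \<inter> block n u) = measure lborel ((+) c -` (B \<inter> block n (\<pi> u)))"
        using measure_unit_eq by metis
      also have "\<dots> = measure (distr lborel borel ((+) c)) (B \<inter> block n (\<pi> u))"
        using Bb by (subst measure_distr) auto
      also have "\<dots> = measure unit_measure (B \<inter> block n (\<pi> u))"
        using measure_unit_eq[OF BB] by (simp add: lborel_distr_plus)
      finally show ?thesis .
    qed
    then have "measure unit_measure A = (\<Sum>u=1..n. measure unit_measure (B \<inter> block n (\<pi> u)))"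
      unfolding measure_blocks[OF n A] by (intro sum.cong) auto
    also have "\<dots> = measure unit_measure B"
      unfolding measure_blocks[OF n B] by (rule sum.reindex_bij_betw[OF \<pi>])
    finally have "emeasure unit_measure A = emeasure unit_measure B"
      by (simp add: UM.emeasure_eq_measure)
    then show "emeasure (distr unit_measure unit_measure ?\<phi>) B = emeasure unit_measure B"
      using m B by (subst emeasure_distr) (auto simp: A_def)
  qed simp
  with m show ?thesis unfolding mp_maps_def by auto
qed

lemma block_perm_inverse:
  assumes \<pi>: "bij_betw \<pi> {1..n} {1..n}" and n: "n \<ge> 1" and i: "\<And>u. u \<in> {1..n} \<Longrightarrow> \<rho> (\<pi> u) = u"
  shows "AE x in unit_measure. block_perm n \<rho> (block_perm n \<pi> x) = x"
  using AE_cell_index[OF n] AE_space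
proof eventually_elim
  case (elim x)
  then have c: "cell_index n (block_perm n \<pi> x) = \<pi> (cell_index n x)"
    by (intro cell_index_block_perm[OF \<pi>]) auto
  have "\<pi> (cell_index n x) \<in> {1..n}" using bij_betwE[OF \<pi>] elim by auto
  then have "block_perm n \<rho> (block_perm n \<pi> x) =
      block_perm n \<pi> x + (real (cell_index n x) - real (\<pi> (cell_index n x))) / real n"
    unfolding block_perm_def[of n \<rho>] Let_def c using i[of "cell_index n x"] elim by auto
  also have "\<dots> = x" using elim by (simp add: block_perm_def Let_def diff_divide_distrib)
  finally show ?case .
qed

lemma block_perm_bijection:
  assumes \<pi>: "bij_betw \<pi> {1..n} {1..n}" and n: "n \<ge> 1"
  shows "block_perm n \<pi> \<in> mp_bijections"
proof -
  define \<rho> where "\<rho> = the_inv_into {1..n} \<pi>"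
  have \<rho>: "bij_betw \<rho> {1..n} {1..n}" unfolding \<rho>_def using \<pi> by (rule bij_betw_the_inv_into)
  have "\<rho> (\<pi> u) = u" if "u \<in> {1..n}" for u
    unfolding \<rho>_def using \<pi> that by (intro the_inv_into_f_f) (auto simp: bij_betw_def)
  moreover have "\<pi> (\<rho> u) = u" if "u \<in> {1..n}" for u
    unfolding \<rho>_def using \<pi> that by (intro f_the_inv_into_f) (auto simp: bij_betw_def)
  ultimately show ?thesis
    unfolding mp_bijections_def
    using block_perm_mp[OF \<pi> n] block_perm_mp[OF \<rho> n] block_perm_inverse[OF \<pi> n, of \<rho>] block_perm_inverse[OF \<rho> n, of \<pi>]
    by blast
qed

section \<open>Monotone class maps sampled on a fixed grid\<close>

lemma sorting_permutation:
  fixes p :: "nat \<Rightarrow> 'a::linorder"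
  shows "\<exists>\<pi>. bij_betw \<pi> {1..n} {1..n} \<and> (\<forall>u v. 1 \<le> u \<longrightarrow> u \<le> v \<longrightarrow> v \<le> n \<longrightarrow> p (\<pi> u) \<le> p (\<pi> v))"
proof -
  define xs where "xs = sort_key p [1..<Suc n]"
  have xs: "length xs = n" "distinct xs" "set xs = {1..n}" "sorted (map p xs)"
    unfolding xs_def by auto
  have "bij_betw (\<lambda>u. u - 1) {1..n} {..<n}"
    by (rule bij_betw_byWitness[of _ Suc]) auto
  moreover have "bij_betw ((!) xs) {..<n} {1..n}"
    using bij_betw_nth[OF xs(2), of "{..<n}" "{1..n}"] xs by auto
  ultimately have "bij_betw (\<lambda>u. xs ! (u - 1)) {1..n} {1..n}"
    using bij_betw_trans[of "\<lambda>u. u - 1" "{1..n}" "{..<n}" "(!) xs" "{1..n}"] by (simp add: comp_def)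
  moreover have "p (xs ! (u - 1)) \<le> p (xs ! (v - 1))" if "1 \<le> u" "u \<le> v" "v \<le> n" for u v
    using sorted_nth_mono[OF xs(4), of "u - 1" "v - 1"] that xs(1) by simp
  ultimately show ?thesis by (intro exI[of _ "\<lambda>u. xs ! (u - 1)"]) blast
qed

text \<open>A monotone map into \<open>q\<close> points has at most \<open>q\<close> jumps.\<close>

lemma monotone_sampling:
  fixes h :: "nat \<Rightarrow> nat"
  assumes n: "n \<ge> 1" and N: "N \<ge> 1"
    and mono: "\<And>u v. 1 \<le> u \<Longrightarrow> u \<le> v \<Longrightarrow> v \<le> n \<Longrightarrow> h u \<le> h v"
    and q: "\<And>u. u \<in> {1..n} \<Longrightarrow> h u < q"
  shows "\<exists>D\<in>sets unit_measure. measure unit_measure D \<le> real q / real N \<and>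
    (AE x in unit_measure. x \<notin> D \<longrightarrow> h (cell_index n x) = h (cell_index n (real (cell_index N x) / real N)))"
proof -
  define c where "c j = h (cell_index n (real j / real N))" for j
  \<comment> \<open>The first cell always counts as a jump, since its left sample point 0 has cell
    index 0, where monotonicity of \<open>h\<close> is not assumed. Along \<open>J\<close> the
    samples \<open>c\<close> increase strictly, so \<open>J\<close> has at most \<open>q\<close>
    elements.\<close>
  define J where "J = {j \<in> {1..N}. j = 1 \<or> c (j - 1) < c j}"
  have ci: "cell_index n (real j / real N) \<in> {1..n}" if "j \<in> {1..N}" for j
    using cell_index_le[of "real j / real N" n] cell_index_pos[OF n, of "real j / real N"] that by auto
  have ci_mono: "cell_index n x \<le> cell_index n y" if "x \<le> y" for x y
    unfolding cell_index_def using that by (intro nat_mono ceiling_mono mult_left_mono) auto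
  have c_mono: "c i \<le> c j" if "1 \<le> i" "i \<le> j" "j \<le> N" for i j
    unfolding c_def using that ci[of i] ci[of j] by (intro mono ci_mono divide_right_mono) auto
  have "c i < c j" if "i \<in> J" "j \<in> J" "i < j" for i j
  proof -
    have "c (j - 1) < c j" "1 \<le> i" "j \<le> N" using that unfolding J_def by auto
    moreover have "c i \<le> c (j - 1)" using that(3) \<open>1 \<le> i\<close> \<open>j \<le> N\<close> by (intro c_mono) auto
    ultimately show ?thesis by simp
  qed
  then have "inj_on c J" by (metis linorder_inj_onI' less_irrefl)
  moreover have "c ` J \<subseteq> {..<q}" unfolding c_def J_def using ci q by auto
  ultimately have card: "card J \<le> q" using card_inj_on_le[of c J "{..<q}"] by simp
  let ?D = "\<Union>j\<in>J. block N j"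
  have fJ: "finite J" unfolding J_def by auto
  have "measure unit_measure ?D \<le> (\<Sum>j\<in>J. measure unit_measure (block N j))"
    using fJ by (intro measure_UNION_le) auto
  also have "\<dots> = real (card J) * (1 / real N)"
    by (subst sum.cong[OF refl measure_block]) (auto simp: J_def)
  also have "\<dots> \<le> real q / real N" using card by (simp add: divide_right_mono)
  finally have "measure unit_measure ?D \<le> real q / real N" .
  moreover have "?D \<in> sets unit_measure" using fJ by auto
  moreover have "AE x in unit_measure. x \<notin> ?D \<longrightarrow> h (cell_index n x) = c (cell_index N x)"
    using AE_cell_index[OF n] AE_cell_index[OF N] AE_space
  proof eventually_elim
    case (elim x)
    define j where "j = cell_index N x"
    have xb: "x \<in> block N j" using elim by (simp add: block_def j_def)
    have j: "j \<in> {1..N}" using elim j_def by simp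
    have x: "(real j - 1) / real N < x" "x \<le> real j / real N"
      using xb unfolding block_eq[OF j] by auto
    show ?case
    proof
      assume "x \<notin> ?D"
      then have "j \<notin> J" using xb by auto
      then have j2: "2 \<le> j" "c j \<le> c (j - 1)" using j unfolding J_def by auto
      \<comment> \<open>The point x lies between the sample points (j-1)/N and j/N, and
        \<open>c\<close> does not increase from j-1 to j; monotonicity squeezes the class of x
        between the two samples.\<close>
      have "h (cell_index n x) \<le> c j" unfolding c_def using elim ci[OF j] ci_mono[OF x(2)] by (intro mono) auto
      moreover have "c (j - 1) \<le> h (cell_index n x)"
      proof -
        have "j - 1 \<in> {1..N}" using j2 j by auto
        moreover have "real (j - 1) / real N \<le> x" using x(1) j2(1) by (simp add: of_nat_diff)
        ultimately show ?thesis unfolding c_def using elim ci[of "j - 1"] ci_mono by (intro mono) auto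
      qed
      ultimately show "h (cell_index n x) = c (cell_index N x)" using j2 j_def by simp
    qed
  qed
  ultimately show ?thesis unfolding c_def by blast
qed

text \<open>Off the cross of points with a coordinate in \<open>D\<close> the two kernels coincide
  almost everywhere. On the cross, of area at most twice the measure of \<open>D\<close>, they
  differ by at most 2 B.\<close>

lemma cut_norm_step_resample:
  fixes h c :: "nat \<Rightarrow> nat" and g :: "nat \<Rightarrow> nat \<Rightarrow> real"
  assumes D: "D \<in> sets unit_measure"
    and AE: "AE x in unit_measure. x \<notin> D \<longrightarrow> h (cell_index n x) = c (cell_index N x)"
    and n: "n \<ge> 1" "N \<ge> 1"
    and h: "\<And>u. u \<in> {1..n} \<Longrightarrow> h u < q" and c: "\<And>j. j \<in> {1..N} \<Longrightarrow> c j < q"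
    and g: "\<And>i j. i < q \<Longrightarrow> j < q \<Longrightarrow> \<bar>g i j\<bar> \<le> B"
  shows "cut_norm (\<lambda>z. step_kernel n (\<lambda>u v. g (h u) (h v)) z - step_kernel N (\<lambda>u v. g (c u) (c v)) z)
    \<le> 4 * B * measure unit_measure D"
proof -
  let ?F = "\<lambda>z. step_kernel n (\<lambda>u v. g (h u) (h v)) z - step_kernel N (\<lambda>u v. g (c u) (c v)) z"
  let ?H = "\<lambda>z. 2 * B * (indicat_real (D \<times> {0..1}) z + indicat_real ({0..1} \<times> D) z)"
  have i1: "integrable square_measure ?F"
    by (intro bounded_kernel_integrable bounded_kernel_diff step_kernel_bounded)
  have D': "D \<times> {0..1} \<in> sets square_measure" "{0..1} \<times> D \<in> sets square_measure" using D by auto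
  have i2: "integrable square_measure ?H"
    using D' by (intro integrable_mult_right Bochner_Integration.integrable_add integrable_real_indicator) (auto simp: less_top[symmetric])
  have "AE z in square_measure. \<bar>?F z\<bar> \<le> ?H z"
    using AE_square[OF AE] AE_square[OF AE_cell_index[OF n(1)]] AE_square[OF AE_cell_index[OF n(2)]] AE_space
  proof eventually_elim
    case (elim z)
    obtain x y where z: "z = (x, y)" by (cases z)
    have xy: "x \<in> {0..1}" "y \<in> {0..1}" using elim(4) z by (auto simp: space_pair_measure)
    have b: "\<bar>g (h (cell_index n x)) (h (cell_index n y))\<bar> \<le> B" "\<bar>g (c (cell_index N x)) (c (cell_index N y))\<bar> \<le> B"
      using elim(2,3) z g h c by auto
    show ?case
    proof (cases "x \<in> D \<or> y \<in> D")
      case True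
      have "\<bar>?F z\<bar> \<le> 2 * B" using b by (auto simp: z step_kernel_def)
      moreover have "B \<ge> 0" using b by linarith
      ultimately show ?thesis using True xy by (auto simp: z indicator_def)
    next
      case False
      then show ?thesis using elim(1) z by (auto simp: step_kernel_def)
    qed
  qed
  then have "(\<integral>z. \<bar>?F z\<bar> \<partial>square_measure) \<le> (\<integral>z. ?H z \<partial>square_measure)"
    using i1 i2 by (intro integral_mono_AE) auto
  also have "\<dots> = 2 * B * (measure square_measure (D \<times> {0..1}) + measure square_measure ({0..1} \<times> D))"
    using D' by (subst integral_mult_right_zero, subst Bochner_Integration.integral_add)
      (auto simp: sets.Int_space_eq2 less_top[symmetric])
  also have "\<dots> = 4 * B * measure unit_measure D"
    using measure_rect[OF D unit_interval_sets] measure_rect[OF unit_interval_sets D] prob_space_unit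
    by (simp add: measure_def)
  finally show ?thesis using cut_norm_le_L1[OF i1] by simp
qed

lemma empirical_graphon_bounded: "bounded_kernel (empirical_graphon k n X a)"
  unfolding empirical_graphon_eq_step by (rule step_kernel_bounded)

text \<open>Sorting the vertices by their class in a weakly regular partition and sampling the sorted
  class map on a fixed grid leaves only finitely many possibilities, independently of \<open>n\<close>.\<close>

lemma empirical_graphon_finite_types:
  assumes \<epsilon>: "\<epsilon> > 0"
  shows "\<exists>\<K> :: kernel set. finite \<K> \<and> (\<forall>K\<in>\<K>. \<forall>a. bounded_kernel (K a)) \<and>
    (\<forall>n\<ge>1. \<forall>X. \<exists>\<phi>\<in>mp_bijections. \<exists>K\<in>\<K>. \<forall>a\<in>{1..k}.
      cut_norm (\<lambda>z. relabel \<phi> (empirical_graphon k n X) a z - K a z) \<le> \<epsilon>)"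
proof -
  obtain q \<G> where wr: "weak_regular k (\<epsilon> / 2) q \<G>"
    using weak_regularity[of "\<epsilon> / 2" k] \<epsilon> by auto
  then have fG: "finite \<G>" unfolding weak_regular_def by blast
  define B where "B = (\<Sum>(G, a, i, j)\<in>\<G> \<times> {1..k} \<times> {..<q} \<times> {..<q}. \<bar>G a i j\<bar>)"
  have B: "\<bar>G a i j\<bar> \<le> B" if "G \<in> \<G>" "a \<in> {1..k}" "i < q" "j < q" for G a i j
    unfolding B_def using fG that
      member_le_sum[of "(G, a, i, j)" "\<G> \<times> {1..k} \<times> {..<q} \<times> {..<q}" "\<lambda>(G, a, i, j). \<bar>G a i j\<bar>"]
    by auto
  have B0: "0 \<le> B" unfolding B_def by (intro sum_nonneg) auto
  \<comment> \<open>N is so large that resampling, which fails on a set of measure at most q/N,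
    costs at most \<epsilon>/2 in cut norm. It depends on the regularity data only and not on
    n.\<close>
  obtain N where N: "real N > 4 * B * real q * 2 / \<epsilon>" using reals_Archimedean2 by blast
  then have Npos: "real N > 0" using \<epsilon> B0 by (smt (verit) divide_nonneg_nonneg mult_nonneg_nonneg of_nat_0_le_iff)
  then have N1: "N \<ge> 1" by simp
  have NB: "4 * B * (real q / real N) \<le> \<epsilon> / 2" using N Npos \<epsilon> by (simp add: field_simps)
  define mk where "mk G c a = step_kernel N (\<lambda>u v. G a (c u) (c v))"
    for G :: "nat \<Rightarrow> nat \<Rightarrow> nat \<Rightarrow> real" and c :: "nat \<Rightarrow> nat" and a :: nat
  define \<K> where "\<K> = (\<lambda>(G, c). mk G c) ` (\<G> \<times> ({1..N} \<rightarrow>\<^sub>E {..<q}))"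
  have "finite \<K>" unfolding \<K>_def using fG by (intro finite_imageI finite_cartesian_product finite_PiE) auto
  moreover have "\<forall>K\<in>\<K>. \<forall>a. bounded_kernel (K a)"
    unfolding \<K>_def mk_def using step_kernel_bounded by auto
  moreover have "\<exists>\<phi>\<in>mp_bijections. \<exists>K\<in>\<K>. \<forall>a\<in>{1..k}.
      cut_norm (\<lambda>z. relabel \<phi> (empirical_graphon k n X) a z - K a z) \<le> \<epsilon>" if n: "n \<ge> 1" for n X
  proof -
    obtain p G where p: "p \<in> {..n} \<rightarrow>\<^sub>E {..<q}" and G: "G \<in> \<G>" and
      close: "\<And>a. a \<in> {1..k} \<Longrightarrow> cut_norm (\<lambda>z. empirical_graphon k n X a z - step_kernel n (\<lambda>u v. G a (p u) (p v)) z) \<le> \<epsilon> / 2"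
      using wr n unfolding weak_regular_def by meson
    obtain \<pi> where \<pi>: "bij_betw \<pi> {1..n} {1..n}"
      and sorted: "\<And>u v. 1 \<le> u \<Longrightarrow> u \<le> v \<Longrightarrow> v \<le> n \<Longrightarrow> p (\<pi> u) \<le> p (\<pi> v)"
      using sorting_permutation[of n p] by blast
    have pq: "p (\<pi> u) < q" if "u \<in> {1..n}" for u
    proof -
      have "\<pi> u \<in> {..n}" using bij_betwE[OF \<pi>] that by auto
      then show ?thesis using PiE_mem[OF p] by blast
    qed
    define \<phi> where "\<phi> = block_perm n \<pi>"
    have \<phi>: "\<phi> \<in> mp_bijections" unfolding \<phi>_def by (rule block_perm_bijection[OF \<pi> n])
    then have \<phi>m: "\<phi> \<in> mp_maps" unfolding mp_bijections_def by auto
    define c where "c = restrict (\<lambda>j. p (\<pi> (cell_index n (real j / real N)))) {1..N}"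
    have cc: "cell_index n (real j / real N) \<in> {1..n}" if "j \<in> {1..N}" for j
      using cell_index_le[of "real j / real N" n] cell_index_pos[OF n, of "real j / real N"] that by auto
    have c: "c j < q" if "j \<in> {1..N}" for j unfolding c_def using pq[OF cc[OF that]] that by simp
    have cE: "c \<in> {1..N} \<rightarrow>\<^sub>E {..<q}" using c by (auto simp: c_def PiE_def extensional_def)
    obtain D where D: "D \<in> sets unit_measure" "measure unit_measure D \<le> real q / real N"
      and AE: "AE x in unit_measure. x \<notin> D \<longrightarrow> p (\<pi> (cell_index n x)) = p (\<pi> (cell_index n (real (cell_index N x) / real N)))"
      using monotone_sampling[OF n N1, of "\<lambda>u. p (\<pi> u)" q, OF sorted pq] by blast
    have AE': "AE x in unit_measure. x \<notin> D \<longrightarrow> p (\<pi> (cell_index n x)) = c (cell_index N x)"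
      using AE AE_cell_index[OF N1] by eventually_elim (simp add: c_def)
    have "cut_norm (\<lambda>z. relabel \<phi> (empirical_graphon k n X) a z - mk G c a z) \<le> \<epsilon>" if a: "a \<in> {1..k}" for a
    proof -
      let ?E = "\<lambda>z. empirical_graphon k n X a z - step_kernel n (\<lambda>u v. G a (p u) (p v)) z"
      let ?S = "step_kernel n (\<lambda>u v. G a (p (\<pi> u)) (p (\<pi> v)))"
      have bE: "bounded_kernel ?E" by (intro bounded_kernel_diff empirical_graphon_bounded step_kernel_bounded)
      have bR: "bounded_kernel (relabel \<phi> (empirical_graphon k n X) a)"
        unfolding relabel_def by (rule bounded_kernel_comp[OF empirical_graphon_bounded \<phi>m])
      \<comment> \<open>The block permutation acts on the step kernel by composing the class map
        with \<open>\<pi>\<close>. The regularity estimate survives because composition with a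
        measure-preserving bijection does not raise the cut norm.\<close>
      have "AE z in square_measure. relabel \<phi> (empirical_graphon k n X) a z - ?S z = (\<lambda>(x, y). ?E (\<phi> x, \<phi> y)) z"
        using AE_square[OF AE_cell_index[OF n]] AE_space
      proof eventually_elim
        case (elim z)
        obtain x y where z: "z = (x, y)" by (cases z)
        have xy: "x \<in> {0..1}" "y \<in> {0..1}" using elim(2) z by (auto simp: space_pair_measure)
        have "cell_index n (\<phi> x) = \<pi> (cell_index n x)" "cell_index n (\<phi> y) = \<pi> (cell_index n y)"
          unfolding \<phi>_def using cell_index_block_perm[OF \<pi>] elim(1) z xy by auto
        then show ?case by (simp add: z relabel_def step_kernel_def)
      qed
      then have "cut_norm (\<lambda>z. relabel \<phi> (empirical_graphon k n X) a z - ?S z) = cut_norm (\<lambda>(x, y). ?E (\<phi> x, \<phi> y))"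
        using bR bounded_kernel_comp[OF bE \<phi>m] unfolding bounded_kernel_def
        by (intro cut_norm_cong_AE) auto
      also have "\<dots> \<le> cut_norm ?E" by (rule cut_norm_comp_le[OF bE \<phi>])
      also have "\<dots> \<le> \<epsilon> / 2" by (rule close[OF a])
      finally have 1: "cut_norm (\<lambda>z. relabel \<phi> (empirical_graphon k n X) a z - ?S z) \<le> \<epsilon> / 2" .
      have "cut_norm (\<lambda>z. ?S z - mk G c a z) \<le> 4 * B * measure unit_measure D"
        unfolding mk_def by (rule cut_norm_step_resample[OF D(1) AE' n N1 pq c B[OF G a]])
      also have "\<dots> \<le> 4 * B * (real q / real N)" using D(2) B0 by (intro mult_left_mono) auto
      finally have 2: "cut_norm (\<lambda>z. ?S z - mk G c a z) \<le> \<epsilon> / 2" using NB by simp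
      have "cut_norm (\<lambda>z. relabel \<phi> (empirical_graphon k n X) a z - mk G c a z) \<le>
         cut_norm (\<lambda>z. relabel \<phi> (empirical_graphon k n X) a z - ?S z) + cut_norm (\<lambda>z. ?S z - mk G c a z)"
        unfolding mk_def by (intro cut_norm_triangle_diff bR step_kernel_bounded)
      with 1 2 show ?thesis by simp
    qed
    moreover have "mk G c \<in> \<K>" unfolding \<K>_def using G cE by force
    ultimately show ?thesis using \<phi> by blast
  qed
  ultimately show ?thesis by (intro exI[of _ \<K>] conjI allI impI)
qed

section \<open>Relabelled graphons and total boundedness of their classes\<close>

lemma relabel_graphon:
  assumes "W \<in> graphons k" "\<phi> \<in> mp_maps"
  shows "relabel \<phi> W \<in> graphons k"
proof -
  have "\<phi> x \<in> {0..1}" if "x \<in> {0..1}" for x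
    using measurable_space[OF mp_mapsD(1)[OF assms(2)]] that by auto
  moreover have "relabel \<phi> W a \<in> borel_measurable square_measure" if "a \<in> {1..k}" for a
    using bounded_kernel_comp[OF graphon_bounded[OF assms(1) that] assms(2)]
    unfolding relabel_def bounded_kernel_def by auto
  moreover have "(\<lambda>a. W a (x, y)) \<in> prob_simplex k \<and> (\<forall>a\<in>{1..k}. W a (x, y) = W a (y, x))"
    if "x \<in> {0..1}" "y \<in> {0..1}" for x y
    using assms(1) that unfolding graphons_def by blast
  ultimately show ?thesis unfolding graphons_def relabel_def by simp
qed

lemma cut_dist_relabel:
  assumes "W \<in> graphons k" "\<phi> \<in> mp_bijections"
  shows "cut_dist k (relabel \<phi> W) W = 0"
proof -
  have g: "relabel \<phi> W \<in> graphons k" using assms relabel_graphon unfolding mp_bijections_def by auto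
  have "cut_dist k (relabel \<phi> W) W \<le> vec_cut_norm k (\<lambda>a p. relabel \<phi> W a p - relabel \<phi> W a p)"
    by (rule cut_dist_lower[OF g assms])
  also have "\<dots> = 0" by (simp add: vec_cut_norm_def cut_norm_zero)
  finally show ?thesis using cut_dist_nonneg[OF g assms(1)] by simp
qed

lemma cut_dist_le_cut_norm:
  assumes "U \<in> graphons k" "W \<in> graphons k"
  shows "cut_dist k U W \<le> (\<Sum>a=1..k. cut_norm (\<lambda>p. U a p - W a p))"
  using cut_dist_lower[OF assms mp_bijections_id] by (simp add: vec_cut_norm_def relabel_def)

text \<open>The approximants may lie outside the space, as step kernels do in the application. For
  each approximant that is near some point of \<open>S\<close> one such point is kept as a centre,
  and points near the same approximant are within \<epsilon> of each other.\<close>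

lemma (in Metric_space) finite_types_totally_bounded:
  assumes S: "S \<subseteq> M"
    and types: "\<And>\<epsilon>. \<epsilon> > 0 \<Longrightarrow> \<exists>(\<K> :: 'b set) near. finite \<K> \<and> (\<forall>A\<in>S. \<exists>K\<in>\<K>. near A K) \<and>
      (\<forall>K\<in>\<K>. \<forall>A B. near A K \<longrightarrow> near B K \<longrightarrow> d A B < \<epsilon>)"
  shows "mtotally_bounded S"
  unfolding mtotally_bounded_def
proof (intro allI impI)
  fix \<epsilon> :: real assume "\<epsilon> > 0"
  from types[OF this] obtain \<K> :: "'b set" and near where *: "finite \<K> \<and> (\<forall>A\<in>S. \<exists>K\<in>\<K>. near A K) \<and>
      (\<forall>K\<in>\<K>. \<forall>A B. near A K \<longrightarrow> near B K \<longrightarrow> d A B < \<epsilon>)" by (elim exE)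
  have \<K>: "finite \<K>" using * by (rule conjunct1)
  have ex: "\<exists>K\<in>\<K>. near A K" if "A \<in> S" for A
    using *[THEN conjunct2, THEN conjunct1] that by (rule bspec)
  have dist: "d A B < \<epsilon>" if "K \<in> \<K>" "near A K" "near B K" for K A B
    using *[THEN conjunct2, THEN conjunct2, rule_format, OF that] .
  define rep where "rep K = (SOME A. A \<in> S \<and> near A K)" for K
  define R where "R = rep ` {K \<in> \<K>. \<exists>A\<in>S. near A K}"
  have rep: "rep K \<in> S \<and> near (rep K) K" if "\<exists>A\<in>S. near A K" for K
    unfolding rep_def by (rule someI_ex) (use that in \<open>simp add: Bex_def\<close>)
  have "finite R" unfolding R_def using \<K> by auto
  moreover have "R \<subseteq> S" unfolding R_def using rep by blast
  moreover have "S \<subseteq> (\<Union>A\<in>R. mball A \<epsilon>)"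
  proof
    fix A assume A: "A \<in> S"
    obtain K where K: "K \<in> \<K>" "near A K" using ex[OF A] by blast
    then have r: "rep K \<in> S" "near (rep K) K" using rep A by blast+
    then have "rep K \<in> R" unfolding R_def using K A by blast
    moreover have "A \<in> mball (rep K) \<epsilon>"
      using dist[OF K(1) r(2) K(2)] r(1) A S by auto
    ultimately show "A \<in> (\<Union>A\<in>R. mball A \<epsilon>)" by (rule UN_I)
  qed
  ultimately show "\<exists>K. finite K \<and> K \<subseteq> S \<and> S \<subseteq> (\<Union>x\<in>K. mball x \<epsilon>)" by blast
qed

interpretation GS: Metric_space "graphon_space k" "class_dist k" for k
  by (rule Metric_space_graphons)

lemma empirical_totally_bounded:
  assumes k: "k \<ge> 1"
  shows "GS.mtotally_bounded k {graphon_class k (empirical_graphon k n X) | n X. n \<ge> 1 \<and> X \<in> colorings k n}"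
    (is "GS.mtotally_bounded k ?S")
proof (rule GS.finite_types_totally_bounded[where ?'b = kernel])
  show "?S \<subseteq> graphon_space k" by (auto intro: graphon_class_in empirical_graphon_in[OF k])
next
  fix \<epsilon> :: real assume e: "\<epsilon> > 0"
  \<comment> \<open>Passing through a common approximant costs 2 \<eta> for each of the
    \<open>k\<close> colours, in total \<epsilon>/2.\<close>
  define \<eta> where "\<eta> = \<epsilon> / (4 * real k)"
  have \<eta>: "\<eta> > 0" using e k by (simp add: \<eta>_def)
  obtain \<K> :: "kernel set" where \<K>0: "finite \<K> \<and> (\<forall>K\<in>\<K>. \<forall>a. bounded_kernel (K a)) \<and>
    (\<forall>n\<ge>1. \<forall>X. \<exists>\<phi>\<in>mp_bijections. \<exists>K\<in>\<K>. \<forall>a\<in>{1..k}.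
      cut_norm (\<lambda>z. relabel \<phi> (empirical_graphon k n X) a z - K a z) \<le> \<eta>)"
    using empirical_graphon_finite_types[OF \<eta>, of k] by (rule exE)
  then have \<K>: "finite \<K>" "\<And>K a. K \<in> \<K> \<Longrightarrow> bounded_kernel (K a)" by simp_all
  have ap: "\<exists>\<phi>\<in>mp_bijections. \<exists>K\<in>\<K>. \<forall>a\<in>{1..k}.
      cut_norm (\<lambda>z. relabel \<phi> (empirical_graphon k n X) a z - K a z) \<le> \<eta>" if "n \<ge> 1" for n X
    using \<K>0[THEN conjunct2, THEN conjunct2] that by blast
  \<comment> \<open>Nearness is asked of some member of the class, which leaves room for the
    relabelling by a block permutation.\<close>
  define near where "near A K \<longleftrightarrow> (\<exists>V\<in>graphons k. A = graphon_class k V \<and> (\<forall>a\<in>{1..k}. cut_norm (\<lambda>z. V a z - K a z) \<le> \<eta>))"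
    for A and K :: kernel
  have ex: "\<exists>K\<in>\<K>. near A K" if A0: "A \<in> ?S" for A
  proof -
    obtain n X where A: "A = graphon_class k (empirical_graphon k n X)" "n \<ge> 1" "X \<in> colorings k n"
      using A0 by blast
    obtain \<phi> K where \<phi>: "\<phi> \<in> mp_bijections" and K: "K \<in> \<K>"
      "\<forall>a\<in>{1..k}. cut_norm (\<lambda>z. relabel \<phi> (empirical_graphon k n X) a z - K a z) \<le> \<eta>"
      using ap[OF A(2)] by blast
    have g: "empirical_graphon k n X \<in> graphons k" by (rule empirical_graphon_in[OF k A(3)])
    have g': "relabel \<phi> (empirical_graphon k n X) \<in> graphons k"
      using g \<phi> relabel_graphon unfolding mp_bijections_def by auto
    have "(relabel \<phi> (empirical_graphon k n X), empirical_graphon k n X) \<in> cut_rel k"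
      unfolding cut_rel_def using g g' cut_dist_relabel[OF g \<phi>] by auto
    then have "A = graphon_class k (relabel \<phi> (empirical_graphon k n X))"
      unfolding A graphon_class_def using equiv_class_eq[OF equiv_cut_rel] by metis
    then show ?thesis unfolding near_def using g' K by blast
  qed
  have dist: "class_dist k A B < \<epsilon>" if n: "near A K" "near B K" and K: "K \<in> \<K>" for A B K
  proof -
    obtain V W where V: "V \<in> graphons k" "A = graphon_class k V" "\<And>a. a\<in>{1..k} \<Longrightarrow> cut_norm (\<lambda>z. V a z - K a z) \<le> \<eta>"
      and W: "W \<in> graphons k" "B = graphon_class k W" "\<And>a. a\<in>{1..k} \<Longrightarrow> cut_norm (\<lambda>z. W a z - K a z) \<le> \<eta>"
      using n unfolding near_def by blast
    have "class_dist k A B = cut_dist k V W" unfolding V W by (rule class_dist_class[OF V(1) W(1)])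
    also have "\<dots> \<le> (\<Sum>a=1..k. cut_norm (\<lambda>p. V a p - W a p))" by (rule cut_dist_le_cut_norm[OF V(1) W(1)])
    also have "\<dots> \<le> (\<Sum>a=1..k. 2 * \<eta>)"
    proof (rule sum_mono)
      fix a assume a: "a \<in> {1..k}"
      have "cut_norm (\<lambda>p. V a p - W a p) \<le> cut_norm (\<lambda>p. V a p - K a p) + cut_norm (\<lambda>p. K a p - W a p)"
        by (intro cut_norm_triangle_diff graphon_bounded[OF V(1) a] graphon_bounded[OF W(1) a] \<K>(2) K)
      then show "cut_norm (\<lambda>p. V a p - W a p) \<le> 2 * \<eta>"
        using V(3)[OF a] W(3)[OF a] cut_norm_minus_commute[of "K a" "W a"] by simp
    qed
    also have "\<dots> = \<epsilon> / 2" using k unfolding \<eta>_def by simp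
    also have "\<dots> < \<epsilon>" using e by simp
    finally show ?thesis .
  qed
  show "\<exists>\<K> near. finite (\<K> :: kernel set) \<and> (\<forall>A\<in>?S. \<exists>K\<in>\<K>. near A K) \<and>
      (\<forall>K\<in>\<K>. \<forall>A B. near A K \<longrightarrow> near B K \<longrightarrow> class_dist k A B < \<epsilon>)"
    using \<K>(1) ex dist by (intro exI[of _ \<K>] exI[of _ near]) simp
qed

section \<open>Weak convergence and lower semicontinuity of the entropy\<close>

lemma sets_unit_generator: "sets unit_measure = sigma_sets {0..1} (range (\<lambda>a. {0..1} \<inter> {..a}))"
proof -
  have "sets unit_measure = sets (restrict_space (borel :: real measure) {0..1})"
    unfolding unit_measure_def by (intro sets_restrict_space_cong) simp
  also have "\<dots> = (\<inter>) {0..1} ` sigma_sets UNIV (range atMost)"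
    unfolding sets_restrict_space by (subst borel_eq_atMost) simp
  also have "\<dots> = sigma_sets {0..1} ((\<inter>) {0..1} ` range atMost)"
  proof (rule sigma_sets_Int)
    have "sets (borel :: real measure) = sigma_sets UNIV (range atMost)"
      by (subst borel_eq_atMost) simp
    then show "{0..1} \<in> sigma_sets UNIV (range (atMost :: real \<Rightarrow> _))"
      using borel_closed[of "{0..1::real}"] by simp
  qed simp
  finally show ?thesis by (simp add: image_image)
qed

text \<open>Boxes anchored at the origin generate the Borel sets of the square, are stable under
  intersection, and are rectangles, so integrals over them are bounded by the cut norm.\<close>

definition corner :: "real \<Rightarrow> real \<Rightarrow> (real \<times> real) set" where
  "corner a b = ({0..1} \<inter> {..a}) \<times> ({0..1} \<inter> {..b})"

lemma sets_square_generator: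
  "sets square_measure = sigma_sets (space square_measure) {corner a b | a b. True}"
proof -
  let ?E = "range (\<lambda>a::real. {0..1} \<inter> {..a})"
  have *: "?E \<subseteq> Pow (space unit_measure)" "sets unit_measure = sigma_sets (space unit_measure) ?E"
     "countable {{0..1::real}}" "{{0..1}} \<subseteq> ?E" "\<Union>{{0..1}} = space unit_measure"
    using sets_unit_generator by (auto intro: image_eqI[of _ _ 1])
  have "sets square_measure = sets (sigma (space unit_measure \<times> space unit_measure) {a \<times> b | a b. a \<in> ?E \<and> b \<in> ?E})"
    by (rule sets_pair_eq[OF * *])
  also have "\<dots> = sigma_sets (space unit_measure \<times> space unit_measure) {a \<times> b | a b. a \<in> ?E \<and> b \<in> ?E}"
    by (rule sets_measure_of) auto
  also have "{a \<times> b | a b. a \<in> ?E \<and> b \<in> ?E} = {corner a b | a b. True}"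
    unfolding corner_def by blast
  finally show ?thesis by (simp add: space_pair_measure)
qed

lemma corner_sets [measurable, simp]: "corner a b \<in> sets square_measure"
  unfolding sets_square_generator by (rule sigma_sets.Basic) blast

lemma corner_one: "corner 1 1 = space square_measure"
  by (auto simp: corner_def space_pair_measure)

lemma integrable_square_indicator [simp]: "A \<in> sets square_measure \<Longrightarrow> integrable square_measure (indicat_real A)"
  by (intro integrable_real_indicator) (auto simp: less_top[symmetric])

text \<open>A Dynkin argument passes from boxes to all measurable sets, and simple functions pass to
  L1. The case \<open>lim\<close> is stated as closure under L1 approximation because the
  functionals to which the rule is applied are Lipschitz in L1, uniformly in their index.\<close>

lemma square_integrable_induct [consumes 1, case_names corner scale add lim]:
  fixes f :: "real \<times> real \<Rightarrow> real"
  assumes f: "integrable square_measure f"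
    and corner: "\<And>a b. P (indicat_real (corner a b))"
    and scale: "\<And>c g. integrable square_measure g \<Longrightarrow> P g \<Longrightarrow> P (\<lambda>p. c * g p)"
    and add: "\<And>g h. integrable square_measure g \<Longrightarrow> P g \<Longrightarrow> integrable square_measure h \<Longrightarrow> P h \<Longrightarrow> P (\<lambda>p. g p + h p)"
    and lim: "\<And>g. integrable square_measure g \<Longrightarrow>
      (\<And>\<epsilon>. \<epsilon> > 0 \<Longrightarrow> \<exists>h. integrable square_measure h \<and> P h \<and> (\<integral>p. \<bar>g p - h p\<bar> \<partial>square_measure) < \<epsilon>) \<Longrightarrow> P g"
  shows "P f"
proof -
  have zero: "P (\<lambda>p. 0)"
    using scale[of "indicat_real (corner 1 1)" 0] corner by simp
  have ind: "P (indicat_real E)" if "E \<in> sets square_measure" for E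
  proof -
    have E: "E \<in> sigma_sets (space square_measure) {corner a b | a b. True}"
      using that unfolding sets_square_generator .
    have "Int_stable {corner a b | a b. True}"
    proof (rule Int_stableI)
      fix A B assume "A \<in> {corner a b | a b. True}" "B \<in> {corner a b | a b. True}"
      then obtain a b c d where "A = corner a b" "B = corner c d" by blast
      then have "A \<inter> B = corner (min a c) (min b d)" by (auto simp: corner_def)
      then show "A \<inter> B \<in> {corner a b | a b. True}" by blast
    qed
    moreover have "{corner a b | a b. True} \<subseteq> Pow (space square_measure)"
      by (auto simp: corner_def space_pair_measure)
    ultimately show ?thesis using E
    proof (induction rule: sigma_sets_induct_disjoint)
      case (basic A)
      then show ?case using corner by auto
    next
      case empty
      then show ?case using zero by (simp add: indicator_def[abs_def])
    next
      case (compl A)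
      then have A: "A \<in> sets square_measure" unfolding sets_square_generator by simp
      have "indicat_real (space square_measure - A) = (\<lambda>p. indicat_real (corner 1 1) p + (-1) * indicat_real A p)"
        unfolding corner_one using sets.sets_into_space[OF A] by (auto simp: indicator_def fun_eq_iff)
      moreover have "P (\<lambda>p. indicat_real (corner 1 1) p + (-1) * indicat_real A p)"
        using A compl corner by (intro add scale integrable_mult_right) auto
      ultimately show ?case by simp
    next
      case (union A)
      then have A: "range A \<subseteq> sets square_measure" unfolding sets_square_generator by simp
      then have Ai: "A i \<in> sets square_measure" for i by auto
      \<comment> \<open>Countable additivity makes these partial sums converge in L1, which is the
        approximation that \<open>lim\<close> asks for.\<close>
      define h where "h n p = (\<Sum>i<n. indicat_real (A i) p)" for n :: nat and p
      have ih: "integrable square_measure (h n)" for n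
        unfolding h_def using Ai by (intro Bochner_Integration.integrable_sum) auto
      have Ph: "P (h n)" for n
      proof (induction n)
        case 0 then show ?case using zero by (simp add: h_def[abs_def])
      next
        case (Suc n)
        have "P (\<lambda>p. h n p + indicat_real (A n) p)" using Suc Ai union(3) ih by (intro add) auto
        then show ?case by (simp add: h_def[abs_def])
      qed
      have hle: "h n p = indicat_real (\<Union>i<n. A i) p" for n p
        unfolding h_def using union(1) by (subst indicator_UN_disjoint) (auto simp: disjoint_family_on_def)
      have d: "(\<integral>p. \<bar>indicat_real (\<Union>i. A i) p - h n p\<bar> \<partial>square_measure) =
          measure square_measure (\<Union>i. A i) - (\<Sum>i<n. measure square_measure (A i))" for n
      proof -
        have "\<bar>indicat_real (\<Union>i. A i) p - h n p\<bar> = indicat_real (\<Union>i. A i) p - h n p" for p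
          unfolding hle by (auto simp: indicator_def)
        moreover have "(\<integral>p. h n p \<partial>square_measure) = (\<Sum>i<n. measure square_measure (A i))"
          unfolding h_def using Ai by (subst Bochner_Integration.integral_sum) (auto simp: sets.Int_space_eq2)
        moreover have "(\<Union>i. A i) \<in> sets square_measure" using A by auto
        ultimately show ?thesis using ih[of n] by (simp add: sets.Int_space_eq2)
      qed
      have "(\<lambda>n. \<Sum>i<n. measure square_measure (A i)) \<longlonglongrightarrow> measure square_measure (\<Union>i. A i)"
        using SM.finite_measure_UNION[OF A union(1)] unfolding sums_def .
      then have "(\<lambda>n. measure square_measure (\<Union>i. A i) - (\<Sum>i<n. measure square_measure (A i))) \<longlonglongrightarrow> 0"
        using tendsto_diff[OF tendsto_const, of _ "measure square_measure (\<Union>i. A i)" _ "measure square_measure (\<Union>i. A i)"] by simp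
      then have "\<exists>n. measure square_measure (\<Union>i. A i) - (\<Sum>i<n. measure square_measure (A i)) < \<epsilon>" if "\<epsilon> > 0" for \<epsilon>
        using eventually_happens'[OF sequentially_bot order_tendstoD(2)[OF _ that]] by blast
      then have ap: "\<exists>n. (\<integral>p. \<bar>indicat_real (\<Union>i. A i) p - h n p\<bar> \<partial>square_measure) < \<epsilon>" if "\<epsilon> > 0" for \<epsilon>
        using that unfolding d by blast
      show ?case
      proof (rule lim)
        show "integrable square_measure (indicat_real (\<Union>i. A i))" using A by auto
        fix \<epsilon> :: real assume "\<epsilon> > 0"
        from ap[OF this] obtain n where "(\<integral>p. \<bar>indicat_real (\<Union>i. A i) p - h n p\<bar> \<partial>square_measure) < \<epsilon>" ..
        then show "\<exists>h. integrable square_measure h \<and> P h \<and> (\<integral>p. \<bar>indicat_real (\<Union>i. A i) p - h p\<bar> \<partial>square_measure) < \<epsilon>"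
          using ih Ph by (intro exI[of _ "h n"] conjI)
      qed
    qed
  qed
  show ?thesis
    using f
  proof (induction rule: integrable_induct)
    case (base A c)
    then show ?case using scale[OF integrable_square_indicator[OF base(1)] ind[OF base(1)], of c]
      by (simp add: mult.commute)
  next
    case (add f g)
    show ?case by (rule assms(4)[OF add(1,3,2,4)])
  next
    case (lim f s)
    note [measurable] = borel_measurable_integrable[OF lim(4)] borel_measurable_integrable[OF lim(1)]
    have "(\<lambda>i. \<integral>p. \<bar>f p - s i p\<bar> \<partial>square_measure) \<longlonglongrightarrow> (\<integral>p. 0 \<partial>square_measure)"
    \<comment> \<open>The approximating simple functions are bounded by twice the modulus of
      \<open>f\<close>, whence the majorant with factor 3.\<close>
    proof (rule integral_dominated_convergence[where w = "\<lambda>p. 3 * \<bar>f p\<bar>"])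
      show "AE p in square_measure. (\<lambda>i. \<bar>f p - s i p\<bar>) \<longlonglongrightarrow> 0"
      proof (rule AE_I2)
        fix p assume "p \<in> space square_measure"
        from tendsto_rabs[OF tendsto_diff[OF tendsto_const lim(2)[OF this], of "f p"]]
        show "(\<lambda>i. \<bar>f p - s i p\<bar>) \<longlonglongrightarrow> 0" by simp
      qed
      show "AE p in square_measure. norm \<bar>f p - s i p\<bar> \<le> 3 * \<bar>f p\<bar>" for i
        using lim(3) by (intro AE_I2) (smt (verit) real_norm_def)
    qed (use lim(4) in auto)
    then have l: "(\<lambda>i. \<integral>p. \<bar>f p - s i p\<bar> \<partial>square_measure) \<longlonglongrightarrow> 0" by simp
    show ?case
    proof (rule assms(5)[OF lim(4)])
      fix \<epsilon> :: real assume "\<epsilon> > 0"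
      then have "\<exists>i. (\<integral>p. \<bar>f p - s i p\<bar> \<partial>square_measure) < \<epsilon>"
        using eventually_happens'[OF sequentially_bot order_tendstoD(2)[OF l]] by blast
      then show "\<exists>h. integrable square_measure h \<and> P h \<and> (\<integral>p. \<bar>f p - h p\<bar> \<partial>square_measure) < \<epsilon>"
        using lim(1,5) by blast
    qed
  qed
qed

section \<open>Cut norm convergence tested against integrable functions\<close>

lemma bounded_integrable_mult:
  assumes D: "D \<in> borel_measurable square_measure" "\<And>p. p \<in> space square_measure \<Longrightarrow> \<bar>D p\<bar> \<le> C"
    and g: "integrable square_measure g"
  shows "integrable square_measure (\<lambda>p. D p * g p :: real)"
    "\<bar>\<integral>p. D p * g p \<partial>square_measure\<bar> \<le> C * (\<integral>p. \<bar>g p\<bar> \<partial>square_measure)"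
proof -
  note [measurable] = D(1) borel_measurable_integrable[OF g]
  have b: "\<bar>D p * g p\<bar> \<le> C * \<bar>g p\<bar>" if "p \<in> space square_measure" for p
    unfolding abs_mult using D(2)[OF that] by (intro mult_right_mono) auto
  have iC: "integrable square_measure (\<lambda>p. C * \<bar>g p\<bar>)" using g by auto
  show i: "integrable square_measure (\<lambda>p. D p * g p)"
    by (rule Bochner_Integration.integrable_bound[OF iC]) (use b in \<open>auto intro!: AE_I2 order_trans[OF b]\<close>)
  have "\<bar>\<integral>p. D p * g p \<partial>square_measure\<bar> \<le> (\<integral>p. \<bar>D p * g p\<bar> \<partial>square_measure)"
    using integral_norm_bound[of square_measure "\<lambda>p. D p * g p"] by simp
  also have "\<dots> \<le> (\<integral>p. C * \<bar>g p\<bar> \<partial>square_measure)"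
    using i iC b by (intro integral_mono) auto
  finally show "\<bar>\<integral>p. D p * g p \<partial>square_measure\<bar> \<le> C * (\<integral>p. \<bar>g p\<bar> \<partial>square_measure)" by simp
qed

lemma integral_corner_le_cut_norm:
  assumes "bounded_kernel D"
  shows "\<bar>\<integral>p. D p * indicat_real (corner a b) p \<partial>square_measure\<bar> \<le> cut_norm D"
proof -
  have "{0..1} \<inter> {..a} \<in> sets unit_measure" for a :: real
    unfolding sets_unit_generator by (rule sigma_sets.Basic) blast
  from cut_norm_upper[OF assms this this, of a b]
  show ?thesis unfolding set_lebesgue_integral_def corner_def by (simp add: mult.commute)
qed

text \<open>On boxes the pairing is at most the cut norm. The uniform bound \<open>C\<close> makes
  the pairing Lipschitz in the L1 norm of \<open>g\<close> with a constant independent of j, so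
  convergence extends to all integrable \<open>g\<close>.\<close>

lemma cut_norm_weak_convergence:
  assumes D: "\<And>j. D j \<in> borel_measurable square_measure" "\<And>j p. p \<in> space square_measure \<Longrightarrow> \<bar>D j p\<bar> \<le> C"
    and cn: "(\<lambda>j. cut_norm (D j)) \<longlonglongrightarrow> 0"
    and g: "integrable square_measure g"
  shows "(\<lambda>j. \<integral>p. D j p * g p \<partial>square_measure) \<longlonglongrightarrow> 0"
  using g
proof (induction rule: square_integrable_induct)
  case (corner a b)
  have "bounded_kernel (D j)" for j using D unfolding bounded_kernel_def by blast
  then show ?case
    by (intro Lim_null_comparison[OF _ cn] always_eventually allI) (simp add: integral_corner_le_cut_norm)
next
  case (scale c g)
  from tendsto_mult_right_zero[OF scale(2), of c] show ?case by (simp add: mult.left_commute)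
next
  case (add g h)
  have "(\<integral>p. D j p * (g p + h p) \<partial>square_measure) = (\<integral>p. D j p * g p \<partial>square_measure) + (\<integral>p. D j p * h p \<partial>square_measure)" for j
    unfolding distrib_left
    by (intro Bochner_Integration.integral_add bounded_integrable_mult(1)[OF D(1) D(2)] add)
  then show ?case using tendsto_add[OF add(3,4)] by simp
next
  case (lim g)
  have C: "C \<ge> 0" using D(2)[of "(0,0)" 0] by (force simp: space_pair_measure)
  show ?case
  proof (rule LIMSEQ_I)
    fix e :: real assume e: "e > 0"
    \<comment> \<open>The denominator uses C + 1 so that it stays positive when \<open>C\<close> is
      0.\<close>
    obtain h where h: "integrable square_measure h" "(\<lambda>j. \<integral>p. D j p * h p \<partial>square_measure) \<longlonglongrightarrow> 0"
      "(\<integral>p. \<bar>g p - h p\<bar> \<partial>square_measure) < e / (2 * (C + 1))"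
      using lim(2)[of "e / (2 * (C + 1))"] e C by auto
    obtain J where J: "\<bar>\<integral>p. D j p * h p \<partial>square_measure\<bar> < e / 2" if "j \<ge> J" for j
      using LIMSEQ_D[OF h(2), of "e / 2"] e by auto
    have gh: "integrable square_measure (\<lambda>p. g p - h p)" using lim(1) h(1) by auto
    have "\<bar>\<integral>p. D j p * g p \<partial>square_measure\<bar> < e" if "j \<ge> J" for j
    proof -
      have "(\<integral>p. D j p * g p \<partial>square_measure) = (\<integral>p. D j p * h p + D j p * (g p - h p) \<partial>square_measure)"
        by (simp add: algebra_simps)
      also have "\<dots> = (\<integral>p. D j p * h p \<partial>square_measure) + (\<integral>p. D j p * (g p - h p) \<partial>square_measure)"
        by (intro Bochner_Integration.integral_add bounded_integrable_mult(1)[OF D(1) D(2)] h gh)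
      finally have "\<bar>\<integral>p. D j p * g p \<partial>square_measure\<bar> \<le> \<bar>\<integral>p. D j p * h p \<partial>square_measure\<bar> + C * (\<integral>p. \<bar>g p - h p\<bar> \<partial>square_measure)"
        using bounded_integrable_mult(2)[OF D(1) D(2) gh, of j] by linarith
      moreover have "C * (\<integral>p. \<bar>g p - h p\<bar> \<partial>square_measure) \<le> (C + 1) * (e / (2 * (C + 1)))"
        using h(3) C by (intro mult_mono) auto
      moreover have "(C + 1) * (e / (2 * (C + 1))) = e / 2" using C by (simp add: divide_simps)
      ultimately show ?thesis using J[OF that] by linarith
    qed
    then show "\<exists>no. \<forall>n\<ge>no. norm ((\<integral>p. D n p * g p \<partial>square_measure) - 0) < e" by auto
  qed
qed

text \<open>Fenchel-Young inequality: \<open>exp (g - 1)\<close> is the convex conjugate of x ln x,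
  with equality at g = 1 + ln x when x > 0. It is the bound exp z \<ge> 1 + z at z = g - 1 - ln
  x.\<close>

lemma xlnx_Young:
  fixes x g :: real
  assumes "0 \<le> x" shows "x * g - exp (g - 1) \<le> x * ln x"
proof (cases "x = 0")
  case False
  then have x: "x > 0" using assms by simp
  have "1 + (g - 1 - ln x) \<le> exp (g - 1 - ln x)" by (rule exp_ge_add_one_self)
  also have "\<dots> = exp (g - 1) / x" using x by (simp add: exp_diff)
  finally show ?thesis using x by (simp add: field_simps)
qed auto

lemma xlnx_bounds:
  fixes x :: real
  assumes "0 \<le> x" "x \<le> 1" shows "-1 \<le> x * ln x" "x * ln x \<le> 0"
proof -
  have "x * 0 - exp (0 - 1) \<le> x * ln x" by (rule xlnx_Young[OF assms(1)])
  moreover have "exp (0 - 1 :: real) \<le> 1" by simp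
  ultimately show "-1 \<le> x * ln x" by linarith
  show "x * ln x \<le> 0" using assms by (cases "x = 0") (auto simp: mult_nonneg_nonpos)
qed

lemma graphon_range:
  assumes "W \<in> graphons k" "a \<in> {1..k}" "p \<in> space square_measure"
  shows "0 \<le> W a p" "W a p \<le> 1"
proof -
  obtain x y where "p = (x, y)" "x \<in> {0..1}" "y \<in> {0..1}" using assms(3) by (auto simp: space_pair_measure)
  then show "0 \<le> W a p" "W a p \<le> 1" using assms unfolding graphons_def prob_simplex_def by fastforce+
qed

lemma graphon_measurable:
  "W \<in> graphons k \<Longrightarrow> a \<in> {1..k} \<Longrightarrow> W a \<in> borel_measurable square_measure"
  unfolding graphons_def by auto

lemma graphon_integrable:
  "W \<in> graphons k \<Longrightarrow> a \<in> {1..k} \<Longrightarrow> integrable square_measure (W a)"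
  by (intro bounded_kernel_integrable graphon_bounded)

lemma entropy_bounded_kernel:
  assumes "W \<in> graphons k" "a \<in> {1..k}"
  shows "bounded_kernel (\<lambda>p. W a p * ln (W a p))"
  unfolding bounded_kernel_def
proof (intro conjI exI[of _ 1] ballI)
  show "(\<lambda>p. W a p * ln (W a p)) \<in> borel_measurable square_measure"
    using graphon_measurable[OF assms] by measurable
  show "\<bar>W a p * ln (W a p)\<bar> \<le> 1" if "p \<in> space square_measure" for p
    using xlnx_bounds[OF graphon_range[OF assms that]] by linarith
qed

lemma entropy_integrable:
  assumes "W \<in> graphons k" "a \<in> {1..k}"
  shows "integrable square_measure (\<lambda>p. W a p * ln (W a p))"
  by (rule bounded_kernel_integrable[OF entropy_bounded_kernel[OF assms]])

lemma entropy_lower_bound: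
  assumes "W \<in> graphons k" shows "- real k \<le> entropy k W"
proof -
  have "-1 \<le> (\<integral>p. W a p * ln (W a p) \<partial>square_measure)" if a: "a \<in> {1..k}" for a
  proof -
    have "(\<integral>p. -1 \<partial>square_measure) \<le> (\<integral>p. W a p * ln (W a p) \<partial>square_measure)"
      using xlnx_bounds[OF graphon_range[OF assms a]] entropy_integrable[OF assms a]
      by (intro integral_mono) auto
    then show ?thesis unfolding integral_square_const .
  qed
  then have "(\<Sum>a=1..k. -1) \<le> entropy k W" unfolding entropy_def by (intro sum_mono) auto
  then show ?thesis by simp
qed

text \<open>The entropy is a supremum of the weakly continuous functionals
  \<open>V \<mapsto> \<integral> V g - \<integral> exp (g - 1)\<close>, almost attained at \<open>g = 1 + ln (max W \<delta>)\<close>.\<close>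

lemma entropy_lower_semicontinuous:
  assumes V: "\<And>j. V j \<in> graphons k" and W: "W \<in> graphons k"
    and cn: "\<And>a. a \<in> {1..k} \<Longrightarrow> (\<lambda>j. cut_norm (\<lambda>p. V j a p - W a p)) \<longlonglongrightarrow> 0"
    and c: "\<And>j. entropy k (V j) \<le> c j" "c \<longlonglongrightarrow> l"
  shows "entropy k W \<le> l"
proof -
  have "entropy k W - real k * \<delta> \<le> l" if \<delta>: "0 < \<delta>" "\<delta> \<le> 1" for \<delta>
  proof -
    \<comment> \<open>Truncation at \<delta> keeps the optimal test function bounded where
      \<open>W a\<close> vanishes. Then \<open>exp (g a p - 1)\<close> exceeds \<open>W a p\<close>
      by at most \<delta>, so the total loss is k \<delta>, which is sent to 0 at the end.\<close>
    define g where "g a p = 1 + ln (max (W a p) \<delta>)" for a p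
    have ex: "exp (g a p - 1) = max (W a p) \<delta>" for a p unfolding g_def using \<delta> by simp
    have gm: "g a \<in> borel_measurable square_measure" if "a \<in> {1..k}" for a
      unfolding g_def using graphon_measurable[OF W that] by measurable
    have mi: "integrable square_measure (\<lambda>p. max (W a p) \<delta>)" if "a \<in> {1..k}" for a
      using graphon_integrable[OF W that] by auto
    have gb: "\<bar>g a p\<bar> \<le> 1 + \<bar>ln \<delta>\<bar>" if "a \<in> {1..k}" "p \<in> space square_measure" for a p
    proof -
      have "\<delta> \<le> max (W a p) \<delta>" "max (W a p) \<delta> \<le> 1" using graphon_range[OF W that] \<delta> by auto
      then have "ln \<delta> \<le> ln (max (W a p) \<delta>)" "ln (max (W a p) \<delta>) \<le> 0" using \<delta> by auto
      then show ?thesis unfolding g_def by linarith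
    qed
    have gi: "integrable square_measure (g a)" if "a \<in> {1..k}" for a
      using gm[OF that] gb[OF that] by (intro bounded_kernel_integrable) (unfold bounded_kernel_def, blast)
    have Ug: "integrable square_measure (\<lambda>p. U a p * g a p)" if "a \<in> {1..k}" "U \<in> graphons k" for a U
      using graphon_measurable[OF that(2,1)] graphon_range[OF that(2,1)] gi[OF that(1)]
      by (intro bounded_integrable_mult(1)[where C = 1]) auto
    define \<Phi> where "\<Phi> U = (\<Sum>a=1..k. (\<integral>p. U a p * g a p \<partial>square_measure) - (\<integral>p. max (W a p) \<delta> \<partial>square_measure))"
      for U :: kernel
    have low: "\<Phi> (V j) \<le> c j" for j
    proof -
      have "(\<integral>p. V j a p * g a p \<partial>square_measure) - (\<integral>p. max (W a p) \<delta> \<partial>square_measure)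
          \<le> (\<integral>p. V j a p * ln (V j a p) \<partial>square_measure)" if a: "a \<in> {1..k}" for a
      proof -
        have "(\<integral>p. V j a p * g a p - max (W a p) \<delta> \<partial>square_measure)
          \<le> (\<integral>p. V j a p * ln (V j a p) \<partial>square_measure)"
          using Ug[OF a V[of j]] mi[OF a] entropy_integrable[OF V a] xlnx_Young[OF graphon_range(1)[OF V a], of _ _ "g a _"]
          unfolding ex by (intro integral_mono) auto
        then show ?thesis using Ug[OF a V[of j]] mi[OF a] by simp
      qed
      then have "\<Phi> (V j) \<le> entropy k (V j)" unfolding \<Phi>_def entropy_def by (intro sum_mono)
      then show ?thesis using c(1)[of j] by simp
    qed
    have conv: "(\<lambda>j. \<Phi> (V j)) \<longlonglongrightarrow> \<Phi> W"
      unfolding \<Phi>_def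
    proof (intro tendsto_sum tendsto_diff tendsto_const)
      fix a assume a: "a \<in> {1..k}"
      have "(\<lambda>j. \<integral>p. (V j a p - W a p) * g a p \<partial>square_measure) \<longlonglongrightarrow> 0"
      proof (rule cut_norm_weak_convergence[OF _ _ cn[OF a] gi[OF a]])
        show "(\<lambda>p. V j a p - W a p) \<in> borel_measurable square_measure" for j
          using graphon_measurable[OF V a] graphon_measurable[OF W a] by measurable
        show "\<bar>V j a p - W a p\<bar> \<le> 1" if "p \<in> space square_measure" for j p
          using graphon_range[OF V a that, of j] graphon_range[OF W a that] by linarith
      qed
      moreover have "(\<integral>p. (V j a p - W a p) * g a p \<partial>square_measure) =
          (\<integral>p. V j a p * g a p \<partial>square_measure) - (\<integral>p. W a p * g a p \<partial>square_measure)" for j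
        using Ug[OF a V[of j]] Ug[OF a W] by (simp add: left_diff_distrib)
      ultimately show "(\<lambda>j. \<integral>p. V j a p * g a p \<partial>square_measure) \<longlonglongrightarrow> (\<integral>p. W a p * g a p \<partial>square_measure)"
        by (simp add: LIM_zero_iff)
    qed
    have "entropy k W - real k * \<delta> \<le> \<Phi> W"
    proof -
      have "(\<integral>p. W a p * ln (W a p) \<partial>square_measure) - \<delta> \<le>
         (\<integral>p. W a p * g a p \<partial>square_measure) - (\<integral>p. max (W a p) \<delta> \<partial>square_measure)" if a: "a \<in> {1..k}" for a
      proof -
        have "W a p * ln (W a p) - \<delta> \<le> W a p * g a p - max (W a p) \<delta>" if p: "p \<in> space square_measure" for p
        proof -
          have "W a p * ln (W a p) \<le> W a p * ln (max (W a p) \<delta>)"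
            using graphon_range(1)[OF W a p] \<delta> by (cases "W a p = 0") (auto intro!: mult_left_mono)
          moreover have "max (W a p) \<delta> \<le> W a p + \<delta>" using graphon_range(1)[OF W a p] \<delta> by auto
          ultimately show ?thesis unfolding g_def distrib_left mult_1_right by linarith
        qed
        then have "(\<integral>p. W a p * ln (W a p) - \<delta> \<partial>square_measure) \<le> (\<integral>p. W a p * g a p - max (W a p) \<delta> \<partial>square_measure)"
          using Ug[OF a W] mi[OF a] entropy_integrable[OF W a] by (intro integral_mono) auto
        then show ?thesis using Ug[OF a W] mi[OF a] entropy_integrable[OF W a] measure_square_space by simp
      qed
      then have "(\<Sum>a=1..k. (\<integral>p. W a p * ln (W a p) \<partial>square_measure) - \<delta>) \<le> \<Phi> W"
        unfolding \<Phi>_def by (rule sum_mono)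
      then show ?thesis by (simp add: entropy_def sum_subtractf)
    qed
    also have "\<Phi> W \<le> l" by (rule LIMSEQ_le[OF conv c(2)]) (use low in auto)
    finally show ?thesis .
  qed
  then have "eventually (\<lambda>\<delta>. entropy k W - real k * \<delta> \<le> l) (at_right 0)"
    unfolding eventually_at_right_field by (intro exI[of _ 1]) auto
  moreover have "((\<lambda>\<delta>. entropy k W - real k * \<delta>) \<longlongrightarrow> entropy k W - real k * 0) (at_right 0)"
    by (intro tendsto_intros)
  ultimately show ?thesis
    using tendsto_upperbound[of "\<lambda>\<delta>. entropy k W - real k * \<delta>"] by (simp add: trivial_limit_at_right_real)
qed

section \<open>Completeness in cut norm and cut distance\<close>

text \<open>Weak convergence before a limit is known: on boxes the integrals are Cauchy, since their
  differences are at most cut norms, and the bound 1 on the kernels makes the L1 approximation of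
  \<open>g\<close> uniform in j.\<close>

lemma cut_norm_Cauchy_weak:
  assumes V: "\<And>j. V j \<in> borel_measurable square_measure" "\<And>j p. p \<in> space square_measure \<Longrightarrow> \<bar>V j p\<bar> \<le> 1"
    and cauchy: "\<And>\<epsilon>. \<epsilon> > 0 \<Longrightarrow> \<exists>N. \<forall>i\<ge>N. \<forall>j\<ge>N. cut_norm (\<lambda>p. V i p - V j p) < \<epsilon>"
    and g: "integrable square_measure g"
  shows "convergent (\<lambda>j. \<integral>p. V j p * g p \<partial>square_measure)"
  using g
proof (induction rule: square_integrable_induct)
  case (corner a b)
  have bV: "bounded_kernel (V j)" for j using V unfolding bounded_kernel_def by blast
  have ic: "integrable square_measure (\<lambda>p. V j p * indicat_real (corner a b) p)" for j
    by (rule bounded_integrable_mult(1)[OF V(1) V(2)]) auto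
  have d: "\<bar>(\<integral>p. V i p * indicat_real (corner a b) p \<partial>square_measure) - (\<integral>p. V j p * indicat_real (corner a b) p \<partial>square_measure)\<bar>
      \<le> cut_norm (\<lambda>p. V i p - V j p)" for i j
    using integral_corner_le_cut_norm[OF bounded_kernel_diff[OF bV bV], of i j a b] ic[of i] ic[of j]
    by (simp add: left_diff_distrib)
  have "Cauchy (\<lambda>j. \<integral>p. V j p * indicat_real (corner a b) p \<partial>square_measure)"
  proof (rule metric_CauchyI)
    fix e :: real assume "e > 0"
    then obtain N where N: "\<forall>i\<ge>N. \<forall>j\<ge>N. cut_norm (\<lambda>p. V i p - V j p) < e" using cauchy by blast
    show "\<exists>M. \<forall>m\<ge>M. \<forall>n\<ge>M. dist (\<integral>p. V m p * indicat_real (corner a b) p \<partial>square_measure)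
        (\<integral>p. V n p * indicat_real (corner a b) p \<partial>square_measure) < e"
      unfolding dist_real_def using N d by (intro exI[of _ N]) (meson order_le_less_trans)
  qed
  then show ?case by (rule Cauchy_convergent)
next
  case (scale c g)
  have "(\<integral>p. V j p * (c * g p) \<partial>square_measure) = c * (\<integral>p. V j p * g p \<partial>square_measure)" for j
    by (simp add: mult.left_commute)
  then show ?case using convergent_mult[OF convergent_const scale(2), of c] by simp
next
  case (add g h)
  have "(\<integral>p. V j p * (g p + h p) \<partial>square_measure) = (\<integral>p. V j p * g p \<partial>square_measure) + (\<integral>p. V j p * h p \<partial>square_measure)" for j
    unfolding distrib_left
    by (intro Bochner_Integration.integral_add bounded_integrable_mult(1)[OF V(1) V(2)] add)
  then show ?case using convergent_add[OF add(3,4)] by simp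
next
  case (lim g)
  have "Cauchy (\<lambda>j. \<integral>p. V j p * g p \<partial>square_measure)"
  proof (rule metric_CauchyI)
    fix e :: real assume e: "e > 0"
    then obtain h where h: "integrable square_measure h" "convergent (\<lambda>j. \<integral>p. V j p * h p \<partial>square_measure)"
      "(\<integral>p. \<bar>g p - h p\<bar> \<partial>square_measure) < e / 3"
      using lim(2)[of "e / 3"] by auto
    have gh: "integrable square_measure (\<lambda>p. g p - h p)" using lim(1) h(1) by auto
    have d: "\<bar>(\<integral>p. V j p * g p \<partial>square_measure) - (\<integral>p. V j p * h p \<partial>square_measure)\<bar> < e / 3" for j
    proof -
      have "(\<integral>p. V j p * g p \<partial>square_measure) - (\<integral>p. V j p * h p \<partial>square_measure) = (\<integral>p. V j p * (g p - h p) \<partial>square_measure)"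
        unfolding right_diff_distrib
        by (intro Bochner_Integration.integral_diff[symmetric] bounded_integrable_mult(1)[OF V(1) V(2)] h lim(1))
      then show ?thesis using bounded_integrable_mult(2)[OF V(1) V(2) gh, of j] h(3) by simp
    qed
    obtain N where N: "\<forall>i\<ge>N. \<forall>j\<ge>N. dist (\<integral>p. V i p * h p \<partial>square_measure) (\<integral>p. V j p * h p \<partial>square_measure) < e / 3"
      using metric_CauchyD[OF convergent_Cauchy[OF h(2)], of "e / 3"] e by auto
    have "dist (\<integral>p. V i p * g p \<partial>square_measure) (\<integral>p. V j p * g p \<partial>square_measure) < e" if "i \<ge> N" "j \<ge> N" for i j
    proof -
      have "dist (\<integral>p. V i p * h p \<partial>square_measure) (\<integral>p. V j p * h p \<partial>square_measure) < e / 3" using N that by blast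
      then show ?thesis using d[of i] d[of j] unfolding dist_real_def by linarith
    qed
    then show "\<exists>M. \<forall>m\<ge>M. \<forall>n\<ge>M. dist (\<integral>p. V m p * g p \<partial>square_measure) (\<integral>p. V n p * g p \<partial>square_measure) < e"
      by blast
  qed
  then show ?case by (rule Cauchy_convergent)
qed

text \<open>The limits of \<open>\<integral>\<^sub>E V\<^sub>j\<close> form a measure dominated by Lebesgue measure; its density is the weak limit.\<close>

lemma cut_norm_Cauchy_density:
  assumes V: "\<And>j. V j \<in> borel_measurable square_measure"
    "\<And>j p. p \<in> space square_measure \<Longrightarrow> 0 \<le> V j p" "\<And>j p. p \<in> space square_measure \<Longrightarrow> V j p \<le> 1"
    and cauchy: "\<And>\<epsilon>. \<epsilon> > 0 \<Longrightarrow> \<exists>N. \<forall>i\<ge>N. \<forall>j\<ge>N. cut_norm (\<lambda>p. V i p - V j p) < \<epsilon>"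
  shows "\<exists>f\<in>borel_measurable square_measure. \<forall>E\<in>sets square_measure.
    \<exists>l. 0 \<le> l \<and> (\<lambda>j. \<integral>p. V j p * indicat_real E p \<partial>square_measure) \<longlonglongrightarrow> l \<and>
      (\<integral>\<^sup>+p. f p * indicator E p \<partial>square_measure) = ennreal l"
proof -
  have V': "\<bar>V j p\<bar> \<le> 1" if "p \<in> space square_measure" for j p using V(2,3)[OF that, of j] by simp
  define I where "I j E = (\<integral>p. V j p * indicat_real E p \<partial>square_measure)" for j E
  define L where "L E = lim (\<lambda>j. I j E)" for E
  have L: "(\<lambda>j. I j E) \<longlonglongrightarrow> L E" if "E \<in> sets square_measure" for E
    unfolding L_def convergent_LIMSEQ_iff[symmetric] I_def
    by (rule cut_norm_Cauchy_weak[OF V(1) V' cauchy]) (use that in auto)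
  have int: "integrable square_measure (\<lambda>p. V j p * indicat_real E p)" if "E \<in> sets square_measure" for j E
    by (rule bounded_integrable_mult(1)[OF V(1) V']) (use that in auto)
  have I0: "0 \<le> I j E" if "E \<in> sets square_measure" for j E
    unfolding I_def using V(2) by (intro integral_nonneg_AE AE_I2) auto
  have I1: "I j E \<le> measure square_measure E" if "E \<in> sets square_measure" for j E
  proof -
    have "I j E \<le> (\<integral>p. indicat_real E p \<partial>square_measure)"
      unfolding I_def
    proof (rule integral_mono[OF int[OF that] integrable_square_indicator[OF that]])
      show "V j p * indicat_real E p \<le> indicat_real E p" if "p \<in> space square_measure" for p
        using V(3)[OF that, of j] by (simp add: indicator_def)
    qed
    then show ?thesis using that by (simp add: sets.Int_space_eq2)
  qed
  have L0: "0 \<le> L E" if "E \<in> sets square_measure" for E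
    by (rule LIMSEQ_le_const[OF L[OF that]]) (use I0[OF that] in auto)
  have L1: "L E \<le> measure square_measure E" if "E \<in> sets square_measure" for E
    by (rule LIMSEQ_le_const2[OF L[OF that]]) (use I1[OF that] in auto)
  have Ladd: "L (A \<union> B) = L A + L B" if AB: "A \<in> sets square_measure" "B \<in> sets square_measure" "A \<inter> B = {}" for A B
  proof -
    have "I j (A \<union> B) = I j A + I j B" for j
    proof -
      have "V j p * indicat_real (A \<union> B) p = V j p * indicat_real A p + V j p * indicat_real B p" for p
        using AB(3) by (auto simp: indicator_def)
      then show ?thesis unfolding I_def using int[OF AB(1)] int[OF AB(2)] by simp
    qed
    then have "(\<lambda>j. I j (A \<union> B)) \<longlonglongrightarrow> L A + L B" using tendsto_add[OF L[OF AB(1)] L[OF AB(2)]] by simp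
    then show ?thesis using L[of "A \<union> B"] AB LIMSEQ_unique by blast
  qed
  define \<nu> where "\<nu> E = ennreal (L E)" for E
  \<comment> \<open>Finite additivity is inherited from the integrals. Continuity at the empty set
    holds because \<open>L\<close> is squeezed between 0 and Lebesgue measure; the same domination
    yields absolute continuity below.\<close>
  have ca: "countably_additive (sets square_measure) \<nu>"
  proof (rule ring_of_sets.empty_continuous_imp_countably_additive[OF sets.ring_of_sets_axioms])
    have "L {} = 0" using L0[of "{}"] L1[of "{}"] by simp
    then show "positive (sets square_measure) \<nu>" unfolding positive_def \<nu>_def by simp
    show "additive (sets square_measure) \<nu>"
      unfolding additive_def \<nu>_def using Ladd L0 by (simp add: ennreal_plus)
    show "\<forall>A\<in>sets square_measure. \<nu> A \<noteq> \<infinity>" unfolding \<nu>_def by simp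
    fix A :: "nat \<Rightarrow> (real \<times> real) set"
    assume A: "range A \<subseteq> sets square_measure" "decseq A" "(\<Inter>i. A i) = {}"
    then have Ai: "A i \<in> sets square_measure" for i by auto
    have Am: "(\<lambda>i. measure square_measure (A i)) \<longlonglongrightarrow> 0"
      using SM.finite_Lim_measure_decseq[OF A(1,2)] A(3) by simp
    have "(\<lambda>i. L (A i)) \<longlonglongrightarrow> 0"
      by (rule tendsto_sandwich[OF _ _ tendsto_const Am]) (simp_all add: L0[OF Ai] L1[OF Ai])
    from tendsto_ennrealI[OF this] show "(\<lambda>i. \<nu> (A i)) \<longlonglongrightarrow> 0" unfolding \<nu>_def by simp
  qed
  define N where "N = measure_of (space square_measure) (sets square_measure) \<nu>"
  have sN: "sets N = sets square_measure" unfolding N_def by simp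
  have N: "emeasure N E = \<nu> E" if "E \<in> sets square_measure" for E
  proof (rule emeasure_measure_of[OF N_def])
    show "positive (sets N) \<nu>" unfolding sN positive_def \<nu>_def using L0[of "{}"] L1[of "{}"] by simp
  qed (use ca sN that sets.space_closed in auto)
  have "absolutely_continuous square_measure N"
    unfolding absolutely_continuous_def
  proof
    fix E assume "E \<in> null_sets square_measure"
    then have E: "E \<in> sets square_measure" "measure square_measure E = 0" by (auto simp: measure_def null_sets_def)
    then have "L E = 0" using L0[of E] L1[of E] by simp
    then show "E \<in> null_sets N" using N[OF E(1)] E(1) sN by (auto simp: null_sets_def \<nu>_def)
  qed
  then obtain f where f: "f \<in> borel_measurable square_measure" "density square_measure f = N"
    using sigma_finite_measure.Radon_Nikodym[OF finite_measure.axioms(1)[OF SM.finite_measure_axioms] _ sN] by blast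
  have fL: "(\<integral>\<^sup>+p. f p * indicator E p \<partial>square_measure) = ennreal (L E)" if "E \<in> sets square_measure" for E
    using N[OF that] emeasure_density[OF f(1) that] f(2) unfolding \<nu>_def by simp
  show ?thesis
  proof (intro bexI[OF _ f(1)] ballI)
    fix E assume E: "E \<in> sets square_measure"
    show "\<exists>l. 0 \<le> l \<and> (\<lambda>j. \<integral>p. V j p * indicat_real E p \<partial>square_measure) \<longlonglongrightarrow> l \<and>
        (\<integral>\<^sup>+p. f p * indicator E p \<partial>square_measure) = ennreal l"
      by (intro exI[of _ "L E"] conjI L0 L[unfolded I_def] fL E)
  qed
qed

section \<open>Exchanging the two coordinates of the square\<close>

lemma square_swap:
  "distr square_measure square_measure (\<lambda>(x, y). (y, x)) = square_measure"
  using UP.distr_pair_swap by simp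

lemma swap_measurable [measurable]: "(\<lambda>(x, y). (y, x)) \<in> measurable square_measure square_measure"
  by (rule measurable_pair_swap')

lemma AE_square_swap:
  assumes "AE p in square_measure. P p"
  shows "AE p in square_measure. P (prod.swap p)"
proof -
  have "AE p in distr square_measure square_measure (\<lambda>(x, y). (y, x)). P p"
    unfolding square_swap by (rule assms)
  from AE_distrD[OF swap_measurable this] show ?thesis by (simp add: case_prod_unfold prod.swap_def)
qed

lemma integral_square_swap:
  assumes "f \<in> borel_measurable square_measure"
  shows "(\<integral>p. f (prod.swap p) \<partial>square_measure) = (\<integral>p. f p \<partial>square_measure :: real)"
proof -
  have "(\<integral>p. f p \<partial>distr square_measure square_measure (\<lambda>(x, y). (y, x))) = (\<integral>p. f (case p of (x, y) \<Rightarrow> (y, x)) \<partial>square_measure)"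
    by (rule integral_distr[OF swap_measurable assms])
  then show ?thesis unfolding square_swap by (simp add: case_prod_unfold prod.swap_def)
qed

text \<open>The weak limits of the colours are densities that are finite and sum to 1 only almost
  everywhere; they are symmetrised and repaired on a null set to give a graphon. Weak limits suffice
  for cut norm convergence because the Cauchy bound is uniform over rectangles and passes to the
  limit on each of them.\<close>

lemma cut_norm_complete:
  assumes k: "k \<ge> 1" and V: "\<And>j. V j \<in> graphons k"
    and cauchy: "\<And>a \<epsilon>. a \<in> {1..k} \<Longrightarrow> \<epsilon> > 0 \<Longrightarrow> \<exists>N. \<forall>i\<ge>N. \<forall>j\<ge>N. cut_norm (\<lambda>p. V i a p - V j a p) < \<epsilon>"
  shows "\<exists>W\<in>graphons k. \<forall>a\<in>{1..k}. (\<lambda>j. cut_norm (\<lambda>p. V j a p - W a p)) \<longlonglongrightarrow> 0"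
proof -
  define Q where "Q a f \<longleftrightarrow> f \<in> borel_measurable square_measure \<and> (\<forall>E\<in>sets square_measure.
    \<exists>l. 0 \<le> l \<and> (\<lambda>j. \<integral>p. V j a p * indicat_real E p \<partial>square_measure) \<longlonglongrightarrow> l \<and>
      (\<integral>\<^sup>+p. f p * indicator E p \<partial>square_measure) = ennreal l)" for a f
  have "\<exists>f. Q a f" if a: "a \<in> {1..k}" for a
    using cut_norm_Cauchy_density[of "\<lambda>j. V j a", OF graphon_measurable[OF V a] graphon_range[OF V a] cauchy[OF a]]
    unfolding Q_def Bex_def .
  then have "\<forall>a\<in>{1..k}. \<exists>f. Q a f" by (rule ballI)
  from bchoice[OF this] obtain f where f0: "\<forall>a\<in>{1..k}. Q a (f a)" ..
  have fm: "f a \<in> borel_measurable square_measure" if "a \<in> {1..k}" for a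
    using bspec[OF f0 that] unfolding Q_def by (rule conjunct1)
  define L where "L a E = lim (\<lambda>j. \<integral>p. V j a p * indicat_real E p \<partial>square_measure)" for a E
  have L: "0 \<le> L a E" "(\<lambda>j. \<integral>p. V j a p * indicat_real E p \<partial>square_measure) \<longlonglongrightarrow> L a E"
      "(\<integral>\<^sup>+p. f a p * indicator E p \<partial>square_measure) = ennreal (L a E)"
    if aE: "a \<in> {1..k}" "E \<in> sets square_measure" for a E
  proof -
    obtain l where "0 \<le> l" "(\<lambda>j. \<integral>p. V j a p * indicat_real E p \<partial>square_measure) \<longlonglongrightarrow> l"
      "(\<integral>\<^sup>+p. f a p * indicator E p \<partial>square_measure) = ennreal l"
      using bspec[OF f0 aE(1), unfolded Q_def, THEN conjunct2, rule_format, OF aE(2)] by (elim exE conjE)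
    moreover from this(2) have "L a E = l" unfolding L_def by (rule limI)
    ultimately show "0 \<le> L a E" "(\<lambda>j. \<integral>p. V j a p * indicat_real E p \<partial>square_measure) \<longlonglongrightarrow> L a E"
      "(\<integral>\<^sup>+p. f a p * indicator E p \<partial>square_measure) = ennreal (L a E)" by simp_all
  qed
  have intV: "integrable square_measure (\<lambda>p. V j a p * indicat_real E p)" if "a \<in> {1..k}" "E \<in> sets square_measure" for j a E
    using graphon_measurable[OF V that(1)] graphon_range[OF V that(1)] that(2)
    by (intro bounded_integrable_mult(1)[where C = 1]) auto
  have sumV: "(\<Sum>a=1..k. V j a p) = 1" if pS: "p \<in> space square_measure" for j p
  proof -
    obtain x y where "p = (x, y)" "x \<in> {0..1}" "y \<in> {0..1}" using pS by (auto simp: space_pair_measure)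
    then show ?thesis using V[of j] unfolding graphons_def prob_simplex_def by auto
  qed
  have sumL: "(\<Sum>a=1..k. L a E) = measure square_measure E" if E: "E \<in> sets square_measure" for E
  proof -
    have "(\<Sum>a=1..k. \<integral>p. V j a p * indicat_real E p \<partial>square_measure) = measure square_measure E" for j
    proof -
      have "(\<Sum>a=1..k. \<integral>p. V j a p * indicat_real E p \<partial>square_measure) = (\<integral>p. (\<Sum>a=1..k. V j a p * indicat_real E p) \<partial>square_measure)"
        using intV E by (intro Bochner_Integration.integral_sum[symmetric]) auto
      also have "\<dots> = (\<integral>p. indicat_real E p \<partial>square_measure)"
        unfolding sum_distrib_right[symmetric] using sumV by (intro Bochner_Integration.integral_cong) auto
      finally show ?thesis using E by (simp add: sets.Int_space_eq2)
    qed
    moreover have "(\<lambda>j. \<Sum>a=1..k. \<integral>p. V j a p * indicat_real E p \<partial>square_measure) \<longlonglongrightarrow> (\<Sum>a=1..k. L a E)"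
      by (intro tendsto_sum L(2)[OF _ E])
    ultimately have "(\<lambda>j. measure square_measure E) \<longlonglongrightarrow> (\<Sum>a=1..k. L a E)" by simp
    then show ?thesis using LIMSEQ_unique tendsto_const by blast
  qed
  \<comment> \<open>Over every measurable set the sum of the densities integrates to the measure of
    the set, as does the constant 1, and densities are unique almost everywhere.\<close>
  have "AE p in square_measure. (\<Sum>a=1..k. f a p) = 1"
  proof (rule finite_measure.density_unique_finite_measure[OF SM.finite_measure_axioms])
    fix E assume E: "E \<in> sets square_measure"
    have "(\<integral>\<^sup>+p. (\<Sum>a=1..k. f a p) * indicator E p \<partial>square_measure) = (\<Sum>a=1..k. \<integral>\<^sup>+p. f a p * indicator E p \<partial>square_measure)"
      unfolding sum_distrib_right using fm E by (intro nn_integral_sum) auto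
    also have "\<dots> = (\<Sum>a=1..k. ennreal (L a E))" using L(3)[OF _ E] by (intro sum.cong) auto
    also have "\<dots> = ennreal (\<Sum>a=1..k. L a E)" using L(1)[OF _ E] by (intro sum_ennreal) auto
    also have "\<dots> = (\<integral>\<^sup>+p. 1 * indicator E p \<partial>square_measure)"
      unfolding sumL[OF E] using E by (simp add: SM.emeasure_eq_measure)
    finally show "(\<integral>\<^sup>+p. (\<Sum>a=1..k. f a p) * indicator E p \<partial>square_measure) = (\<integral>\<^sup>+p. 1 * indicator E p \<partial>square_measure)" .
  qed (use fm in auto)
  define w where "w a p = enn2real (f a p)" for a p
  have wm: "w a \<in> borel_measurable square_measure" if "a \<in> {1..k}" for a
    unfolding w_def using fm[OF that] by measurable
  define good where "good p \<longleftrightarrow> (\<Sum>a=1..k. w a p) = 1" for p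
  have AEg: "AE p in square_measure. (\<forall>a\<in>{1..k}. ennreal (w a p) = f a p) \<and> good p"
    using \<open>AE p in square_measure. (\<Sum>a=1..k. f a p) = 1\<close>
  proof eventually_elim
    case (elim p)
    have fin: "ennreal (w a p) = f a p" if a: "a \<in> {1..k}" for a
    proof -
      have "f a p \<le> (\<Sum>a=1..k. f a p)" using a by (intro member_le_sum) auto
      then have "f a p < top" using elim by (metis ennreal_one_less_top order_le_less_trans)
      then show ?thesis unfolding w_def by simp
    qed
    have "ennreal (\<Sum>a=1..k. w a p) = (\<Sum>a=1..k. ennreal (w a p))"
      by (intro sum_ennreal[symmetric]) (simp add: w_def)
    also have "\<dots> = 1" using elim fin by simp
    finally have "good p" unfolding good_def by (simp add: ennreal_eq_1)
    then show ?case using fin by blast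
  qed
  have wint: "integrable square_measure (\<lambda>p. w a p * indicat_real E p)"
    "(\<integral>p. w a p * indicat_real E p \<partial>square_measure) = L a E" if "a \<in> {1..k}" "E \<in> sets square_measure" for a E
  proof -
    have "(\<integral>\<^sup>+p. ennreal (w a p * indicat_real E p) \<partial>square_measure) = (\<integral>\<^sup>+p. f a p * indicator E p \<partial>square_measure)"
    proof (rule nn_integral_cong_AE)
      show "AE p in square_measure. ennreal (w a p * indicat_real E p) = f a p * indicator E p"
        using AEg by eventually_elim (use that(1) in \<open>auto simp: indicator_def\<close>)
    qed
    then have nn: "(\<integral>\<^sup>+p. ennreal (w a p * indicat_real E p) \<partial>square_measure) = ennreal (L a E)"
      using L(3)[OF that] by simp
    have m: "(\<lambda>p. w a p * indicat_real E p) \<in> borel_measurable square_measure"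
      using wm[OF that(1)] that(2) by measurable
    have nnn: "0 \<le> w a p * indicat_real E p" for p unfolding w_def by simp
    show "integrable square_measure (\<lambda>p. w a p * indicat_real E p)"
      by (rule integrableI_nonneg[OF m]) (use nnn nn in auto)
    show "(\<integral>p. w a p * indicat_real E p \<partial>square_measure) = L a E"
      by (subst integral_eq_nn_integral[OF m]) (use nnn nn L(1)[OF that] in auto)
  qed
  \<comment> \<open>Testing both p and its mirror image keeps the repaired set symmetric. Where both
    tests succeed, the mean of the two values is again a point of the simplex.\<close>
  define W where "W a p = (if good p \<and> good (prod.swap p) then (w a p + w a (prod.swap p)) / 2 else 1 / real k)" for a p
  have sw: "prod.swap \<in> measurable square_measure square_measure"
  proof -
    have "prod.swap = (\<lambda>(x :: real, y :: real). (y, x))" by (auto simp: fun_eq_iff)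
    then show ?thesis using swap_measurable by (simp only:)
  qed
  have ws: "(\<lambda>p. w a (prod.swap p)) \<in> borel_measurable square_measure" if "a \<in> {1..k}" for a
    using measurable_comp[OF sw wm[OF that]] by (simp add: comp_def)
  have gm: "Measurable.pred square_measure good"
    unfolding good_def using wm by measurable
  have gs: "Measurable.pred square_measure (\<lambda>p. good (prod.swap p))"
    using measurable_comp[OF sw gm] by (simp add: comp_def)
  have Wm: "W a \<in> borel_measurable square_measure" if "a \<in> {1..k}" for a
    unfolding W_def using wm[OF that] ws[OF that] gm gs by measurable
  have w0: "0 \<le> w a p" for a p by (simp add: w_def)
  have Wg: "W \<in> graphons k"
  proof -
    have sumW: "(\<Sum>a=1..k. W a p) = 1" for p
    proof (cases "good p \<and> good (prod.swap p)")
      case True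
      then show ?thesis unfolding W_def good_def
        by (simp add: sum_divide_distrib[symmetric] sum.distrib)
    qed (use k in \<open>auto simp: W_def\<close>)
    have W0: "0 \<le> W a p" for a p using w0 by (auto simp: W_def)
    have W1: "W a p \<le> 1" if "a \<in> {1..k}" for a p
      using member_le_sum[of a "{1..k}" "\<lambda>a. W a p"] sumW[of p] W0 that by auto
    have "W a (x, y) = W a (y, x)" for a x y unfolding W_def by (auto simp: add.commute)
    then show ?thesis unfolding graphons_def prob_simplex_def using Wm sumW W0 W1 by auto
  qed
  have WL: "(\<integral>p. W a p * indicat_real (S \<times> T) p \<partial>square_measure) = L a (S \<times> T)"
    if a: "a \<in> {1..k}" and S: "S \<in> sets unit_measure" and T: "T \<in> sets unit_measure" for a S T
  proof -
    have ST: "S \<times> T \<in> sets square_measure" "T \<times> S \<in> sets square_measure" using S T by auto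
    have isw: "indicat_real (S \<times> T) (prod.swap p) = indicat_real (T \<times> S) p" for S T :: "real set" and p
      by (cases p) (auto simp: indicator_def)
    \<comment> \<open>Each \<open>V j\<close> is symmetric, so the limits agree on mirrored
      rectangles, and symmetrisation leaves the integrals over rectangles unchanged.\<close>
    have Ls: "L a (T \<times> S) = L a (S \<times> T)"
    proof -
      have "(\<integral>p. V j a p * indicat_real (T \<times> S) p \<partial>square_measure) = (\<integral>p. V j a p * indicat_real (S \<times> T) p \<partial>square_measure)" for j
      proof -
        have "(\<integral>p. V j a p * indicat_real (S \<times> T) p \<partial>square_measure) =
            (\<integral>p. V j a (prod.swap p) * indicat_real (S \<times> T) (prod.swap p) \<partial>square_measure)"
          by (rule integral_square_swap[symmetric]) (use graphon_measurable[OF V a] ST in measurable)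
        also have "\<dots> = (\<integral>p. V j a p * indicat_real (T \<times> S) p \<partial>square_measure)"
          unfolding isw
        proof (rule Bochner_Integration.integral_cong[OF refl])
          fix p assume "p \<in> space square_measure"
          then obtain x y where "p = (x, y)" "x \<in> {0..1}" "y \<in> {0..1}" by (auto simp: space_pair_measure)
          then show "V j a (prod.swap p) * indicat_real (T \<times> S) p = V j a p * indicat_real (T \<times> S) p"
            using V[of j] a unfolding graphons_def by auto
        qed
        finally show ?thesis by simp
      qed
      then show ?thesis unfolding L_def by simp
    qed
    have "AE p in square_measure. W a p * indicat_real (S \<times> T) p =
       (w a p * indicat_real (S \<times> T) p + w a (prod.swap p) * indicat_real (S \<times> T) p) / 2"
      using AEg AE_square_swap[OF AEg] by eventually_elim (simp add: W_def field_simps)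
    then have "(\<integral>p. W a p * indicat_real (S \<times> T) p \<partial>square_measure) =
       (\<integral>p. (w a p * indicat_real (S \<times> T) p + w a (prod.swap p) * indicat_real (S \<times> T) p) / 2 \<partial>square_measure)"
      using Wm[OF a] wm[OF a] ws[OF a] ST
      by (intro integral_cong_AE borel_measurable_times borel_measurable_divide borel_measurable_add
          borel_measurable_indicator borel_measurable_const) auto
    also have "\<dots> = ((\<integral>p. w a p * indicat_real (S \<times> T) p \<partial>square_measure) +
        (\<integral>p. w a (prod.swap p) * indicat_real (S \<times> T) p \<partial>square_measure)) / 2"
    proof -
      have "integrable square_measure (\<lambda>p. w a (prod.swap p) * indicat_real (S \<times> T) p)"
      proof -
        have "integrable (distr square_measure square_measure (\<lambda>(x, y). (y, x))) (\<lambda>p. w a p * indicat_real (T \<times> S) p)"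
          unfolding square_swap by (rule wint(1)[OF a ST(2)])
        from integrable_distr[OF swap_measurable this] show ?thesis
          by (simp add: case_prod_unfold prod.swap_def[symmetric] isw)
      qed
      then show ?thesis using wint(1)[OF a ST(1)] by simp
    qed
    also have "(\<integral>p. w a (prod.swap p) * indicat_real (S \<times> T) p \<partial>square_measure) = (\<integral>p. w a p * indicat_real (T \<times> S) p \<partial>square_measure)"
      using integral_square_swap[of "\<lambda>p. w a p * indicat_real (T \<times> S) p"] wm[OF a] ST by (simp add: isw)
    finally show ?thesis using wint(2)[OF a ST(1)] wint(2)[OF a ST(2)] Ls by simp
  qed
  have "(\<lambda>j. cut_norm (\<lambda>p. V j a p - W a p)) \<longlonglongrightarrow> 0" if a: "a \<in> {1..k}" for a
  proof (rule LIMSEQ_I)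
    fix e :: real assume e: "e > 0"
    then obtain N where N: "\<forall>i\<ge>N. \<forall>j\<ge>N. cut_norm (\<lambda>p. V i a p - V j a p) < e / 2"
      using cauchy[OF a, of "e / 2"] by auto
    have "cut_norm (\<lambda>p. V j a p - W a p) \<le> e / 2" if j: "j \<ge> N" for j
    proof (rule cut_norm_least)
      fix S T assume S: "S \<in> sets unit_measure" "T \<in> sets unit_measure"
      have ST: "S \<times> T \<in> sets square_measure" using S by auto
      have set_int: "set_lebesgue_integral square_measure (S \<times> T) (\<lambda>p. V j a p - U a p) =
         (\<integral>p. V j a p * indicat_real (S \<times> T) p \<partial>square_measure) - (\<integral>p. U a p * indicat_real (S \<times> T) p \<partial>square_measure)"
        if U: "U \<in> graphons k" for U
      proof -
        have "integrable square_measure (\<lambda>p. U a p * indicat_real (S \<times> T) p)"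
          using bounded_kernel_set_integrable[OF graphon_bounded[OF U a] S] by (simp add: set_integrable_def mult.commute)
        then show ?thesis
          unfolding set_lebesgue_integral_def using intV[OF a ST, of j] by (simp add: right_diff_distrib mult.commute)
      qed
      have "(\<lambda>i. set_lebesgue_integral square_measure (S \<times> T) (\<lambda>p. V j a p - V i a p)) \<longlonglongrightarrow>
         (\<integral>p. V j a p * indicat_real (S \<times> T) p \<partial>square_measure) - L a (S \<times> T)"
        unfolding set_int[OF V] by (intro tendsto_diff tendsto_const L(2)[OF a ST])
      then have "(\<lambda>i. set_lebesgue_integral square_measure (S \<times> T) (\<lambda>p. V j a p - V i a p)) \<longlonglongrightarrow>
          set_lebesgue_integral square_measure (S \<times> T) (\<lambda>p. V j a p - W a p)"
        unfolding set_int[OF Wg] WL[OF a S] .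
      then have l: "(\<lambda>i. \<bar>set_lebesgue_integral square_measure (S \<times> T) (\<lambda>p. V j a p - V i a p)\<bar>) \<longlonglongrightarrow>
          \<bar>set_lebesgue_integral square_measure (S \<times> T) (\<lambda>p. V j a p - W a p)\<bar>" by (rule tendsto_rabs)
      \<comment> \<open>The Cauchy estimate does not depend on the rectangle, so letting i tend to
        infinity on a fixed rectangle gives a bound that survives the supremum.\<close>
      have "\<bar>set_lebesgue_integral square_measure (S \<times> T) (\<lambda>p. V j a p - V i a p)\<bar> \<le> e / 2" if "i \<ge> N" for i
      proof -
        have "cut_norm (\<lambda>p. V j a p - V i a p) < e / 2" using N j that by blast
        then show ?thesis
          using cut_norm_upper[OF bounded_kernel_diff[OF graphon_bounded[OF V a] graphon_bounded[OF V a]] S, of j i] by linarith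
      qed
      then show "\<bar>set_lebesgue_integral square_measure (S \<times> T) (\<lambda>p. V j a p - W a p)\<bar> \<le> e / 2"
        using l by (intro LIMSEQ_le_const2[OF l]) blast
    qed
    moreover have "0 \<le> cut_norm (\<lambda>p. V j a p - W a p)" for j
      by (intro cut_norm_nonneg bounded_kernel_diff graphon_bounded[OF V a] graphon_bounded[OF Wg a])
    ultimately show "\<exists>no. \<forall>n\<ge>no. norm (cut_norm (\<lambda>p. V n a p - W a p) - 0) < e"
      using e by (intro exI[of _ N]) (auto intro: le_less_trans[of _ "e / 2"])
  qed
  then show ?thesis using Wg by blast
qed

section \<open>From completeness in cut norm to completeness in cut distance\<close>

lemma cut_dist_less_obtain:
  assumes "cut_dist k U W < c"
  obtains \<phi> where "\<phi> \<in> mp_bijections" "vec_cut_norm k (\<lambda>a p. U a p - relabel \<phi> W a p) < c"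
proof (cases "\<exists>\<phi>\<in>mp_bijections. vec_cut_norm k (\<lambda>a p. U a p - relabel \<phi> W a p) < c")
  case True
  then show thesis using that by auto
next
  case False
  then have "c \<le> cut_dist k U W" by (intro cut_dist_greatest) (auto simp: not_less)
  then show thesis using assms by simp
qed

lemma cut_norm_le_vec_cut_norm:
  assumes "\<And>b. b \<in> {1..k} \<Longrightarrow> bounded_kernel (D b)" "a \<in> {1..k}"
  shows "cut_norm (D a) \<le> vec_cut_norm k D"
  unfolding vec_cut_norm_def using assms by (intro member_le_sum) (auto intro: cut_norm_nonneg)

lemma entropy_relabel:
  assumes W: "W \<in> graphons k" and \<phi>: "\<phi> \<in> mp_maps"
  shows "entropy k (relabel \<phi> W) = entropy k W"
proof -
  have "(\<integral>p. relabel \<phi> W a p * ln (relabel \<phi> W a p) \<partial>square_measure) = (\<integral>p. W a p * ln (W a p) \<partial>square_measure)"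
    if a: "a \<in> {1..k}" for a
  proof -
    have "(\<integral>p. W a p * ln (W a p) \<partial>distr square_measure square_measure (\<lambda>(x, y). (\<phi> x, \<phi> y))) =
        (\<integral>p. relabel \<phi> W a p * ln (relabel \<phi> W a p) \<partial>square_measure)"
      using integral_distr[OF measurable_square[OF \<phi>], of "\<lambda>p. W a p * ln (W a p)"] entropy_bounded_kernel[OF W a]
      by (simp add: bounded_kernel_def relabel_def case_prod_unfold)
    then show ?thesis unfolding distr_square[OF \<phi>] by simp
  qed
  then show ?thesis unfolding entropy_def by (intro sum.cong) auto
qed

text \<open>Bijections that nearly realise the consecutive distances are composed, so that the
  relabelled kernels \<open>V j\<close> are close in the cut norm itself, where completeness is
  available. Summability of the steps makes them Cauchy.\<close>

lemma cut_dist_fast_Cauchy_limit: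
  assumes k: "k \<ge> 1" and U: "\<And>j. U j \<in> graphons k"
    and fast: "\<And>j. cut_dist k (U j) (U (Suc j)) < (1/2) ^ j"
  shows "\<exists>W\<in>graphons k. (\<lambda>j. cut_dist k (U j) W) \<longlonglongrightarrow> 0"
proof -
  have "\<exists>\<phi>. \<phi> \<in> mp_bijections \<and> vec_cut_norm k (\<lambda>a p. U j a p - relabel \<phi> (U (Suc j)) a p) < (1/2) ^ j" for j
    using cut_dist_less_obtain[OF fast[of j]] by metis
  then have "\<forall>j. \<exists>\<phi>. \<phi> \<in> mp_bijections \<and> vec_cut_norm k (\<lambda>a p. U j a p - relabel \<phi> (U (Suc j)) a p) < (1/2) ^ j" ..
  from choice[OF this] obtain \<phi> where \<phi>0: "\<forall>j. \<phi> j \<in> mp_bijections \<and>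
      vec_cut_norm k (\<lambda>a p. U j a p - relabel (\<phi> j) (U (Suc j)) a p) < (1/2) ^ j" ..
  have \<phi>: "\<phi> j \<in> mp_bijections" "vec_cut_norm k (\<lambda>a p. U j a p - relabel (\<phi> j) (U (Suc j)) a p) < (1/2) ^ j" for j
    using \<phi>0 by simp_all
  \<comment> \<open>\<open>\<Phi> j\<close> is the composite of \<open>\<phi> 0\<close> up to
    \<open>\<phi> (j - 1)\<close>, with \<open>\<phi> 0\<close> applied innermost. Thus
    \<open>V j - V (Suc j)\<close> is the difference controlled by \<open>\<phi> j\<close>,
    evaluated along \<open>\<Phi> j\<close>.\<close>
  define \<Phi> where "\<Phi> = rec_nat id (\<lambda>j \<psi>. \<phi> j \<circ> \<psi>)"
  have \<Phi>0: "\<Phi> 0 = id" and \<Phi>S: "\<Phi> (Suc j) = \<phi> j \<circ> \<Phi> j" for j unfolding \<Phi>_def by simp_all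
  have \<Phi>: "\<Phi> j \<in> mp_bijections" for j
  proof (induction j)
    case 0
    show ?case unfolding \<Phi>0 by (rule mp_bijections_id)
  next
    case (Suc j)
    show ?case unfolding \<Phi>S by (rule mp_bijections_comp[OF \<phi>(1) Suc])
  qed
  then have \<Phi>m: "\<Phi> j \<in> mp_maps" for j unfolding mp_bijections_def by auto
  define V where "V j = relabel (\<Phi> j) (U j)" for j
  have V: "V j \<in> graphons k" for j unfolding V_def by (rule relabel_graphon[OF U \<Phi>m])
  have step: "cut_norm (\<lambda>p. V j a p - V (Suc j) a p) \<le> (1/2) ^ j" if a: "a \<in> {1..k}" for j a
  proof -
    let ?D = "\<lambda>a p. U j a p - relabel (\<phi> j) (U (Suc j)) a p"
    have bD: "bounded_kernel (?D b)" if "b \<in> {1..k}" for b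
      by (intro bounded_kernel_diff graphon_bounded[OF U that] relabel_bounded[OF U that \<phi>(1)])
    have "(\<lambda>p. V j a p - V (Suc j) a p) = (\<lambda>(x, y). ?D a (\<Phi> j x, \<Phi> j y))"
      unfolding V_def \<Phi>S by (auto simp: relabel_def fun_eq_iff)
    then have "cut_norm (\<lambda>p. V j a p - V (Suc j) a p) \<le> cut_norm (?D a)"
      using cut_norm_comp_le[OF bD[OF a] \<Phi>[of j]] by simp
    also have "\<dots> \<le> vec_cut_norm k ?D" using bD a by (rule cut_norm_le_vec_cut_norm)
    also have "\<dots> \<le> (1/2) ^ j" using \<phi>(2)[of j] by simp
    finally show ?thesis .
  qed
  \<comment> \<open>Keeping the exact value of the geometric sum, rather than its bound 2 (1/2)^i,
    lets the induction on \<open>d\<close> close.\<close>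
  have far: "cut_norm (\<lambda>p. V i a p - V (i + d) a p) \<le> 2 * (1/2) ^ i - 2 * (1/2) ^ (i + d)" if a: "a \<in> {1..k}" for i d a
  proof (induction d)
    case 0
    then show ?case by (simp add: cut_norm_zero)
  next
    case (Suc d)
    have "cut_norm (\<lambda>p. V i a p - V (i + Suc d) a p) \<le>
       cut_norm (\<lambda>p. V i a p - V (i + d) a p) + cut_norm (\<lambda>p. V (i + d) a p - V (i + Suc d) a p)"
      by (intro cut_norm_triangle_diff graphon_bounded[OF V a])
    also have "cut_norm (\<lambda>p. V (i + d) a p - V (i + Suc d) a p) \<le> (1/2) ^ (i + d)"
      using step[OF a, of "i + d"] by simp
    finally show ?case using Suc by simp
  qed
  have cauchy: "\<exists>N. \<forall>i\<ge>N. \<forall>j\<ge>N. cut_norm (\<lambda>p. V i a p - V j a p) < \<epsilon>" if a: "a \<in> {1..k}" and e: "\<epsilon> > 0" for a \<epsilon>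
  proof -
    obtain N where N: "(1/2 :: real) ^ N < \<epsilon> / 2" using real_arch_pow_inv[of "\<epsilon> / 2" "1/2"] e by auto
    have le: "cut_norm (\<lambda>p. V i a p - V j a p) < \<epsilon>" if "N \<le> i" "i \<le> j" for i j
    proof -
      have "cut_norm (\<lambda>p. V i a p - V j a p) \<le> 2 * (1/2) ^ i - 2 * (1/2) ^ j"
        using far[OF a, of i "j - i"] that by simp
      also have "\<dots> \<le> 2 * (1/2) ^ i" by simp
      also have "\<dots> \<le> 2 * (1/2) ^ N" using that by (simp add: power_decreasing)
      finally show ?thesis using N by simp
    qed
    have "cut_norm (\<lambda>p. V i a p - V j a p) < \<epsilon>" if "N \<le> i" "N \<le> j" for i j
      using le[of i j] le[of j i] that cut_norm_minus_commute[of "V i a" "V j a"] by (cases "i \<le> j") auto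
    then show ?thesis by blast
  qed
  obtain W where W: "W \<in> graphons k" and lim: "\<forall>a\<in>{1..k}. (\<lambda>j. cut_norm (\<lambda>p. V j a p - W a p)) \<longlonglongrightarrow> 0"
    using cut_norm_complete[OF k V cauchy] by blast
  have le: "cut_dist k (U j) W \<le> (\<Sum>a=1..k. cut_norm (\<lambda>p. V j a p - W a p))" for j
  proof -
    have "cut_dist k (U j) W \<le> cut_dist k (U j) (V j) + cut_dist k (V j) W"
      by (rule cut_dist_triangle[OF U V W])
    moreover have "cut_dist k (U j) (V j) = 0"
      using cut_dist_relabel[OF U \<Phi>, of j] cut_dist_sym[OF U V, of j j] unfolding V_def by simp
    ultimately show ?thesis using cut_dist_le_cut_norm[OF V W, of j] by simp
  qed
  have "(\<lambda>j. \<Sum>a=1..k. cut_norm (\<lambda>p. V j a p - W a p)) \<longlonglongrightarrow> 0"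
    by (intro tendsto_null_sum) (use lim in auto)
  then have "(\<lambda>j. cut_dist k (U j) W) \<longlonglongrightarrow> 0"
    by (rule tendsto_sandwich[OF _ _ tendsto_const, rotated 2])
      (rule always_eventually, rule allI, rule cut_dist_nonneg[OF U W], rule always_eventually, rule allI, rule le)
  then show ?thesis using W by blast
qed

lemma (in Metric_space) MCauchy_fast_subsequence:
  assumes "MCauchy \<sigma>"
  obtains r where "strict_mono r" "\<And>j::nat. d (\<sigma> (r j)) (\<sigma> (r (Suc j))) < (1/2) ^ j"
proof -
  have "\<exists>N. \<forall>n n'. N \<le> n \<longrightarrow> N \<le> n' \<longrightarrow> d (\<sigma> n) (\<sigma> n') < (1/2) ^ j" for j :: nat
    using assms unfolding MCauchy_def by simp
  then obtain N where N: "\<And>j n n'. N j \<le> n \<Longrightarrow> N j \<le> n' \<Longrightarrow> d (\<sigma> n) (\<sigma> n') < (1/2) ^ j" by metis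
  \<comment> \<open>The partial sum dominates each of its terms, and the added j makes the sequence
    strictly increasing even where some \<open>N i\<close> vanish.\<close>
  define r where "r j = (\<Sum>i\<le>j. N i) + j" for j :: nat
  have "strict_mono r" unfolding strict_mono_Suc_iff r_def by simp
  moreover have "N j \<le> r j" "N j \<le> r (Suc j)" for j
    using member_le_sum[of j "{..j}" N] unfolding r_def by simp_all
  ultimately show thesis using that N by blast
qed

text \<open>Aligning representatives handles a subsequence with summable steps, and a Cauchy
  sequence converges as soon as one of its subsequences does.\<close>

lemma graphon_space_complete:
  assumes k: "k \<ge> 1" and \<sigma>: "GS.MCauchy k \<sigma>"
  shows "\<exists>A. limitin (graphon_topology k) \<sigma> A sequentially"
proof -
  obtain r where r: "strict_mono r" "\<And>j::nat. class_dist k (\<sigma> (r j)) (\<sigma> (r (Suc j))) < (1/2) ^ j"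
    using GS.MCauchy_fast_subsequence[OF \<sigma>] by blast
  have \<sigma>M: "\<sigma> j \<in> graphon_space k" for j using \<sigma> unfolding GS.MCauchy_def by auto
  define U where "U j = representative (\<sigma> (r j))" for j
  have U: "U j \<in> graphons k" for j unfolding U_def using representative_in(2)[OF \<sigma>M] .
  have "cut_dist k (U j) (U (Suc j)) < (1/2) ^ j" for j
    using r(2)[of j] \<sigma>M unfolding class_dist_def U_def by simp
  from cut_dist_fast_Cauchy_limit[of k U, OF k U this]
  obtain W where W: "W \<in> graphons k" "(\<lambda>j. cut_dist k (U j) W) \<longlonglongrightarrow> 0" by blast
  have eq: "class_dist k (\<sigma> (r j)) (graphon_class k W) = cut_dist k (U j) W" for j
    using class_dist_class[OF U W(1), of j] representative_in(3)[OF \<sigma>M] unfolding U_def by simp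
  have "limitin (GS.mtopology k) (\<sigma> \<circ> r) (graphon_class k W) sequentially"
    unfolding GS.limit_metric_sequentially
  proof (intro conjI allI impI)
    show "graphon_class k W \<in> graphon_space k" by (rule graphon_class_in[OF W(1)])
    fix e :: real assume "e > 0"
    then obtain N where "\<forall>n\<ge>N. norm (cut_dist k (U n) W - 0) < e" using LIMSEQ_D[OF W(2)] by blast
    then show "\<exists>N. \<forall>n\<ge>N. (\<sigma> \<circ> r) n \<in> graphon_space k \<and> class_dist k ((\<sigma> \<circ> r) n) (graphon_class k W) < e"
      using \<sigma>M eq by (intro exI[of _ N]) auto
  qed
  from GS.MCauchy_convergent_subsequence[OF \<sigma> r(1) this]
  show ?thesis unfolding graphon_topology_def by blast
qed

text \<open>Compactness replaces uniform continuity of \<open>T\<close>: a subsequence of the empirical graphons converges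
  to a class at which \<open>T\<close> is continuous.\<close>

lemma empirical_limit_point:
  assumes k: "k \<ge> 1" and T: "continuous_map (graphon_topology k) euclideanreal T"
    and n: "\<And>m. n m \<ge> 1" and X: "\<And>m. X m \<in> colorings k (n m)"
    and V: "\<And>m. V m \<in> graphons k"
    and close: "\<And>m a. a \<in> {1..k} \<Longrightarrow> cut_norm (\<lambda>p. empirical_graphon k (n m) (X m) a p - V m a p) \<le> \<eta> m"
    and \<eta>: "\<eta> \<longlonglongrightarrow> 0"
    and b: "\<And>m. b \<le> T (graphon_class k (empirical_graphon k (n m) (X m))) - 1 / 2 * entropy k (V m) + \<eta> m"
  shows "\<exists>A\<in>graphon_space k. b \<le> T A - 1 / 2 * class_entropy k A"
proof -
  define E where "E m = empirical_graphon k (n m) (X m)" for m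
  have E: "E m \<in> graphons k" for m unfolding E_def by (rule empirical_graphon_in[OF k X])
  define \<sigma> where "\<sigma> m = graphon_class k (E m)" for m
  have "range \<sigma> \<subseteq> {graphon_class k (empirical_graphon k n X) | n X. n \<ge> 1 \<and> X \<in> colorings k n}"
    unfolding \<sigma>_def E_def using n X by auto
  then obtain r where r: "strict_mono r" "GS.MCauchy k (\<sigma> \<circ> r)"
    using empirical_totally_bounded[OF k] unfolding GS.mtotally_bounded_sequentially by meson
  obtain A where A: "limitin (graphon_topology k) (\<sigma> \<circ> r) A sequentially"
    using graphon_space_complete[OF k r(2)] by blast
  have AM: "A \<in> graphon_space k"
    using A unfolding graphon_topology_def GS.limit_metric_sequentially by blast
  define W where "W = representative A"
  have W: "W \<in> graphons k" "graphon_class k W = A" unfolding W_def using representative_in[OF AM] by auto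
  have dW: "(\<lambda>m. cut_dist k W (E (r m))) \<longlonglongrightarrow> 0"
  proof (rule LIMSEQ_I)
    fix e :: real assume "e > 0"
    then obtain N where N: "\<forall>m\<ge>N. class_dist k ((\<sigma> \<circ> r) m) A < e"
      using A unfolding graphon_topology_def GS.limit_metric_sequentially by blast
    have "class_dist k ((\<sigma> \<circ> r) m) A = cut_dist k W (E (r m))" for m
      using class_dist_class[OF E W(1), of "r m"] cut_dist_sym[OF E W(1), of "r m"] W(2) by (simp add: \<sigma>_def)
    then show "\<exists>N. \<forall>m\<ge>N. norm (cut_dist k W (E (r m)) - 0) < e"
      using N cut_dist_nonneg[OF W(1) E] by (intro exI[of _ N]) simp
  qed
  have \<eta>r: "(\<lambda>m. \<eta> (r m)) \<longlonglongrightarrow> 0" using LIMSEQ_subseq_LIMSEQ[OF \<eta> r(1)] by (simp add: comp_def)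
  have dV: "cut_dist k W (V (r m)) \<le> cut_dist k W (E (r m)) + real k * \<eta> (r m)" for m
  proof -
    have "cut_dist k (E (r m)) (V (r m)) \<le> (\<Sum>a=1..k. cut_norm (\<lambda>p. E (r m) a p - V (r m) a p))"
      by (rule cut_dist_le_cut_norm[OF E V])
    also have "\<dots> \<le> (\<Sum>a=1..k. \<eta> (r m))" unfolding E_def by (intro sum_mono close)
    finally show ?thesis using cut_dist_triangle[OF W(1) E V, of "r m" "r m"] by simp
  qed
  \<comment> \<open>The summand 1/(m+1) makes the inequality strict, so that an actual bijection can
    be chosen even when the infimum in the cut distance is not attained.\<close>
  define \<epsilon> where "\<epsilon> m = cut_dist k W (E (r m)) + real k * \<eta> (r m) + 1 / real (Suc m)" for m
  have \<epsilon>: "\<epsilon> \<longlonglongrightarrow> 0"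
  proof -
    have "\<epsilon> \<longlonglongrightarrow> 0 + real k * 0 + 0"
      unfolding \<epsilon>_def by (intro tendsto_add tendsto_mult tendsto_const dW \<eta>r LIMSEQ_inverse_real_of_nat[unfolded inverse_eq_divide])
    then show ?thesis by simp
  qed
  have "\<exists>\<phi>. \<phi> \<in> mp_bijections \<and> vec_cut_norm k (\<lambda>a p. W a p - relabel \<phi> (V (r m)) a p) < \<epsilon> m" for m
  proof -
    have "cut_dist k W (V (r m)) < \<epsilon> m" using dV[of m] unfolding \<epsilon>_def by (simp add: add_strict_increasing2 order_le_less_trans)
    from cut_dist_less_obtain[OF this] show ?thesis by metis
  qed
  then have "\<forall>m. \<exists>\<phi>. \<phi> \<in> mp_bijections \<and> vec_cut_norm k (\<lambda>a p. W a p - relabel \<phi> (V (r m)) a p) < \<epsilon> m" ..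
  from choice[OF this] obtain \<phi> where \<phi>0: "\<forall>m. \<phi> m \<in> mp_bijections \<and> vec_cut_norm k (\<lambda>a p. W a p - relabel (\<phi> m) (V (r m)) a p) < \<epsilon> m" ..
  then have \<phi>: "\<phi> m \<in> mp_bijections" "vec_cut_norm k (\<lambda>a p. W a p - relabel (\<phi> m) (V (r m)) a p) < \<epsilon> m" for m by simp_all
  then have \<phi>m: "\<phi> m \<in> mp_maps" for m unfolding mp_bijections_def by auto
  \<comment> \<open>Relabelling turns convergence in cut distance into convergence in cut norm, as
    semicontinuity requires, and leaves the entropy unchanged.\<close>
  define V' where "V' m = relabel (\<phi> m) (V (r m))" for m
  have V': "V' m \<in> graphons k" for m unfolding V'_def by (rule relabel_graphon[OF V \<phi>m])
  define c where "c m = 2 * (T (\<sigma> (r m)) + \<eta> (r m) - b)" for m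
  have "entropy k W \<le> 2 * (T A + 0 - b)"
  proof (rule entropy_lower_semicontinuous[where V = V' and c = c])
    show "V' j \<in> graphons k" for j by (rule V')
    show "entropy k (V' j) \<le> c j" for j
      using b[of "r j"] unfolding V'_def entropy_relabel[OF V \<phi>m] c_def \<sigma>_def E_def by simp
    have "(\<lambda>m. T (\<sigma> (r m))) \<longlonglongrightarrow> T A"
      using continuous_map_limit[OF T A] by (simp add: comp_def)
    then show "c \<longlonglongrightarrow> 2 * (T A + 0 - b)" unfolding c_def by (intro tendsto_intros \<eta>r)
    fix a assume a: "a \<in> {1..k}"
    have "cut_norm (\<lambda>p. V' j a p - W a p) \<le> \<epsilon> j" for j
    proof -
      have "cut_norm (\<lambda>p. W a p - V' j a p) \<le> vec_cut_norm k (\<lambda>a p. W a p - V' j a p)"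
        using a by (intro cut_norm_le_vec_cut_norm[where D = "\<lambda>a p. W a p - V' j a p"] bounded_kernel_diff graphon_bounded[OF W(1)] graphon_bounded[OF V'])
      then show ?thesis using \<phi>(2)[of j] cut_norm_minus_commute[of "W a" "V' j a"] unfolding V'_def by simp
    qed
    moreover have "0 \<le> cut_norm (\<lambda>p. V' j a p - W a p)" for j
      by (intro cut_norm_nonneg bounded_kernel_diff graphon_bounded[OF W(1) a] graphon_bounded[OF V' a])
    ultimately show "(\<lambda>j. cut_norm (\<lambda>p. V' j a p - W a p)) \<longlonglongrightarrow> 0"
      by (intro tendsto_sandwich[OF _ _ tendsto_const \<epsilon>]) simp_all
  qed (rule W(1))
  then have "b \<le> T A - 1 / 2 * class_entropy k A" unfolding class_entropy_def W_def by simp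
  then show ?thesis using AM by blast
qed

section \<open>Counting colourings: the upper bound\<close>

text \<open>The relative entropy of \<open>P\<close> with respect to the Gibbs weights
  \<open>exp (f x) / Z\<close> is nonnegative; termwise this is ln y \<le> y - 1. Points of weight 0
  contribute nothing to the left-hand side.\<close>

lemma Gibbs_variational_le:
  fixes P f :: "'a \<Rightarrow> real"
  assumes S: "finite S" and P: "\<And>x. x \<in> S \<Longrightarrow> 0 \<le> P x" "(\<Sum>x\<in>S. P x) = 1"
  shows "(\<Sum>x\<in>S. P x * f x) - (\<Sum>x\<in>S. P x * ln (P x)) \<le> ln (\<Sum>x\<in>S. exp (f x))"
proof -
  define Z where "Z = (\<Sum>x\<in>S. exp (f x))"
  have "S \<noteq> {}" using P(2) by auto
  then have Z: "Z > 0" unfolding Z_def using S by (intro sum_pos) auto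
  have "P x * f x - P x * ln (P x) - P x * ln Z \<le> exp (f x) / Z - P x" if x: "x \<in> S" for x
  proof (cases "P x = 0")
    case False
    then have Px: "P x > 0" using P(1)[OF x] by simp
    have "ln (exp (f x) / (P x * Z)) \<le> exp (f x) / (P x * Z) - 1"
      using Px Z by (intro ln_le_minus_one) simp
    moreover have "ln (exp (f x) / (P x * Z)) = f x - ln (P x) - ln Z"
      using Px Z by (simp add: ln_div ln_mult)
    ultimately have "P x * (f x - ln (P x) - ln Z) \<le> P x * (exp (f x) / (P x * Z) - 1)"
      using Px by (intro mult_left_mono) auto
    also have "\<dots> = exp (f x) / Z - P x" using Px Z by (simp add: field_simps)
    finally show ?thesis by (simp add: right_diff_distrib)
  qed (use Z in simp)
  then have "(\<Sum>x\<in>S. P x * f x - P x * ln (P x) - P x * ln Z) \<le> (\<Sum>x\<in>S. exp (f x) / Z - P x)"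
    by (rule sum_mono)
  also have "\<dots> = 0" using Z P(2) by (simp add: sum_subtractf sum_divide_distrib[symmetric] Z_def[symmetric])
  finally have "(\<Sum>x\<in>S. P x * f x) - (\<Sum>x\<in>S. P x * ln (P x)) - (\<Sum>x\<in>S. P x) * ln Z \<le> 0"
    by (simp add: sum_subtractf sum_distrib_right)
  then show ?thesis using P(2) Z_def by simp
qed

text \<open>Compare the uniform distribution on \<open>B\<close> with the product of its marginals.\<close>

lemma ln_card_le_sum_marginal_entropies:
  fixes B :: "('e \<Rightarrow> 'c) set"
  assumes E: "finite E" and C: "finite C" and B: "B \<subseteq> E \<rightarrow>\<^sub>E C" "B \<noteq> {}"
  defines "p \<equiv> \<lambda>e a. real (card {X \<in> B. X e = a}) / real (card B)"
  shows "ln (real (card B)) \<le> - (\<Sum>e\<in>E. \<Sum>a\<in>C. p e a * ln (p e a))"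
proof -
  have fB: "finite B" using finite_subset[OF B(1) finite_PiE[OF E]] C by blast
  define N where "N = real (card B)"
  have N: "N > 0" unfolding N_def using fB B(2) by (simp add: card_gt_0_iff)
  have group: "(\<Sum>X\<in>B. g (X e)) = N * (\<Sum>a\<in>C. p e a * g a)" if e: "e \<in> E" for e and g :: "'c \<Rightarrow> real"
  proof -
    have "(\<Sum>X\<in>B. g (X e)) = (\<Sum>a\<in>C. \<Sum>X\<in>{X \<in> B. X e = a}. g (X e))"
      using fB C B(1) e by (intro sum.group[symmetric]) auto
    also have "\<dots> = (\<Sum>a\<in>C. N * (p e a * g a))"
      using N by (intro sum.cong refl) (simp add: p_def N_def)
    finally show ?thesis by (simp add: sum_distrib_left)
  qed
  have p0: "0 \<le> p e a" for e a unfolding p_def by simp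
  have psum: "(\<Sum>a\<in>C. p e a) = 1" if "e \<in> E" for e
    using group[OF that, of "\<lambda>_. 1"] N by (simp add: N_def)
  \<comment> \<open>A colour taken by some member of \<open>B\<close> has positive frequency in
    \<open>B\<close>, so the logarithms below are taken of positive numbers.\<close>
  have ppos: "p e (X e) > 0" if "X \<in> B" for X e
  proof -
    have "X \<in> {Y \<in> B. Y e = X e}" using that by simp
    then have "card {Y \<in> B. Y e = X e} > 0" using fB by (subst card_gt_0_iff) auto
    then show ?thesis unfolding p_def using N by (simp add: N_def)
  qed
  define Q where "Q X = (\<Prod>e\<in>E. p e (X e))" for X
  have Q: "Q X > 0" if "X \<in> B" for X unfolding Q_def using ppos[OF that] by (intro prod_pos) auto
  have "(\<Sum>X\<in>B. Q X) \<le> (\<Sum>X\<in>E \<rightarrow>\<^sub>E C. Q X)"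
    using B(1) E C p0 unfolding Q_def by (intro sum_mono2 finite_PiE prod_nonneg) auto
  also have "\<dots> = (\<Prod>e\<in>E. \<Sum>a\<in>C. p e a)" unfolding Q_def using E C by (intro prod_sum_PiE[symmetric]) auto
  also have "\<dots> = 1" using psum by simp
  finally have Q1: "(\<Sum>X\<in>B. Q X) \<le> 1" .
  \<comment> \<open>Gibbs' inequality for the uniform weights 1/N and the exponent
    \<open>ln (Q X)\<close>. Its right-hand side is the logarithm of the mass that the product of
    the marginals puts on \<open>B\<close>, hence at most 0.\<close>
  have "(\<Sum>X\<in>B. 1 / N * ln (Q X)) - (\<Sum>X\<in>B. 1 / N * ln (1 / N)) \<le> ln (\<Sum>X\<in>B. exp (ln (Q X)))"
    using fB N by (intro Gibbs_variational_le) (auto simp: N_def)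
  also have "\<dots> = ln (\<Sum>X\<in>B. Q X)" using Q by simp
  also have "\<dots> \<le> 0" using Q1 Q fB B(2) by (simp add: sum_pos)
  finally have "ln N \<le> - (1 / N * (\<Sum>X\<in>B. ln (Q X)))"
    using N by (simp add: ln_div sum_distrib_left[symmetric] N_def sum_divide_distrib[symmetric])
  also have "(\<Sum>X\<in>B. ln (Q X)) = (\<Sum>X\<in>B. \<Sum>e\<in>E. ln (p e (X e)))"
  proof (rule sum.cong[OF refl])
    fix X assume "X \<in> B"
    then have "p e (X e) \<noteq> 0" for e using ppos[of X e] by simp
    then show "ln (Q X) = (\<Sum>e\<in>E. ln (p e (X e)))" unfolding Q_def using E by (intro ln_prod) auto
  qed
  also have "\<dots> = (\<Sum>e\<in>E. \<Sum>X\<in>B. ln (p e (X e)))" by (rule sum.swap)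
  also have "\<dots> = (\<Sum>e\<in>E. N * (\<Sum>a\<in>C. p e a * ln (p e a)))"
    by (intro sum.cong refl group)
  finally show ?thesis using N by (simp add: sum_distrib_left[symmetric] N_def)
qed

section \<open>Edges, ordered pairs and average graphons\<close>

lemma finite_complete_edges [simp]: "finite (complete_edges n)"
  unfolding complete_edges_def by (rule finite_subset[of _ "Pow {1..n}"]) auto

lemma finite_colorings [simp]: "finite (colorings k n)"
  unfolding colorings_def by (intro finite_PiE) auto

lemma colorings_nonempty: "k \<ge> 1 \<Longrightarrow> colorings k n \<noteq> {}"
  unfolding colorings_def by (auto simp: PiE_eq_empty_iff)

lemma edge_in: "u \<in> {1..n} \<Longrightarrow> v \<in> {1..n} \<Longrightarrow> u \<noteq> v \<Longrightarrow> {u, v} \<in> complete_edges n"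
  unfolding complete_edges_def by auto

lemma complete_edges_Min_Max:
  assumes "e \<in> complete_edges n"
  shows "Min e \<in> {1..n}" "Max e \<in> {1..n}" "Min e < Max e" "e = {Min e, Max e}"
proof -
  obtain a b where e: "e = {a, b}" "a \<noteq> b" "a \<in> {1..n}" "b \<in> {1..n}"
    using assms unfolding complete_edges_def by (auto simp: card_2_iff)
  then show "Min e \<in> {1..n}" "Max e \<in> {1..n}" "Min e < Max e" "e = {Min e, Max e}"
    by (auto simp: min_def max_def)
qed

text \<open>Ordered pairs off the diagonal are grouped by their edge, with \<open>Min\<close> and
  \<open>Max\<close> distinguishing the two orientations. This double count is the source of the
  factor 1/2 in front of the entropy.\<close>

lemma sum_ordered_pairs:
  fixes f :: "nat \<Rightarrow> nat \<Rightarrow> real"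
  shows "(\<Sum>u=1..n. \<Sum>v=1..n. if u \<noteq> v then f u v else 0) =
    (\<Sum>e\<in>complete_edges n. f (Min e) (Max e) + f (Max e) (Min e))"
proof -
  let ?D = "{(u, v) \<in> {1..n} \<times> {1..n}. u \<noteq> v}"
  have "(\<Sum>u=1..n. \<Sum>v=1..n. if u \<noteq> v then f u v else 0) = (\<Sum>(u, v)\<in>{1..n} \<times> {1..n}. if u \<noteq> v then f u v else 0)"
    by (rule sum.cartesian_product)
  also have "\<dots> = (\<Sum>z\<in>?D. case z of (u, v) \<Rightarrow> f u v)"
    by (intro sum.mono_neutral_cong_right) (auto split: if_splits)
  also have "\<dots> = (\<Sum>e\<in>complete_edges n. \<Sum>z\<in>{z \<in> ?D. (case z of (u, v) \<Rightarrow> {u, v}) = e}. case z of (u, v) \<Rightarrow> f u v)"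
  proof (rule sum.group[symmetric])
    show "finite ?D" by (rule finite_subset[of _ "{1..n} \<times> {1..n}"]) auto
    show "(\<lambda>z. case z of (u, v) \<Rightarrow> {u, v}) ` ?D \<subseteq> complete_edges n" using edge_in by auto
  qed simp
  also have "\<dots> = (\<Sum>e\<in>complete_edges n. f (Min e) (Max e) + f (Max e) (Min e))"
  proof (rule sum.cong[OF refl])
    fix e assume "e \<in> complete_edges n"
    note e = complete_edges_Min_Max[OF this]
    have "{z \<in> ?D. (case z of (u, v) \<Rightarrow> {u, v}) = {Min e, Max e}} = {(Min e, Max e), (Max e, Min e)}"
      using e(1-3) by (auto simp: doubleton_eq_iff)
    then have "{z \<in> ?D. (case z of (u, v) \<Rightarrow> {u, v}) = e} = {(Min e, Max e), (Max e, Min e)}"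
      using e(4) by simp
    then show "(\<Sum>z\<in>{z \<in> ?D. (case z of (u, v) \<Rightarrow> {u, v}) = e}. case z of (u, v) \<Rightarrow> f u v) = f (Min e) (Max e) + f (Max e) (Min e)"
      using e(3) by simp
  qed
  finally show ?thesis .
qed

lemma sum_ordered_pairs_edges:
  fixes f :: "nat set \<Rightarrow> real"
  shows "(\<Sum>u=1..n. \<Sum>v=1..n. if u \<noteq> v then f {u, v} else 0) = 2 * (\<Sum>e\<in>complete_edges n. f e)"
proof -
  have "f {Min e, Max e} + f {Max e, Min e} = 2 * f e" if "e \<in> complete_edges n" for e
    using complete_edges_Min_Max(4)[OF that] by (simp add: insert_commute)
  then show ?thesis
    unfolding sum_ordered_pairs[of "\<lambda>u v. f {u, v}"] sum_distrib_left by (intro sum.cong refl) simp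
qed

text \<open>Its off-diagonal blocks carry the colour frequencies of \<open>B\<close> at each edge,
  which are the marginals of the uniform distribution on \<open>B\<close>; this ties its entropy to
  the size of \<open>B\<close>.\<close>

definition average_graphon :: "nat \<Rightarrow> nat \<Rightarrow> (nat set \<Rightarrow> nat) set \<Rightarrow> kernel" where
  "average_graphon k n B a p = (\<Sum>X\<in>B. empirical_graphon k n X a p) / real (card B)"

lemma average_graphon_in:
  assumes k: "k \<ge> 1" and B: "B \<subseteq> colorings k n" "B \<noteq> {}"
  shows "average_graphon k n B \<in> graphons k"
proof -
  have fB: "finite B" using B(1) finite_subset finite_colorings by blast
  have N: "real (card B) > 0" using fB B(2) by (simp add: card_gt_0_iff)
  have X: "X \<in> B \<Longrightarrow> empirical_graphon k n X \<in> graphons k" for X using empirical_graphon_in[OF k] B(1) by blast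
  have sym: "average_graphon k n B a (x, y) = average_graphon k n B a (y, x)"
    if "x \<in> {0..1}" "y \<in> {0..1}" "a \<in> {1..k}" for x y a
  proof -
    have "empirical_graphon k n X a (x, y) = empirical_graphon k n X a (y, x)" if "X \<in> B" for X
      using X[OF that] \<open>x \<in> _\<close> \<open>y \<in> _\<close> \<open>a \<in> _\<close> unfolding graphons_def by blast
    then show ?thesis unfolding average_graphon_def by (intro arg_cong[of _ _ "\<lambda>s. s / _"] sum.cong) auto
  qed
  have rng: "0 \<le> empirical_graphon k n X a p" "empirical_graphon k n X a p \<le> 1" if "X \<in> B" "a \<in> {1..k}" "p \<in> {0..1} \<times> {0..1}" for X a p
    using graphon_range[OF X[OF that(1)] that(2)] that(3) by (auto simp: space_pair_measure)
  have le1: "average_graphon k n B a p \<le> 1" if "a \<in> {1..k}" "p \<in> {0..1} \<times> {0..1}" for a p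
  proof -
    have "(\<Sum>X\<in>B. empirical_graphon k n X a p) \<le> (\<Sum>X\<in>B. 1)" using rng that by (intro sum_mono) auto
    then show ?thesis using N by (simp add: average_graphon_def)
  qed
  have ge0: "0 \<le> average_graphon k n B a p" if "a \<in> {1..k}" "p \<in> {0..1} \<times> {0..1}" for a p
    unfolding average_graphon_def using rng that by (intro divide_nonneg_nonneg sum_nonneg) auto
  have sum1: "(\<Sum>a=1..k. average_graphon k n B a (x, y)) = 1" if "x \<in> {0..1}" "y \<in> {0..1}" for x y
  proof -
    have "(\<Sum>a=1..k. empirical_graphon k n X a (x, y)) = 1" if "X \<in> B" for X
      using X[OF that] \<open>x \<in> _\<close> \<open>y \<in> _\<close> unfolding graphons_def prob_simplex_def by auto
    then have "(\<Sum>X\<in>B. \<Sum>a=1..k. empirical_graphon k n X a (x, y)) = real (card B)" by simp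
    then show ?thesis unfolding average_graphon_def sum_divide_distrib[symmetric]
      by (subst sum.swap) (use N in simp)
  qed
  have "average_graphon k n B a \<in> borel_measurable square_measure" for a
    unfolding average_graphon_def by measurable
  then show ?thesis
    unfolding graphons_def prob_simplex_def using sym le1 ge0 sum1 by auto
qed

text \<open>Balls of the cut norm are convex: on each rectangle the integral for the average is the
  mean of the integrals for the members of \<open>B\<close>.\<close>

lemma cut_norm_average_le:
  assumes k: "k \<ge> 1" and B: "B \<subseteq> colorings k n" "B \<noteq> {}" and a: "a \<in> {1..k}"
    and F: "bounded_kernel F"
    and c: "\<And>Y. Y \<in> B \<Longrightarrow> cut_norm (\<lambda>p. F p - empirical_graphon k n Y a p) \<le> c"
  shows "cut_norm (\<lambda>p. F p - average_graphon k n B a p) \<le> c"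
proof (rule cut_norm_least)
  fix S T assume S: "S \<in> sets unit_measure" "T \<in> sets unit_measure"
  have fB: "finite B" using B(1) finite_subset finite_colorings by blast
  have N: "real (card B) > 0" using fB B(2) by (simp add: card_gt_0_iff)
  let ?I = "\<lambda>D. set_lebesgue_integral square_measure (S \<times> T) D"
  have i: "set_integrable square_measure (S \<times> T) (\<lambda>p. F p - empirical_graphon k n Y a p)" for Y
    by (intro bounded_kernel_set_integrable bounded_kernel_diff F empirical_graphon_bounded S)
  have "F p - average_graphon k n B a p = (\<Sum>Y\<in>B. F p - empirical_graphon k n Y a p) / real (card B)" for p
    unfolding average_graphon_def using N by (simp add: sum_subtractf diff_divide_distrib)
  then have "?I (\<lambda>p. F p - average_graphon k n B a p) = ?I (\<lambda>p. (\<Sum>Y\<in>B. F p - empirical_graphon k n Y a p) / real (card B))"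
    by simp
  also have "\<dots> = (\<Sum>Y\<in>B. ?I (\<lambda>p. F p - empirical_graphon k n Y a p)) / real (card B)"
    using i unfolding set_lebesgue_integral_def set_integrable_def
    by (simp add: sum_distrib_left Bochner_Integration.integral_sum)
  finally have "\<bar>?I (\<lambda>p. F p - average_graphon k n B a p)\<bar> = \<bar>\<Sum>Y\<in>B. ?I (\<lambda>p. F p - empirical_graphon k n Y a p)\<bar> / real (card B)"
    using N by simp
  also have "\<dots> \<le> (\<Sum>Y\<in>B. c) / real (card B)"
  proof (intro divide_right_mono order_trans[OF sum_abs] sum_mono)
    fix Y assume "Y \<in> B"
    then show "\<bar>?I (\<lambda>p. F p - empirical_graphon k n Y a p)\<bar> \<le> c"
      using cut_norm_upper[OF bounded_kernel_diff[OF F empirical_graphon_bounded] S, of k n Y a] c by force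
  qed (use N in simp)
  also have "\<dots> = c" using N by simp
  finally show "\<bar>?I (\<lambda>p. F p - average_graphon k n B a p)\<bar> \<le> c" .
qed

lemma integral_step_xlnx:
  assumes n: "n \<ge> 1" and g: "g \<in> borel_measurable square_measure"
    and AE: "AE p in square_measure. g p = step_kernel n m p"
  shows "(\<integral>p. g p * ln (g p) \<partial>square_measure) = (\<Sum>u=1..n. \<Sum>v=1..n. m u v * ln (m u v)) / (real n)\<^sup>2"
proof -
  have "(\<integral>p. g p * ln (g p) \<partial>square_measure) = (\<integral>p. step_kernel n (\<lambda>u v. m u v * ln (m u v)) p \<partial>square_measure)"
  proof (rule integral_cong_AE)
    show "AE p in square_measure. g p * ln (g p) = step_kernel n (\<lambda>u v. m u v * ln (m u v)) p"
      using AE by eventually_elim (auto simp: step_kernel_def split: prod.splits)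
  qed (use g in measurable)
  then show ?thesis using integral_step_kernel[OF n] by simp
qed

text \<open>Subadditivity bounds \<open>ln (real (card B))\<close> by the edge entropies, and every
  edge accounts for two blocks of the average graphon. The diagonal blocks add nonpositive terms to
  its entropy functional, which only enlarges the bound.\<close>

lemma ln_card_le_entropy_average:
  assumes k: "k \<ge> 1" and n: "n \<ge> 1" and B: "B \<subseteq> colorings k n" "B \<noteq> {}"
  shows "ln (real (card B)) \<le> - (1 / 2) * (real n)\<^sup>2 * entropy k (average_graphon k n B)"
proof -
  have fB: "finite B" using B(1) finite_subset finite_colorings by blast
  have N: "real (card B) > 0" using fB B(2) by (simp add: card_gt_0_iff)
  define p where "p e a = real (card {X \<in> B. X e = a}) / real (card B)" for e a
  define m where "m a u v = (if u \<noteq> v then p {u, v} a else 1 / real k)" for a u v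
  have ln: "ln (real (card B)) \<le> - (\<Sum>e\<in>complete_edges n. \<Sum>a=1..k. p e a * ln (p e a))"
    unfolding p_def using B by (intro ln_card_le_sum_marginal_entropies) (auto simp: colorings_def)
  have "(\<integral>p. average_graphon k n B a p * ln (average_graphon k n B a p) \<partial>square_measure) =
      (\<Sum>u=1..n. \<Sum>v=1..n. m a u v * ln (m a u v)) / (real n)\<^sup>2" if a: "a \<in> {1..k}" for a
  proof (rule integral_step_xlnx[OF n graphon_measurable[OF average_graphon_in[OF k B] a]])
    have "AE p in square_measure. \<forall>X\<in>B. empirical_graphon k n X a p = step_kernel n (color_matrix k X a) p"
      using fB empirical_graphon_AE[OF n] by (intro AE_finite_allI) auto
    then show "AE p in square_measure. average_graphon k n B a p = step_kernel n (m a) p"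
    proof eventually_elim
      case (elim z)
      have "(\<Sum>X\<in>B. color_matrix k X a u v) / real (card B) = m a u v" for u v
      proof (cases "u = v")
        case False
        have "(\<Sum>X\<in>B. color_matrix k X a u v) = (\<Sum>X\<in>B. of_bool (X {u, v} = a))"
          using False by (simp add: color_matrix_def)
        also have "\<dots> = real (card {X \<in> B. X {u, v} = a})"
          using fB by (simp add: of_bool_def sum.If_cases Int_def)
        finally show ?thesis using False by (simp add: m_def p_def)
      qed (use N in \<open>simp add: color_matrix_def m_def\<close>)
      then show ?case using elim by (cases z) (simp add: average_graphon_def step_kernel_def)
    qed
  qed
  then have ent: "(real n)\<^sup>2 * entropy k (average_graphon k n B) = (\<Sum>a=1..k. \<Sum>u=1..n. \<Sum>v=1..n. m a u v * ln (m a u v))"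
    unfolding entropy_def using n by (simp add: sum_divide_distrib[symmetric])
  have "m a u v * ln (m a u v) \<le> (if u \<noteq> v then p {u, v} a * ln (p {u, v} a) else 0)" for a u v
    using xlnx_bounds(2)[of "1 / real k"] k by (auto simp: m_def)
  then have "(\<Sum>a=1..k. \<Sum>u=1..n. \<Sum>v=1..n. m a u v * ln (m a u v)) \<le>
     (\<Sum>a=1..k. \<Sum>u=1..n. \<Sum>v=1..n. if u \<noteq> v then p {u, v} a * ln (p {u, v} a) else 0)"
    by (intro sum_mono)
  also have "\<dots> = (\<Sum>a=1..k. 2 * (\<Sum>e\<in>complete_edges n. p e a * ln (p e a)))"
    using sum_ordered_pairs_edges[of "\<lambda>e. p e _ * ln (p e _)" n] by (intro sum.cong refl)
  also have "\<dots> = 2 * (\<Sum>e\<in>complete_edges n. \<Sum>a=1..k. p e a * ln (p e a))"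
    by (simp only: sum_distrib_left[symmetric]) (subst sum.swap, rule refl)
  finally show ?thesis using ln ent by simp
qed

text \<open>Pigeonhole over the keys: if every cell fell below the average, the cells could not add
  up to the whole sum.\<close>

lemma heavy_cell:
  fixes f :: "'a \<Rightarrow> real"
  assumes S: "finite S" "S \<noteq> {}" and K: "finite K" "key ` S \<subseteq> K"
  shows "\<exists>c\<in>K. (\<Sum>x\<in>S. f x) \<le> real (card K) * (\<Sum>x\<in>{x \<in> S. key x = c}. f x)"
proof (rule ccontr)
  assume "\<not> ?thesis"
  then have less: "real (card K) * (\<Sum>x\<in>{x \<in> S. key x = c}. f x) < (\<Sum>x\<in>S. f x)" if "c \<in> K" for c
    using that by (auto simp: not_le)
  have "K \<noteq> {}" using S(2) K(2) by auto
  then have "(\<Sum>c\<in>K. real (card K) * (\<Sum>x\<in>{x \<in> S. key x = c}. f x)) < (\<Sum>c\<in>K. (\<Sum>x\<in>S. f x))"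
    using K(1) less by (intro sum_strict_mono) auto
  also have "(\<Sum>c\<in>K. (\<Sum>x\<in>S. f x)) = real (card K) * (\<Sum>x\<in>S. f x)" by simp
  finally show False
    using sum.group[OF S(1) K, of f] by (simp add: sum_distrib_left[symmetric])
qed

text \<open>The partition function is compared with its heaviest cell \<open>B\<close>. The member
  \<open>X\<close> with the largest value of \<open>T\<close> bounds every summand, and the entropy
  of the average \<open>V\<close> bounds the size of \<open>B\<close>. Members of \<open>B\<close>
  share an approximant up to \<eta>/2, so \<open>X\<close> is within \<eta> of each of them and
  hence of \<open>V\<close>.\<close>

lemma log_partition_upper:
  assumes k: "k \<ge> 1" and \<eta>: "\<eta> > 0"
  shows "\<exists>n0. \<forall>n\<ge>n0. \<exists>X\<in>colorings k n. \<exists>V\<in>graphons k.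
    log_partition k T n \<le> T (graphon_class k (empirical_graphon k n X)) - 1 / 2 * entropy k V + \<eta> \<and>
    (\<forall>a\<in>{1..k}. cut_norm (\<lambda>p. empirical_graphon k n X a p - V a p) \<le> \<eta>)"
proof -
  obtain q \<G> where wr: "weak_regular k (\<eta> / 2) q \<G>"
    using weak_regularity[of "\<eta> / 2" k] \<eta> by auto
  then have fG: "finite \<G>" unfolding weak_regular_def by blast
  have reg: "\<exists>c\<in>({..n} \<rightarrow>\<^sub>E {..<q}) \<times> \<G>. \<forall>a\<in>{1..k}. cut_norm (\<lambda>z. empirical_graphon k n X a z -
      step_kernel n (\<lambda>u v. snd c a (fst c u) (fst c v)) z) \<le> \<eta> / 2" if "n \<ge> 1" for n X
    using wr that unfolding weak_regular_def by force
  \<comment> \<open>The numerator is the logarithm of the number of cells. The factor n + 1 appears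
    because class maps live on \<open>{..n}\<close>.\<close>
  have "(\<lambda>n. (real (Suc n) * ln (real q) + ln (real (card \<G>))) / (real n)\<^sup>2) \<longlonglongrightarrow> 0"
    by real_asymp
  then have "eventually (\<lambda>n. (real (Suc n) * ln (real q) + ln (real (card \<G>))) / (real n)\<^sup>2 < \<eta>) sequentially"
    using \<eta> by (rule order_tendstoD(2))
  then obtain n1 where n1: "\<And>n. n \<ge> n1 \<Longrightarrow> (real (Suc n) * ln (real q) + ln (real (card \<G>))) / (real n)\<^sup>2 < \<eta>"
    unfolding eventually_sequentially by blast
  show ?thesis
  proof (intro exI[of _ "max 1 n1"] allI impI)
    fix n assume "max 1 n1 \<le> n"
    then have n: "n \<ge> 1" "n \<ge> n1" by auto
    define K where "K = ({..n} \<rightarrow>\<^sub>E {..<q}) \<times> \<G>"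
    have "\<forall>X. \<exists>c. c \<in> K \<and> (\<forall>a\<in>{1..k}. cut_norm (\<lambda>z. empirical_graphon k n X a z -
      step_kernel n (\<lambda>u v. snd c a (fst c u) (fst c v)) z) \<le> \<eta> / 2)"
      unfolding K_def using reg[OF n(1)] by (simp only: Bex_def) simp
    from choice[OF this] obtain key where key0: "\<forall>X. key X \<in> K \<and> (\<forall>a\<in>{1..k}. cut_norm (\<lambda>z. empirical_graphon k n X a z -
      step_kernel n (\<lambda>u v. snd (key X) a (fst (key X) u) (fst (key X) v)) z) \<le> \<eta> / 2)" ..
    then have keyK: "key X \<in> K" for X by simp
    have close: "cut_norm (\<lambda>z. empirical_graphon k n X a z -
      step_kernel n (\<lambda>u v. snd (key X) a (fst (key X) u) (fst (key X) v)) z) \<le> \<eta> / 2" if "a \<in> {1..k}" for X a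
      using key0[THEN spec, THEN conjunct2] that by (rule bspec)
    have fK: "finite K" unfolding K_def using fG by (intro finite_cartesian_product finite_PiE) auto
    have K0: "K \<noteq> {}" using keyK by auto
    then have q: "q \<ge> 1" and G: "card \<G> > 0"
      unfolding K_def using fG by (auto simp: PiE_eq_empty_iff card_gt_0_iff)
    have cardK: "real (card K) = real q ^ Suc n * real (card \<G>)"
      unfolding K_def by (simp add: card_cartesian_product card_PiE)
    define t where "t X = T (graphon_class k (empirical_graphon k n X))" for X
    define Z where "Z = (\<Sum>X\<in>colorings k n. exp ((real n)\<^sup>2 * t X))"
    have Z: "Z > 0" unfolding Z_def using colorings_nonempty[OF k] by (intro sum_pos) auto
    obtain c where c: "c \<in> K" "Z \<le> real (card K) * (\<Sum>X\<in>{X \<in> colorings k n. key X = c}. exp ((real n)\<^sup>2 * t X))"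
      using heavy_cell[OF finite_colorings colorings_nonempty[OF k] fK, of key n "\<lambda>X. exp ((real n)\<^sup>2 * t X)"] keyK
      unfolding Z_def by blast
    define B where "B = {X \<in> colorings k n. key X = c}"
    have B: "B \<subseteq> colorings k n" unfolding B_def by auto
    have fB: "finite B" using B finite_subset finite_colorings by blast
    have Bne: "B \<noteq> {}" using c(2) Z unfolding B_def[symmetric] by auto
    have cB: "real (card B) > 0" using fB Bne by (simp add: card_gt_0_iff)
    have "Max (t ` B) \<in> t ` B" using fB Bne by (intro Max_in) auto
    then obtain X where X: "X \<in> B" "t X = Max (t ` B)" by auto
    have Xmax: "t Y \<le> t X" if "Y \<in> B" for Y unfolding X(2) using fB that by (intro Max_ge) auto
    define V where "V = average_graphon k n B"
    have V: "V \<in> graphons k" unfolding V_def by (rule average_graphon_in[OF k B Bne])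
    have "(\<Sum>X\<in>B. exp ((real n)\<^sup>2 * t X)) \<le> (\<Sum>Y\<in>B. exp ((real n)\<^sup>2 * t X))"
      using Xmax by (intro sum_mono) (auto intro: mult_left_mono)
    then have "Z \<le> real (card K) * (real (card B) * exp ((real n)\<^sup>2 * t X))"
      using c(2) unfolding B_def[symmetric] by (intro order_trans[OF c(2)[folded B_def]] mult_left_mono) auto
    then have "ln Z \<le> ln (real (card K) * (real (card B) * exp ((real n)\<^sup>2 * t X)))"
      using Z by (subst ln_le_cancel_iff) (auto intro: order_less_le_trans)
    also have "\<dots> = ln (real (card K)) + ln (real (card B)) + (real n)\<^sup>2 * t X"
      using cB fK K0 by (simp add: ln_mult card_gt_0_iff)
    also have "ln (real (card K)) = real (Suc n) * ln (real q) + ln (real (card \<G>))"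
      unfolding cardK using q G by (simp add: ln_mult ln_realpow del: power_Suc of_nat_Suc)
    also have "\<dots> \<le> (real n)\<^sup>2 * \<eta>"
      using n1[OF n(2)] n(1) by (simp add: divide_less_eq mult.commute)
    also have "ln (real (card B)) \<le> - (1 / 2) * (real n)\<^sup>2 * entropy k V"
      unfolding V_def by (rule ln_card_le_entropy_average[OF k n(1) B Bne])
    finally have "ln Z \<le> (real n)\<^sup>2 * (t X - 1 / 2 * entropy k V + \<eta>)"
      by (simp add: algebra_simps)
    then have "log_partition k T n \<le> t X - 1 / 2 * entropy k V + \<eta>"
      using n(1) unfolding log_partition_def t_def[symmetric] Z_def[symmetric]
      by (simp add: divide_le_eq mult.commute)
    moreover have "cut_norm (\<lambda>p. empirical_graphon k n X a p - V a p) \<le> \<eta>" if a: "a \<in> {1..k}" for a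
      unfolding V_def
    proof (rule cut_norm_average_le[OF k B Bne a empirical_graphon_bounded])
      fix Y assume Y: "Y \<in> B"
      have "cut_norm (\<lambda>p. empirical_graphon k n X a p - empirical_graphon k n Y a p) \<le>
        cut_norm (\<lambda>p. empirical_graphon k n X a p - step_kernel n (\<lambda>u v. snd c a (fst c u) (fst c v)) p) +
        cut_norm (\<lambda>p. step_kernel n (\<lambda>u v. snd c a (fst c u) (fst c v)) p - empirical_graphon k n Y a p)"
        by (intro cut_norm_triangle_diff empirical_graphon_bounded step_kernel_bounded)
      moreover have "key X = c" "key Y = c" using X(1) Y unfolding B_def by auto
      ultimately show "cut_norm (\<lambda>p. empirical_graphon k n X a p - empirical_graphon k n Y a p) \<le> \<eta>"
        using close[OF a, of X] close[OF a, of Y]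
          cut_norm_minus_commute[of "empirical_graphon k n Y a" "step_kernel n (\<lambda>u v. snd c a (fst c u) (fst c v))"]
        by simp
    qed
    ultimately show "\<exists>X\<in>colorings k n. \<exists>V\<in>graphons k.
      log_partition k T n \<le> T (graphon_class k (empirical_graphon k n X)) - 1 / 2 * entropy k V + \<eta> \<and>
      (\<forall>a\<in>{1..k}. cut_norm (\<lambda>p. empirical_graphon k n X a p - V a p) \<le> \<eta>)"
      using X(1) B V unfolding t_def by blast
  qed
qed

section \<open>Block averages\<close>

definition block_mean :: "nat \<Rightarrow> (real \<times> real \<Rightarrow> real) \<Rightarrow> nat \<Rightarrow> nat \<Rightarrow> real" where
  "block_mean n f u v = (real n)\<^sup>2 * set_lebesgue_integral square_measure (block n u \<times> block n v) f"

lemma block_set_integrable: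
  "integrable square_measure f \<Longrightarrow> set_integrable square_measure (block n u \<times> block n v) (f :: _ \<Rightarrow> real)"
  unfolding set_integrable_def by (intro integrable_mult_indicator) auto

lemma measure_block_square:
  assumes "u \<in> {1..n}" "v \<in> {1..n}"
  shows "measure square_measure (block n u \<times> block n v) = 1 / (real n)\<^sup>2"
  using assms by (simp add: measure_rect measure_block power2_eq_square)

lemma set_integral_block_const:
  assumes "u \<in> {1..n}" "v \<in> {1..n}"
  shows "set_lebesgue_integral square_measure (block n u \<times> block n v) (\<lambda>p. c) = c / (real n)\<^sup>2"
  unfolding set_lebesgue_integral_def using measure_block_square[OF assms] by (simp add: sets.Int_space_eq2)

lemma block_mean_mono:
  assumes uv: "u \<in> {1..n}" "v \<in> {1..n}" and fg: "integrable square_measure f" "integrable square_measure g"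
    and le: "\<And>p. p \<in> space square_measure \<Longrightarrow> f p \<le> g p"
  shows "block_mean n f u v \<le> block_mean n g u v"
  unfolding block_mean_def set_lebesgue_integral_def using fg le
  by (intro mult_left_mono integral_mono integrable_mult_indicator) (auto simp: indicator_def)

lemma block_mean_const: "u \<in> {1..n} \<Longrightarrow> v \<in> {1..n} \<Longrightarrow> block_mean n (\<lambda>p. c) u v = c"
  by (subst block_mean_def, subst set_integral_block_const) auto

lemma block_mean_diff:
  assumes "integrable square_measure f" "integrable square_measure g"
  shows "block_mean n (\<lambda>p. f p - g p) u v = block_mean n f u v - block_mean n g u v"
  unfolding block_mean_def using set_integral_diff(2)[OF block_set_integrable[OF assms(1)] block_set_integrable[OF assms(2)]]
  by (simp add: right_diff_distrib)

lemma block_mean_add: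
  assumes "integrable square_measure f" "integrable square_measure g"
  shows "block_mean n (\<lambda>p. f p + g p) u v = block_mean n f u v + block_mean n g u v"
  unfolding block_mean_def using set_integral_add(2)[OF block_set_integrable[OF assms(1)] block_set_integrable[OF assms(2)]]
  by (simp add: distrib_left)

lemma block_mean_scale: "block_mean n (\<lambda>p. c * f p) u v = c * block_mean n f u v"
  unfolding block_mean_def by simp

lemma step_kernel_integrable: "integrable square_measure (step_kernel n R)"
  by (rule bounded_kernel_integrable[OF step_kernel_bounded])

text \<open>Block averaging is a conditional expectation, so the triangle inequality on each block
  makes it a contraction of L1.\<close>

lemma block_mean_contraction:
  assumes n: "n \<ge> 1" and f: "integrable square_measure f"
  shows "(\<integral>p. \<bar>step_kernel n (block_mean n f) p\<bar> \<partial>square_measure) \<le> (\<integral>p. \<bar>f p\<bar> \<partial>square_measure)"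
proof -
  have "(\<integral>p. \<bar>step_kernel n (block_mean n f) p\<bar> \<partial>square_measure) = (\<integral>p. step_kernel n (\<lambda>u v. \<bar>block_mean n f u v\<bar>) p \<partial>square_measure)"
    by (intro Bochner_Integration.integral_cong) (auto simp: step_kernel_def)
  also have "\<dots> = (\<Sum>u=1..n. \<Sum>v=1..n. \<bar>block_mean n f u v\<bar>) / (real n)\<^sup>2" by (rule integral_step_kernel[OF n])
  also have "\<dots> = (\<Sum>u=1..n. \<Sum>v=1..n. \<bar>set_lebesgue_integral square_measure (block n u \<times> block n v) f\<bar>)"
    using n by (simp add: block_mean_def abs_mult sum_divide_distrib)
  also have "\<dots> \<le> (\<Sum>u=1..n. \<Sum>v=1..n. set_lebesgue_integral square_measure (block n u \<times> block n v) (\<lambda>p. \<bar>f p\<bar>))"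
  proof (intro sum_mono)
    fix u v
    show "\<bar>set_lebesgue_integral square_measure (block n u \<times> block n v) f\<bar> \<le>
        set_lebesgue_integral square_measure (block n u \<times> block n v) (\<lambda>p. \<bar>f p\<bar>)"
      using integral_norm_bound[of square_measure "\<lambda>p. indicator (block n u \<times> block n v) p *\<^sub>R f p"]
      unfolding set_lebesgue_integral_def by (simp add: abs_mult)
  qed
  also have "\<dots> = (\<integral>p. \<bar>f p\<bar> \<partial>square_measure)"
    using f by (intro integral_blocks[OF n, symmetric]) auto
  finally show ?thesis .
qed

text \<open>Indices outside \<open>{1..n}\<close> are covered because the cell of a box coordinate
  may fall there; such blocks are null.\<close>

lemma measure_block_le:
  assumes n: "n \<ge> 1" shows "measure unit_measure (block n u) \<le> 1 / real n"
proof (cases "u \<in> {1..n}")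
  case False
  have "AE x in unit_measure. x \<notin> block n u"
    using AE_cell_index[OF n] by eventually_elim (use False in \<open>auto simp: block_def\<close>)
  then have "measure unit_measure (block n u) = measure unit_measure {}"
    by (intro UM.finite_measure_eq_AE) auto
  then show ?thesis by simp
qed (simp add: measure_block)

text \<open>Up to a null set the indicator is constant on every block that avoids the strip of
  blocks at the cell of \<open>a\<close> and the one at the cell of \<open>b\<close>. On these two
  strips, of area at most 1/n each, the error is at most 1.\<close>

lemma block_mean_corner_L1:
  assumes n: "n \<ge> 1"
  shows "(\<integral>p. \<bar>indicat_real (corner a b) p - step_kernel n (block_mean n (indicat_real (corner a b))) p\<bar> \<partial>square_measure) \<le> 2 / real n"
proof -
  let ?f = "indicat_real (corner a b)"
  let ?i = "cell_index n a" and ?j = "cell_index n b"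
  let ?H = "\<lambda>z. indicat_real (block n ?i \<times> {0..1}) z + indicat_real ({0..1} \<times> block n ?j) z"
  have ci_mono: "cell_index n x \<le> cell_index n y" if "x \<le> y" for x y
    unfolding cell_index_def using that by (intro nat_mono ceiling_mono mult_left_mono) auto
  have side: "x \<le> c \<longleftrightarrow> cell_index n x < cell_index n c" if "cell_index n x \<noteq> cell_index n c" for x c
    using ci_mono[of x c] ci_mono[of c x] that by fastforce
  have if1: "integrable square_measure ?f" by simp
  have mean01: "0 \<le> block_mean n ?f u v" "block_mean n ?f u v \<le> 1" if "u \<in> {1..n}" "v \<in> {1..n}" for u v
    using block_mean_mono[OF that _ if1, of "\<lambda>_. 0"] block_mean_mono[OF that if1, of "\<lambda>_. 1"]
      block_mean_const[OF that] by (auto simp: indicator_def)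
  have mean: "block_mean n ?f u v = of_bool (u < ?i \<and> v < ?j)"
    if uv: "u \<in> {1..n}" "v \<in> {1..n}" "u \<noteq> ?i" "v \<noteq> ?j" for u v
  proof -
    have "set_lebesgue_integral square_measure (block n u \<times> block n v) ?f =
        set_lebesgue_integral square_measure (block n u \<times> block n v) (\<lambda>p. of_bool (u < ?i \<and> v < ?j))"
      unfolding set_lebesgue_integral_def
    proof (intro Bochner_Integration.integral_cong refl)
      fix p :: "real \<times> real"
      show "indicat_real (block n u \<times> block n v) p *\<^sub>R ?f p = indicat_real (block n u \<times> block n v) p *\<^sub>R of_bool (u < ?i \<and> v < ?j)"
        using side uv(3,4) by (cases p) (auto simp: indicator_def corner_def block_def)
    qed
    then have "block_mean n ?f u v = block_mean n (\<lambda>p. of_bool (u < ?i \<and> v < ?j)) u v"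
      unfolding block_mean_def by simp
    then show ?thesis using block_mean_const[OF uv(1,2)] by simp
  qed
  have "AE z in square_measure. \<bar>?f z - step_kernel n (block_mean n ?f) z\<bar> \<le> ?H z"
    using AE_square[OF AE_cell_index[OF n]] AE_space
  proof eventually_elim
    case (elim z)
    obtain x y where z: "z = (x, y)" by (cases z)
    have xy: "x \<in> {0..1}" "y \<in> {0..1}" using elim(2) z by (auto simp: space_pair_measure)
    have c: "cell_index n x \<in> {1..n}" "cell_index n y \<in> {1..n}" using elim(1) z by auto
    show ?case
    proof (cases "cell_index n x = ?i \<or> cell_index n y = ?j")
      case True
      have "\<bar>?f z - step_kernel n (block_mean n ?f) z\<bar> \<le> 1"
        using mean01[OF c] by (auto simp: z step_kernel_def indicator_def)
      moreover have "1 \<le> ?H z" using True xy by (auto simp: z indicator_def block_def)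
      ultimately show ?thesis by linarith
    next
      case False
      then have "?f z = of_bool (cell_index n x < ?i \<and> cell_index n y < ?j)"
        using side[of x a] side[of y b] xy by (auto simp: z indicator_def corner_def)
      then have "?f z - step_kernel n (block_mean n ?f) z = 0"
        using mean[OF c] False by (simp add: z step_kernel_def)
      then show ?thesis by simp
    qed
  qed
  moreover have "integrable square_measure (\<lambda>z. \<bar>?f z - step_kernel n (block_mean n ?f) z\<bar>)"
    using if1 step_kernel_integrable by (intro integrable_abs Bochner_Integration.integrable_diff) auto
  ultimately have "(\<integral>z. \<bar>?f z - step_kernel n (block_mean n ?f) z\<bar> \<partial>square_measure) \<le> (\<integral>z. ?H z \<partial>square_measure)"
    by (intro integral_mono_AE) auto
  also have "\<dots> = measure square_measure (block n ?i \<times> {0..1}) + measure square_measure ({0..1} \<times> block n ?j)"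
    by (subst Bochner_Integration.integral_add) (auto simp: sets.Int_space_eq2)
  also have "\<dots> \<le> 2 / real n"
  proof -
    have "measure unit_measure {0..1} = 1" using prob_space_unit by (simp add: measure_def)
    moreover have "2 / real n = 1 / real n + 1 / real n" by simp
    ultimately show ?thesis
      using measure_block_le[OF n, of ?i] measure_block_le[OF n, of ?j] by (simp add: measure_rect del: add_divide_distrib)
  qed
  finally show ?thesis .
qed

text \<open>The grids for successive n are not nested, so the argument goes through boxes and L1
  approximation instead of martingale convergence; contraction controls the block averages of the
  approximation error.\<close>

lemma block_mean_L1_convergence:
  assumes "integrable square_measure f"
  shows "(\<lambda>n. \<integral>p. \<bar>f p - step_kernel n (block_mean n f) p\<bar> \<partial>square_measure) \<longlonglongrightarrow> 0"
  using assms
proof (induction rule: square_integrable_induct)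
  case (corner a b)
  have "(\<lambda>n. 2 / real n) \<longlonglongrightarrow> 0" by real_asymp
  then show ?case
    by (rule tendsto_sandwich[OF _ _ tendsto_const, rotated 2])
      (simp, rule eventually_mono[OF eventually_ge_at_top[of 1]], rule block_mean_corner_L1)
next
  case (scale c g)
  have "(\<integral>p. \<bar>c * g p - step_kernel n (block_mean n (\<lambda>p. c * g p)) p\<bar> \<partial>square_measure) =
      \<bar>c\<bar> * (\<integral>p. \<bar>g p - step_kernel n (block_mean n g) p\<bar> \<partial>square_measure)" for n
  proof -
    have "\<bar>c * g p - step_kernel n (block_mean n (\<lambda>p. c * g p)) p\<bar> = \<bar>c\<bar> * \<bar>g p - step_kernel n (block_mean n g) p\<bar>" for p
      by (auto simp: step_kernel_def block_mean_scale abs_mult[symmetric] right_diff_distrib split: prod.split)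
    then show ?thesis by simp
  qed
  then show ?case using tendsto_mult_right_zero[OF scale(2), of "\<bar>c\<bar>"] by simp
next
  case (add g h)
  have i: "integrable square_measure (\<lambda>p. \<bar>q p - step_kernel n (block_mean n q) p\<bar>)" if "integrable square_measure q" for q n
    using that step_kernel_integrable by (intro integrable_abs Bochner_Integration.integrable_diff) auto
  have le: "(\<integral>p. \<bar>(g p + h p) - step_kernel n (block_mean n (\<lambda>p. g p + h p)) p\<bar> \<partial>square_measure) \<le>
      (\<integral>p. \<bar>g p - step_kernel n (block_mean n g) p\<bar> \<partial>square_measure) + (\<integral>p. \<bar>h p - step_kernel n (block_mean n h) p\<bar> \<partial>square_measure)" for n
    unfolding Bochner_Integration.integral_add[OF i[OF add(1)] i[OF add(2)], symmetric]
  proof (rule integral_mono)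
    show "integrable square_measure (\<lambda>p. \<bar>(g p + h p) - step_kernel n (block_mean n (\<lambda>p. g p + h p)) p\<bar>)"
      using i[of "\<lambda>p. g p + h p" n] add(1,2) by simp
    show "integrable square_measure (\<lambda>p. \<bar>g p - step_kernel n (block_mean n g) p\<bar> + \<bar>h p - step_kernel n (block_mean n h) p\<bar>)"
      using i add(1,2) by simp
    show "\<bar>(g p + h p) - step_kernel n (block_mean n (\<lambda>p. g p + h p)) p\<bar> \<le>
        \<bar>g p - step_kernel n (block_mean n g) p\<bar> + \<bar>h p - step_kernel n (block_mean n h) p\<bar>" for p
      by (cases p) (simp add: step_kernel_def block_mean_add[OF add(1,2)])
  qed
  show ?case
    by (rule tendsto_sandwich[OF _ _ tendsto_const tendsto_add_zero[OF add(3,4)]])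
      (simp, rule always_eventually, rule allI, rule le)
next
  case (lim f)
  show ?case
  proof (rule LIMSEQ_I)
    fix e :: real assume e: "e > 0"
    then obtain h where h: "integrable square_measure h"
      "(\<lambda>n. \<integral>p. \<bar>h p - step_kernel n (block_mean n h) p\<bar> \<partial>square_measure) \<longlonglongrightarrow> 0"
      "(\<integral>p. \<bar>f p - h p\<bar> \<partial>square_measure) < e / 3" using lim(2)[of "e / 3"] by auto
    obtain N where N: "\<forall>n\<ge>N. norm ((\<integral>p. \<bar>h p - step_kernel n (block_mean n h) p\<bar> \<partial>square_measure) - 0) < e / 3"
      using LIMSEQ_D[OF h(2), of "e / 3"] e by auto
    have "(\<integral>p. \<bar>f p - step_kernel n (block_mean n f) p\<bar> \<partial>square_measure) < e" if n: "n \<ge> max 1 N" for n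
    proof -
      have fh: "integrable square_measure (\<lambda>p. f p - h p)" using lim(1) h(1) by simp
      let ?s = "step_kernel n (block_mean n (\<lambda>p. f p - h p))"
      have j1: "integrable square_measure (\<lambda>p. \<bar>f p - h p\<bar>)" using fh by simp
      have j2: "integrable square_measure (\<lambda>p. \<bar>h p - step_kernel n (block_mean n h) p\<bar>)"
        using h(1) step_kernel_integrable by (intro integrable_abs Bochner_Integration.integrable_diff) auto
      have j3: "integrable square_measure (\<lambda>p. \<bar>?s p\<bar>)" using step_kernel_integrable by (intro integrable_abs)
      have j0: "integrable square_measure (\<lambda>p. \<bar>f p - step_kernel n (block_mean n f) p\<bar>)"
        using lim(1) step_kernel_integrable by (intro integrable_abs Bochner_Integration.integrable_diff) auto
      have "(\<integral>p. \<bar>f p - step_kernel n (block_mean n f) p\<bar> \<partial>square_measure) \<le>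
          (\<integral>p. \<bar>f p - h p\<bar> + \<bar>h p - step_kernel n (block_mean n h) p\<bar> + \<bar>?s p\<bar> \<partial>square_measure)"
      proof (rule integral_mono[OF j0])
        show "integrable square_measure (\<lambda>p. \<bar>f p - h p\<bar> + \<bar>h p - step_kernel n (block_mean n h) p\<bar> + \<bar>?s p\<bar>)"
          using j1 j2 j3 by simp
        show "\<bar>f p - step_kernel n (block_mean n f) p\<bar> \<le> \<bar>f p - h p\<bar> + \<bar>h p - step_kernel n (block_mean n h) p\<bar> + \<bar>?s p\<bar>" for p
          by (cases p) (simp add: step_kernel_def block_mean_diff[OF lim(1) h(1)])
      qed
      also have "\<dots> = (\<integral>p. \<bar>f p - h p\<bar> \<partial>square_measure) + (\<integral>p. \<bar>h p - step_kernel n (block_mean n h) p\<bar> \<partial>square_measure)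
          + (\<integral>p. \<bar>?s p\<bar> \<partial>square_measure)" using j1 j2 j3 by simp
      also have "(\<integral>p. \<bar>?s p\<bar> \<partial>square_measure) \<le> (\<integral>p. \<bar>f p - h p\<bar> \<partial>square_measure)"
        using n by (intro block_mean_contraction[OF _ fh]) simp
      finally show ?thesis using h(3) N n by fastforce
    qed
    moreover have "0 \<le> (\<integral>p. \<bar>f p - step_kernel n (block_mean n f) p\<bar> \<partial>square_measure)" for n by simp
    ultimately show "\<exists>N. \<forall>n\<ge>N. norm ((\<integral>p. \<bar>f p - step_kernel n (block_mean n f) p\<bar> \<partial>square_measure) - 0) < e"
      by (intro exI[of _ "max 1 N"]) auto
  qed
qed

text \<open>Jensen's inequality for x ln x, obtained by averaging Young's inequality over the block
  for each constant \<open>g\<close> and choosing g = 1 + ln m.\<close>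

lemma block_mean_xlnx_le:
  assumes W: "W \<in> graphons k" and a: "a \<in> {1..k}" and uv: "u \<in> {1..n}" "v \<in> {1..n}"
  shows "block_mean n (W a) u v * ln (block_mean n (W a) u v) \<le> block_mean n (\<lambda>p. W a p * ln (W a p)) u v"
proof -
  define m where "m = block_mean n (W a) u v"
  define J where "J = block_mean n (\<lambda>p. W a p * ln (W a p)) u v"
  have young: "m * g - exp (g - 1) \<le> J" for g
  proof -
    have "block_mean n (\<lambda>p. g * W a p - exp (g - 1)) u v \<le> J"
      unfolding J_def
    proof (rule block_mean_mono[OF uv])
      show "integrable square_measure (\<lambda>p. g * W a p - exp (g - 1))"
        using graphon_integrable[OF W a] by (intro Bochner_Integration.integrable_diff integrable_mult_right) auto
      show "g * W a p - exp (g - 1) \<le> W a p * ln (W a p)" if "p \<in> space square_measure" for p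
        using xlnx_Young[OF graphon_range(1)[OF W a that], of g] by (simp add: mult.commute)
    qed (rule entropy_integrable[OF W a])
    moreover have "block_mean n (\<lambda>p. g * W a p - exp (g - 1)) u v = m * g - exp (g - 1)"
      using graphon_integrable[OF W a] block_mean_const[OF uv]
      by (simp add: block_mean_diff block_mean_scale m_def mult.commute)
    ultimately show ?thesis by simp
  qed
  have m0: "0 \<le> m"
    using block_mean_mono[OF uv _ graphon_integrable[OF W a], of "\<lambda>_. 0"] graphon_range[OF W a] block_mean_const[OF uv]
    by (simp add: m_def)
  have "m * ln m \<le> J"
  proof (cases "m = 0")
    case True
    have "0 \<le> J"
    proof (rule field_le_epsilon)
      fix e :: real assume "0 < e"
      \<comment> \<open>At m = 0 the optimal \<open>g\<close> lies at minus infinity; g = 1 + ln e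
        yields -e \<le> J for every positive e.\<close>
      then show "0 \<le> J + e" using young[of "1 + ln e"] True by simp
    qed
    then show ?thesis using True by simp
  next
    case False
    then show ?thesis using young[of "1 + ln m"] m0 by (simp add: distrib_left)
  qed
  then show ?thesis unfolding m_def J_def .
qed

lemma block_mean_sym:
  assumes W: "W \<in> graphons k" and a: "a \<in> {1..k}"
  shows "block_mean n (W a) u v = block_mean n (W a) v u"
proof -
  have "(\<integral>p. indicat_real (block n v \<times> block n u) p *\<^sub>R W a p \<partial>square_measure) =
     (\<integral>p. indicat_real (block n v \<times> block n u) (prod.swap p) *\<^sub>R W a (prod.swap p) \<partial>square_measure)"
    using block_set_integrable[OF graphon_integrable[OF W a]]
    by (intro integral_square_swap[symmetric]) (auto simp: set_integrable_def)
  also have "\<dots> = (\<integral>p. indicat_real (block n u \<times> block n v) p *\<^sub>R W a p \<partial>square_measure)"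
  proof (rule Bochner_Integration.integral_cong[OF refl])
    fix p assume "p \<in> space square_measure"
    then obtain x y where "p = (x, y)" "x \<in> {0..1}" "y \<in> {0..1}" by (auto simp: space_pair_measure)
    then show "indicat_real (block n v \<times> block n u) (prod.swap p) *\<^sub>R W a (prod.swap p) = indicat_real (block n u \<times> block n v) p *\<^sub>R W a p"
      using W a unfolding graphons_def by (auto simp: indicator_def)
  qed
  finally show ?thesis unfolding block_mean_def set_lebesgue_integral_def by simp
qed

lemma block_mean_simplex:
  assumes W: "W \<in> graphons k" and uv: "u \<in> {1..n}" "v \<in> {1..n}"
  shows "a \<in> {1..k} \<Longrightarrow> 0 \<le> block_mean n (W a) u v" "a \<in> {1..k} \<Longrightarrow> block_mean n (W a) u v \<le> 1"
    "(\<Sum>a=1..k. block_mean n (W a) u v) = 1"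
proof -
  show "0 \<le> block_mean n (W a) u v" "block_mean n (W a) u v \<le> 1" if a: "a \<in> {1..k}"
    using block_mean_mono[OF uv _ graphon_integrable[OF W a], of "\<lambda>_. 0"]
      block_mean_mono[OF uv graphon_integrable[OF W a], of "\<lambda>_. 1"] graphon_range[OF W a] block_mean_const[OF uv]
    by simp_all
  have "(\<Sum>a=1..k. block_mean n (W a) u v) =
      (real n)\<^sup>2 * (\<Sum>a=1..k. \<integral>p. indicat_real (block n u \<times> block n v) p *\<^sub>R W a p \<partial>square_measure)"
    unfolding block_mean_def set_lebesgue_integral_def by (simp add: sum_distrib_left)
  also have "(\<Sum>a=1..k. \<integral>p. indicat_real (block n u \<times> block n v) p *\<^sub>R W a p \<partial>square_measure) =
      (\<integral>p. (\<Sum>a=1..k. indicat_real (block n u \<times> block n v) p *\<^sub>R W a p) \<partial>square_measure)"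
    using block_set_integrable[OF graphon_integrable[OF W]]
    by (intro Bochner_Integration.integral_sum[symmetric]) (auto simp: set_integrable_def)
  also have "\<dots> = set_lebesgue_integral square_measure (block n u \<times> block n v) (\<lambda>p. 1)"
    unfolding set_lebesgue_integral_def
  proof (rule Bochner_Integration.integral_cong[OF refl])
    fix p assume "p \<in> space square_measure"
    then obtain x y where "p = (x, y)" "x \<in> {0..1}" "y \<in> {0..1}" by (auto simp: space_pair_measure)
    then have "(\<Sum>a=1..k. W a p) = 1" using W unfolding graphons_def prob_simplex_def by auto
    then show "(\<Sum>a=1..k. indicat_real (block n u \<times> block n v) p *\<^sub>R W a p) = indicat_real (block n u \<times> block n v) p *\<^sub>R 1"
      by (simp add: sum_distrib_left[symmetric])
  qed
  also have "(real n)\<^sup>2 * \<dots> = 1" using set_integral_block_const[OF uv, of 1] uv by simp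
  finally show "(\<Sum>a=1..k. block_mean n (W a) u v) = 1" .
qed

lemma sum_block_mean_xlnx_le:
  assumes W: "W \<in> graphons k" and n: "n \<ge> 1"
  shows "(\<Sum>a=1..k. \<Sum>u=1..n. \<Sum>v=1..n. block_mean n (W a) u v * ln (block_mean n (W a) u v)) \<le> (real n)\<^sup>2 * entropy k W"
proof -
  have "(\<Sum>a=1..k. \<Sum>u=1..n. \<Sum>v=1..n. block_mean n (W a) u v * ln (block_mean n (W a) u v)) \<le>
      (\<Sum>a=1..k. \<Sum>u=1..n. \<Sum>v=1..n. block_mean n (\<lambda>p. W a p * ln (W a p)) u v)"
    by (intro sum_mono block_mean_xlnx_le[OF W])
  also have "\<dots> = (\<Sum>a=1..k. (real n)\<^sup>2 * (\<integral>p. W a p * ln (W a p) \<partial>square_measure))"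
  proof (rule sum.cong[OF refl])
    fix a assume "a \<in> {1..k}"
    then show "(\<Sum>u=1..n. \<Sum>v=1..n. block_mean n (\<lambda>p. W a p * ln (W a p)) u v) = (real n)\<^sup>2 * (\<integral>p. W a p * ln (W a p) \<partial>square_measure)"
      unfolding integral_blocks[OF n entropy_integrable[OF W \<open>a \<in> _\<close>]] block_mean_def by (simp only: sum_distrib_left)
  qed
  also have "\<dots> = (real n)\<^sup>2 * entropy k W" by (simp add: entropy_def sum_distrib_left)
  finally show ?thesis .
qed

section \<open>Random colourings: the lower bound\<close>

text \<open>For probability vectors \<open>w e\<close> this is the law of independent
  coordinates.\<close>

definition product_weight :: "'e set \<Rightarrow> ('e \<Rightarrow> 'c \<Rightarrow> real) \<Rightarrow> ('e \<Rightarrow> 'c) \<Rightarrow> real" where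
  "product_weight E w X = (\<Prod>e\<in>E. w e (X e))"

lemma exp_le_quadratic:
  fixes y :: real
  assumes "\<bar>y\<bar> \<le> 1" shows "exp y \<le> 1 + y + y\<^sup>2"
proof (cases "0 \<le> y")
  case True
  then show ?thesis using assms by (intro exp_bound) auto
next
  case False
  define s where "s = - y"
  have s: "0 < s" "s \<le> 1" using False assms by (auto simp: s_def)
  \<comment> \<open>The product equals 1 + s^3, so the case of negative y reduces to exp s \<ge> 1 +
    s by taking reciprocals.\<close>
  have "1 \<le> (1 + s) * (1 - s + s\<^sup>2)" using s by (simp add: algebra_simps power2_eq_square)
  also have "\<dots> \<le> exp s * (1 - s + s\<^sup>2)"
    using s by (intro mult_right_mono) (auto simp: exp_ge_add_one_self)
  finally have "1 / exp s \<le> 1 - s + s\<^sup>2" by (simp add: divide_le_eq mult.commute)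
  then show ?thesis by (simp add: s_def exp_minus inverse_eq_divide)
qed

section \<open>Independent coordinates with prescribed marginals\<close>

context
  fixes E :: "'e set" and C :: "'c set" and w :: "'e \<Rightarrow> 'c \<Rightarrow> real"
  assumes E: "finite E" and C: "finite C"
    and w0: "\<And>e a. e \<in> E \<Longrightarrow> a \<in> C \<Longrightarrow> 0 \<le> w e a"
    and w1: "\<And>e. e \<in> E \<Longrightarrow> (\<Sum>a\<in>C. w e a) = 1"
begin

lemma product_weight_nonneg: "X \<in> E \<rightarrow>\<^sub>E C \<Longrightarrow> 0 \<le> product_weight E w X"
  unfolding product_weight_def by (intro prod_nonneg) (auto intro!: w0)

text \<open>Independence as a factorisation of expectations. Taking all factors 1, a single factor
  different from 1, or exponentials gives the total mass, the marginals and the moment generating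
  function.\<close>

lemma sum_product_weight_prod:
  "(\<Sum>X\<in>E \<rightarrow>\<^sub>E C. product_weight E w X * (\<Prod>e\<in>E. f e (X e))) = (\<Prod>e\<in>E. \<Sum>a\<in>C. w e a * f e a)"
  unfolding product_weight_def prod.distrib[symmetric] using E C by (intro prod_sum_PiE[symmetric]) auto

lemma sum_product_weight: "(\<Sum>X\<in>E \<rightarrow>\<^sub>E C. product_weight E w X) = 1"
  using sum_product_weight_prod[of "\<lambda>_ _. 1"] w1 by simp

lemma product_weight_marginal:
  assumes e: "e \<in> E"
  shows "(\<Sum>X\<in>E \<rightarrow>\<^sub>E C. product_weight E w X * g (X e)) = (\<Sum>a\<in>C. w e a * g a)"
proof -
  let ?f = "\<lambda>e' a. if e' = e then g a else 1"
  have "(\<Prod>e'\<in>E. ?f e' (X e')) = g (X e)" for X :: "'e \<Rightarrow> 'c"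
    using E e by (simp add: prod.delta)
  then have "(\<Sum>X\<in>E \<rightarrow>\<^sub>E C. product_weight E w X * g (X e)) = (\<Prod>e'\<in>E. \<Sum>a\<in>C. w e' a * ?f e' a)"
    using sum_product_weight_prod[of ?f] by simp
  also have "\<dots> = (\<Prod>e'\<in>E. if e' = e then (\<Sum>a\<in>C. w e a * g a) else 1)"
    using w1 by (intro prod.cong) auto
  also have "\<dots> = (\<Sum>a\<in>C. w e a * g a)" using E e by (simp add: prod.delta)
  finally show ?thesis .
qed

text \<open>The logarithm of the weight is a sum over coordinates, and each summand is averaged
  against a single marginal. Colourings of weight 0 contribute 0 on both sides, which covers
  vanishing entries of \<open>w\<close>.\<close>

lemma product_weight_entropy:
  "(\<Sum>X\<in>E \<rightarrow>\<^sub>E C. product_weight E w X * ln (product_weight E w X)) = (\<Sum>e\<in>E. \<Sum>a\<in>C. w e a * ln (w e a))"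
proof -
  have "product_weight E w X * ln (product_weight E w X) = (\<Sum>e\<in>E. product_weight E w X * ln (w e (X e)))" for X
  proof (cases "product_weight E w X = 0")
    case False
    then have "w e (X e) \<noteq> 0" if "e \<in> E" for e using E that by (auto simp: product_weight_def)
    then show ?thesis using E by (simp add: product_weight_def ln_prod sum_distrib_left)
  qed simp
  then have "(\<Sum>X\<in>E \<rightarrow>\<^sub>E C. product_weight E w X * ln (product_weight E w X)) =
      (\<Sum>e\<in>E. \<Sum>X\<in>E \<rightarrow>\<^sub>E C. product_weight E w X * ln (w e (X e)))"
    by (simp add: sum.swap[of _ E])
  also have "\<dots> = (\<Sum>e\<in>E. \<Sum>a\<in>C. w e a * ln (w e a))"
  proof (rule sum.cong[OF refl])
    fix e assume "e \<in> E"
    then show "(\<Sum>X\<in>E \<rightarrow>\<^sub>E C. product_weight E w X * ln (w e (X e))) = (\<Sum>a\<in>C. w e a * ln (w e a))"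
      by (rule product_weight_marginal)
  qed
  finally show ?thesis .
qed

text \<open>For a centred variable bounded by 1 the linear term of the quadratic bound on exp
  averages to 0, leaving 1 + t^2 \<le> exp (t^2) for each coordinate.\<close>

lemma product_weight_mgf:
  assumes mean: "\<And>e. e \<in> E \<Longrightarrow> (\<Sum>a\<in>C. w e a * z e a) = 0"
    and z: "\<And>e a. e \<in> E \<Longrightarrow> a \<in> C \<Longrightarrow> \<bar>z e a\<bar> \<le> 1" and t: "\<And>e. e \<in> E \<Longrightarrow> \<bar>t e\<bar> \<le> 1"
  shows "(\<Sum>X\<in>E \<rightarrow>\<^sub>E C. product_weight E w X * exp (\<Sum>e\<in>E. t e * z e (X e))) \<le> exp (\<Sum>e\<in>E. (t e)\<^sup>2)"
proof -
  have "(\<Sum>X\<in>E \<rightarrow>\<^sub>E C. product_weight E w X * exp (\<Sum>e\<in>E. t e * z e (X e))) =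
      (\<Prod>e\<in>E. \<Sum>a\<in>C. w e a * exp (t e * z e a))"
    using sum_product_weight_prod[of "\<lambda>e a. exp (t e * z e a)"] E by (simp add: exp_sum)
  also have "\<dots> \<le> (\<Prod>e\<in>E. exp ((t e)\<^sup>2))"
  proof (rule prod_mono)
    fix e assume e: "e \<in> E"
    have "w e a * exp (t e * z e a) \<le> w e a + t e * (w e a * z e a) + w e a * (t e)\<^sup>2" if a: "a \<in> C" for a
    proof -
      have 1: "\<bar>t e * z e a\<bar> \<le> 1" using z[OF e a] t[OF e] by (simp add: abs_mult mult_le_one)
      have "(t e * z e a)\<^sup>2 \<le> (t e)\<^sup>2"
        using z[OF e a] by (simp add: power_mult_distrib mult_left_le abs_square_le_1)
      with exp_le_quadratic[OF 1] have "exp (t e * z e a) \<le> 1 + t e * z e a + (t e)\<^sup>2" by linarith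
      from mult_left_mono[OF this w0[OF e a]] show ?thesis by (simp add: algebra_simps)
    qed
    then have "(\<Sum>a\<in>C. w e a * exp (t e * z e a)) \<le> (\<Sum>a\<in>C. w e a + t e * (w e a * z e a) + w e a * (t e)\<^sup>2)"
      by (rule sum_mono)
    also have "\<dots> = 1 + (t e)\<^sup>2"
      using w1[OF e] mean[OF e] by (simp add: sum.distrib sum_distrib_left[symmetric] sum_distrib_right[symmetric])
    also have "\<dots> \<le> exp ((t e)\<^sup>2)" by (rule exp_ge_add_one_self)
    finally show "0 \<le> (\<Sum>a\<in>C. w e a * exp (t e * z e a)) \<and> (\<Sum>a\<in>C. w e a * exp (t e * z e a)) \<le> exp ((t e)\<^sup>2)"
      using w0[OF e] by (auto intro!: sum_nonneg)
  qed
  also have "\<dots> = exp (\<Sum>e\<in>E. (t e)\<^sup>2)" using E by (simp add: exp_sum)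
  finally show ?thesis .
qed

text \<open>Chernoff's method: on the event, the exponential of \<theta> times the excess over
  \<open>l\<close> is at least 1, so its expectation dominates the probability.\<close>

lemma product_weight_tail:
  assumes mean: "\<And>e. e \<in> E \<Longrightarrow> (\<Sum>a\<in>C. w e a * z e a) = 0"
    and z: "\<And>e a. e \<in> E \<Longrightarrow> a \<in> C \<Longrightarrow> \<bar>z e a\<bar> \<le> 1" and t: "\<And>e. e \<in> E \<Longrightarrow> \<bar>\<theta> * c e\<bar> \<le> 1"
    and \<theta>: "\<theta> \<ge> 0"
  shows "(\<Sum>X\<in>{X \<in> E \<rightarrow>\<^sub>E C. l < (\<Sum>e\<in>E. c e * z e (X e))}. product_weight E w X)
    \<le> exp ((\<Sum>e\<in>E. (\<theta> * c e)\<^sup>2) - \<theta> * l)"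
proof -
  let ?F = "\<lambda>X. \<Sum>e\<in>E. c e * z e (X e)"
  have fin: "finite (E \<rightarrow>\<^sub>E C)" using E C by (intro finite_PiE) auto
  have "(\<Sum>X\<in>{X \<in> E \<rightarrow>\<^sub>E C. l < ?F X}. product_weight E w X) \<le>
      (\<Sum>X\<in>{X \<in> E \<rightarrow>\<^sub>E C. l < ?F X}. product_weight E w X * exp (\<theta> * (?F X - l)))"
  proof (rule sum_mono)
    fix X assume X: "X \<in> {X \<in> E \<rightarrow>\<^sub>E C. l < ?F X}"
    then have "1 \<le> exp (\<theta> * (?F X - l))" using \<theta> by simp
    then show "product_weight E w X \<le> product_weight E w X * exp (\<theta> * (?F X - l))"
      using product_weight_nonneg[of X] X by (simp add: mult_le_cancel_left1)
  qed
  also have "\<dots> \<le> (\<Sum>X\<in>E \<rightarrow>\<^sub>E C. product_weight E w X * exp (\<theta> * (?F X - l)))"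
    using fin product_weight_nonneg by (intro sum_mono2) auto
  also have "\<dots> = (\<Sum>X\<in>E \<rightarrow>\<^sub>E C. product_weight E w X * exp (\<Sum>e\<in>E. (\<theta> * c e) * z e (X e))) * exp (- \<theta> * l)"
    by (simp add: sum_distrib_right sum_distrib_left right_diff_distrib exp_diff exp_minus field_simps)
  also have "\<dots> \<le> exp (\<Sum>e\<in>E. (\<theta> * c e)\<^sup>2) * exp (- \<theta> * l)"
    by (intro mult_right_mono product_weight_mgf mean z t) auto
  also have "\<dots> = exp ((\<Sum>e\<in>E. (\<theta> * c e)\<^sup>2) - \<theta> * l)" by (simp add: exp_add[symmetric])
  finally show ?thesis .
qed

end

section \<open>Sampling a colouring from a graphon\<close>

definition edge_weight :: "nat \<Rightarrow> kernel \<Rightarrow> nat set \<Rightarrow> nat \<Rightarrow> real" where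
  "edge_weight n W e a = block_mean n (W a) (Min e) (Max e)"

text \<open>For a graphon \<open>W\<close> this is the expectation of \<open>color_matrix\<close>
  under the product of the edge weights. The diagonal value 1/k is shared with
  \<open>color_matrix\<close>, so deviations vanish on the diagonal.\<close>

definition mean_matrix :: "nat \<Rightarrow> nat \<Rightarrow> kernel \<Rightarrow> nat \<Rightarrow> nat \<Rightarrow> nat \<Rightarrow> real" where
  "mean_matrix k n W a u v = (if u \<noteq> v then block_mean n (W a) u v else 1 / real k)"

lemma edge_weight_simplex:
  assumes W: "W \<in> graphons k" and e: "e \<in> complete_edges n"
  shows "a \<in> {1..k} \<Longrightarrow> 0 \<le> edge_weight n W e a" "a \<in> {1..k} \<Longrightarrow> edge_weight n W e a \<le> 1"
    "(\<Sum>a=1..k. edge_weight n W e a) = 1"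
  unfolding edge_weight_def using block_mean_simplex[OF W complete_edges_Min_Max(1,2)[OF e]] by auto

lemma card_complete_edges_le: "2 * real (card (complete_edges n)) \<le> (real n)\<^sup>2"
proof -
  have "2 * real (card (complete_edges n)) = (\<Sum>u=1..n. \<Sum>v=1..n. if u \<noteq> v then 1 else 0)"
    using sum_ordered_pairs_edges[of "\<lambda>_. 1" n] by simp
  also have "\<dots> \<le> (\<Sum>u=1..n. \<Sum>v=1..n. 1)" by (intro sum_mono) auto
  finally show ?thesis by (simp add: power2_eq_square)
qed

text \<open>The deviation over S \<times> T is a sum of independent centred terms, one for each of
  the at most n^2/2 edges, so the exponential tail bound applies.\<close>

lemma sampling_deviation:
  assumes W: "W \<in> graphons k" and a: "a \<in> {1..k}" and \<delta>: "0 \<le> \<delta>" "\<delta> \<le> 2"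
    and ST: "S \<subseteq> {1..n}" "T \<subseteq> {1..n}" and s: "s \<in> {-1, 1}"
  shows "(\<Sum>X\<in>{X \<in> colorings k n. \<delta> * (real n)\<^sup>2 < s * (\<Sum>u\<in>S. \<Sum>v\<in>T. color_matrix k X a u v - mean_matrix k n W a u v)}.
    product_weight (complete_edges n) (edge_weight n W) X) \<le> exp (- (\<delta>\<^sup>2 / 8) * (real n)\<^sup>2)"
proof -
  let ?E = "complete_edges n"
  define z where "z e b = of_bool (b = a) - edge_weight n W e a" for e and b :: nat
  \<comment> \<open>An edge enters once for each of its orientations lying in S \<times> T, so
    \<open>c e\<close> is at most 2 in modulus.\<close>
  define c where "c e = s * (of_bool (Min e \<in> S \<and> Max e \<in> T) + of_bool (Max e \<in> S \<and> Min e \<in> T))" for e :: "nat set"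
  \<comment> \<open>The exponent is at most 2 \<theta>^2 n^2 - \<theta> \<delta> n^2, minimal at
    \<theta> = \<delta>/4 with value - \<delta>^2 n^2 / 8. The hypothesis \<delta> \<le> 2 keeps the
    products \<open>\<theta> * c e\<close> within [-1, 1].\<close>
  define \<theta> where "\<theta> = \<delta> / 4"
  have dev: "s * (\<Sum>u\<in>S. \<Sum>v\<in>T. color_matrix k X a u v - mean_matrix k n W a u v) = (\<Sum>e\<in>?E. c e * z e (X e))" for X
  proof -
    let ?R = "\<lambda>u v. of_bool (u \<in> S \<and> v \<in> T) * (of_bool (X {u, v} = a) - block_mean n (W a) u v)"
    have "(\<Sum>u\<in>S. \<Sum>v\<in>T. color_matrix k X a u v - mean_matrix k n W a u v) =
        (\<Sum>u\<in>S. \<Sum>v=1..n. if u \<noteq> v then ?R u v else 0)"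
      using ST finite_subset[OF ST(2)]
      by (intro sum.cong refl sum.mono_neutral_cong_left) (auto simp: color_matrix_def mean_matrix_def)
    also have "\<dots> = (\<Sum>u=1..n. \<Sum>v=1..n. if u \<noteq> v then ?R u v else 0)"
      using ST finite_subset[OF ST(1)] by (intro sum.mono_neutral_left) (auto intro!: sum.neutral)
    also have "\<dots> = (\<Sum>e\<in>?E. ?R (Min e) (Max e) + ?R (Max e) (Min e))"
      by (rule sum_ordered_pairs)
    also have "s * \<dots> = (\<Sum>e\<in>?E. c e * z e (X e))"
      unfolding sum_distrib_left
    proof (rule sum.cong[OF refl])
      fix e assume e: "e \<in> ?E"
      have "X {Min e, Max e} = X e" "X {Max e, Min e} = X e"
        using complete_edges_Min_Max(4)[OF e] by (simp_all add: insert_commute)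
      then show "s * (?R (Min e) (Max e) + ?R (Max e) (Min e)) = c e * z e (X e)"
        using block_mean_sym[OF W a, of n "Max e" "Min e"]
        by (simp add: c_def z_def edge_weight_def algebra_simps)
    qed
    finally show ?thesis .
  qed
  have "(\<Sum>X\<in>{X \<in> ?E \<rightarrow>\<^sub>E {1..k}. \<delta> * (real n)\<^sup>2 < (\<Sum>e\<in>?E. c e * z e (X e))}. product_weight ?E (edge_weight n W) X)
      \<le> exp ((\<Sum>e\<in>?E. (\<theta> * c e)\<^sup>2) - \<theta> * (\<delta> * (real n)\<^sup>2))"
  proof (rule product_weight_tail)
    show "(\<Sum>b=1..k. edge_weight n W e b * z e b) = 0" if e: "e \<in> ?E" for e
    proof -
      have "(\<Sum>b=1..k. edge_weight n W e b * z e b) =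
          (\<Sum>b=1..k. if b = a then edge_weight n W e b else 0) - (\<Sum>b=1..k. edge_weight n W e b) * edge_weight n W e a"
        unfolding z_def sum_distrib_right sum_subtractf[symmetric] by (intro sum.cong) (auto simp: right_diff_distrib)
      then show ?thesis using edge_weight_simplex(3)[OF W e] a by simp
    qed
    show "\<bar>z e b\<bar> \<le> 1" if "e \<in> ?E" for e b
      using edge_weight_simplex(1,2)[OF W that a] by (auto simp: z_def)
    have "\<bar>c e\<bar> \<le> 2" for e using s by (auto simp: c_def)
    then have "\<theta> * \<bar>c e\<bar> \<le> (1 / 2) * 2" for e using \<delta> unfolding \<theta>_def by (intro mult_mono) auto
    then show "\<bar>\<theta> * c e\<bar> \<le> 1" for e using \<delta> by (simp add: abs_mult \<theta>_def)
    show "0 \<le> \<theta>" using \<delta> by (simp add: \<theta>_def)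
  qed (use edge_weight_simplex[OF W] in auto)
  also have "\<dots> \<le> exp (- (\<delta>\<^sup>2 / 8) * (real n)\<^sup>2)"
  proof -
    have "(c e)\<^sup>2 \<le> 4" for e using s by (auto simp: c_def power2_eq_square)
    then have "(\<Sum>e\<in>?E. (\<theta> * c e)\<^sup>2) \<le> (\<Sum>e\<in>?E. \<theta>\<^sup>2 * 4)"
      unfolding power_mult_distrib by (intro sum_mono mult_left_mono) auto
    also have "\<dots> = 2 * \<theta>\<^sup>2 * (2 * real (card ?E))" by simp
    also have "\<dots> \<le> 2 * \<theta>\<^sup>2 * (real n)\<^sup>2" by (intro mult_left_mono card_complete_edges_le) auto
    also have "\<dots> = \<delta>\<^sup>2 / 8 * (real n)\<^sup>2" by (simp add: \<theta>_def power2_eq_square)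
    finally have "(\<Sum>e\<in>?E. (\<theta> * c e)\<^sup>2) - \<theta> * (\<delta> * (real n)\<^sup>2) \<le> \<delta>\<^sup>2 / 8 * (real n)\<^sup>2 - \<theta> * (\<delta> * (real n)\<^sup>2)" by simp
    also have "\<dots> = - (\<delta>\<^sup>2 / 8) * (real n)\<^sup>2" by (simp add: \<theta>_def power2_eq_square)
    finally show ?thesis by simp
  qed
  finally show ?thesis unfolding colorings_def dev .
qed

lemma union_bound:
  fixes f :: "'a \<Rightarrow> real"
  assumes S: "finite S" "\<And>x. x \<in> S \<Longrightarrow> 0 \<le> f x" and I: "finite I"
    and Q: "\<And>x. x \<in> S \<Longrightarrow> Q x \<Longrightarrow> \<exists>i\<in>I. P i x"
    and b: "\<And>i. i \<in> I \<Longrightarrow> (\<Sum>x\<in>{x \<in> S. P i x}. f x) \<le> b"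
  shows "(\<Sum>x\<in>{x \<in> S. Q x}. f x) \<le> real (card I) * b"
proof -
  have "(\<Sum>x\<in>{x \<in> S. Q x}. f x) \<le> (\<Sum>x\<in>{x \<in> S. Q x}. \<Sum>i\<in>I. if P i x then f x else 0)"
  proof (rule sum_mono)
    fix x assume x: "x \<in> {x \<in> S. Q x}"
    then obtain i where i: "i \<in> I" "P i x" using Q by auto
    then show "f x \<le> (\<Sum>i\<in>I. if P i x then f x else 0)"
      using member_le_sum[of i I "\<lambda>i. if P i x then f x else 0"] I S(2) x by auto
  qed
  also have "\<dots> \<le> (\<Sum>x\<in>S. \<Sum>i\<in>I. if P i x then f x else 0)"
    using S by (intro sum_mono2) (auto intro!: sum_nonneg)
  also have "\<dots> = (\<Sum>i\<in>I. \<Sum>x\<in>{x \<in> S. P i x}. f x)"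
    using S(1) by (subst sum.swap) (simp add: sum.inter_filter)
  also have "\<dots> \<le> (\<Sum>i\<in>I. b)" by (intro sum_mono b)
  finally show ?thesis by simp
qed

text \<open>The event is phrased through vertex subsets, which suffice for the cut norm of step
  kernels and leave finitely many events for the union bound.\<close>

definition far_sample :: "nat \<Rightarrow> nat \<Rightarrow> kernel \<Rightarrow> real \<Rightarrow> (nat set \<Rightarrow> nat) \<Rightarrow> bool" where
  "far_sample k n W \<delta> X \<longleftrightarrow> (\<exists>a\<in>{1..k}. \<exists>S\<subseteq>{1..n}. \<exists>T\<subseteq>{1..n}.
    \<delta> * (real n)\<^sup>2 < \<bar>\<Sum>u\<in>S. \<Sum>v\<in>T. color_matrix k X a u v - mean_matrix k n W a u v\<bar>)"

text \<open>The union runs over a colour, two vertex sets and a sign, that is, over 2 k 4^n events,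
  each of probability at most exp (- \<delta>^2 n^2 / 8).\<close>

lemma far_sample_probability:
  assumes W: "W \<in> graphons k" and \<delta>: "0 \<le> \<delta>" "\<delta> \<le> 2"
  shows "(\<Sum>X\<in>{X \<in> colorings k n. far_sample k n W \<delta> X}. product_weight (complete_edges n) (edge_weight n W) X)
    \<le> 2 * real k * (2 ^ n * 2 ^ n * exp (- (\<delta>\<^sup>2 / 8) * (real n)\<^sup>2))"
proof -
  let ?I = "{1..k} \<times> Pow {1..n} \<times> Pow {1..n} \<times> {-1, 1 :: real}"
  have "(\<Sum>X\<in>{X \<in> colorings k n. far_sample k n W \<delta> X}. product_weight (complete_edges n) (edge_weight n W) X)
      \<le> real (card ?I) * exp (- (\<delta>\<^sup>2 / 8) * (real n)\<^sup>2)"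
  proof (rule union_bound[where P = "\<lambda>(a, S, T, s) X. \<delta> * (real n)\<^sup>2 < s * (\<Sum>u\<in>S. \<Sum>v\<in>T. color_matrix k X a u v - mean_matrix k n W a u v)"])
    show "0 \<le> product_weight (complete_edges n) (edge_weight n W) X" if "X \<in> colorings k n" for X
      using that edge_weight_simplex[OF W] unfolding colorings_def
      by (intro product_weight_nonneg[where C = "{1..k}"]) auto
  next
    fix X assume "far_sample k n W \<delta> X"
    then obtain a S T where aST: "a \<in> {1..k}" "S \<subseteq> {1..n}" "T \<subseteq> {1..n}"
      "\<delta> * (real n)\<^sup>2 < \<bar>\<Sum>u\<in>S. \<Sum>v\<in>T. color_matrix k X a u v - mean_matrix k n W a u v\<bar>"
      unfolding far_sample_def by blast
    define s :: real where "s = (if (\<Sum>u\<in>S. \<Sum>v\<in>T. color_matrix k X a u v - mean_matrix k n W a u v) \<ge> 0 then 1 else -1)"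
    have "(a, S, T, s) \<in> ?I" using aST(1-3) by (auto simp: s_def)
    moreover have "\<delta> * (real n)\<^sup>2 < s * (\<Sum>u\<in>S. \<Sum>v\<in>T. color_matrix k X a u v - mean_matrix k n W a u v)"
      using aST(4) by (auto simp: s_def abs_if split: if_splits)
    ultimately show "\<exists>i\<in>?I. (case i of (a, S, T, s) \<Rightarrow> \<lambda>X. \<delta> * (real n)\<^sup>2 < s * (\<Sum>u\<in>S. \<Sum>v\<in>T. color_matrix k X a u v - mean_matrix k n W a u v)) X"
      by (intro bexI[of _ "(a, S, T, s)"]) simp_all
  next
    fix i assume "i \<in> ?I"
    then obtain a S T s where i: "i = (a, S, T, s)" "a \<in> {1..k}" "S \<subseteq> {1..n}" "T \<subseteq> {1..n}" "s \<in> {-1, 1}" by blast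
    from sampling_deviation[OF W i(2) \<delta> i(3-5)]
    show "(\<Sum>X\<in>{X \<in> colorings k n. (case i of (a, S, T, s) \<Rightarrow> \<lambda>X. \<delta> * (real n)\<^sup>2 < s * (\<Sum>u\<in>S. \<Sum>v\<in>T. color_matrix k X a u v - mean_matrix k n W a u v)) X}.
      product_weight (complete_edges n) (edge_weight n W) X) \<le> exp (- (\<delta>\<^sup>2 / 8) * (real n)\<^sup>2)"
      unfolding i(1) by simp
  qed auto
  also have "real (card ?I) = 2 * real k * (2 ^ n * 2 ^ n)"
    by (simp add: card_cartesian_product card_Pow)
  finally show ?thesis by (simp add: mult.assoc)
qed

text \<open>Three errors add up: the sampling deviation \<delta>, the n diagonal blocks of total
  area 1/n, and the L1 distance of \<open>W a\<close> from its block averages.\<close>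

lemma near_sample_cut_norm:
  assumes k: "k \<ge> 1" and n: "n \<ge> 1" and W: "W \<in> graphons k" and a: "a \<in> {1..k}" and X: "\<not> far_sample k n W \<delta> X"
  shows "cut_norm (\<lambda>p. empirical_graphon k n X a p - W a p) \<le>
    \<delta> + (1 / real n + (\<integral>p. \<bar>W a p - step_kernel n (block_mean n (W a)) p\<bar> \<partial>square_measure))"
proof -
  let ?M = "step_kernel n (mean_matrix k n W a)" and ?B = "step_kernel n (block_mean n (W a))"
  have iW: "integrable square_measure (W a)" by (rule graphon_integrable[OF W a])
  have "cut_norm (\<lambda>z. empirical_graphon k n X a z - ?M z) \<le> \<delta>"
    unfolding cut_norm_empirical_minus_step[OF n]
    using X a by (intro cut_norm_step_kernel_le[OF n]) (auto simp: far_sample_def not_less)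
  moreover have "cut_norm (\<lambda>z. ?M z - ?B z) \<le> 1 / real n"
  proof -
    have "cut_norm (\<lambda>z. ?M z - ?B z) \<le> (\<integral>p. \<bar>?M p - ?B p\<bar> \<partial>square_measure)"
      by (intro cut_norm_le_L1 Bochner_Integration.integrable_diff step_kernel_integrable)
    also have "\<dots> = (\<integral>p. step_kernel n (\<lambda>u v. \<bar>mean_matrix k n W a u v - block_mean n (W a) u v\<bar>) p \<partial>square_measure)"
      by (intro Bochner_Integration.integral_cong) (auto simp: step_kernel_def)
    also have "\<dots> = (\<Sum>u=1..n. \<Sum>v=1..n. \<bar>mean_matrix k n W a u v - block_mean n (W a) u v\<bar>) / (real n)\<^sup>2"
      by (rule integral_step_kernel[OF n])
    also have "\<dots> \<le> (\<Sum>u=1..n. \<Sum>v=1..n. if u = v then 1 else 0) / (real n)\<^sup>2"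
    proof (intro divide_right_mono sum_mono)
      fix u v assume uv: "u \<in> {1..n}" "v \<in> {1..n}"
      have "1 / real k \<le> 1" "0 \<le> 1 / real k" using k by auto
      then have "\<bar>1 / real k - b\<bar> \<le> 1" if "0 \<le> b" "b \<le> 1" for b using that by linarith
      then show "\<bar>mean_matrix k n W a u v - block_mean n (W a) u v\<bar> \<le> (if u = v then 1 else 0)"
        using block_mean_simplex(1,2)[OF W uv a] by (auto simp: mean_matrix_def)
    qed simp
    also have "\<dots> = 1 / real n" using n by (simp add: power2_eq_square)
    finally show ?thesis .
  qed
  moreover have "cut_norm (\<lambda>z. ?B z - W a z) \<le> (\<integral>p. \<bar>W a p - ?B p\<bar> \<partial>square_measure)"
    unfolding cut_norm_minus_commute[of ?B]
    by (intro cut_norm_le_L1 Bochner_Integration.integrable_diff step_kernel_integrable iW)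
  moreover have "cut_norm (\<lambda>p. empirical_graphon k n X a p - W a p) \<le>
      cut_norm (\<lambda>z. empirical_graphon k n X a z - ?M z) + cut_norm (\<lambda>z. ?M z - W a z)"
    by (intro cut_norm_triangle_diff empirical_graphon_bounded step_kernel_bounded graphon_bounded[OF W a])
  moreover have "cut_norm (\<lambda>z. ?M z - W a z) \<le> cut_norm (\<lambda>z. ?M z - ?B z) + cut_norm (\<lambda>z. ?B z - W a z)"
    by (intro cut_norm_triangle_diff step_kernel_bounded graphon_bounded[OF W a])
  ultimately show ?thesis by linarith
qed

text \<open>Passing from all blocks to the off-diagonal ones omits n terms per colour, each at least
  -1, which costs at most n k. The rest is Jensen's inequality on the blocks.\<close>

lemma edge_weight_entropy_le:
  assumes W: "W \<in> graphons k" and n: "n \<ge> 1"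
  shows "2 * (\<Sum>e\<in>complete_edges n. \<Sum>a=1..k. edge_weight n W e a * ln (edge_weight n W e a))
    \<le> (real n)\<^sup>2 * entropy k W + real n * real k"
proof -
  let ?x = "\<lambda>a u v. block_mean n (W a) u v * ln (block_mean n (W a) u v)"
  have "2 * (\<Sum>e\<in>complete_edges n. edge_weight n W e a * ln (edge_weight n W e a)) =
      (\<Sum>u=1..n. \<Sum>v=1..n. if u \<noteq> v then ?x a u v else 0)" if a: "a \<in> {1..k}" for a
  proof -
    have "?x a (Max e) (Min e) = ?x a (Min e) (Max e)" for e
      using block_mean_sym[OF W a, of n "Max e" "Min e"] by simp
    then show ?thesis unfolding sum_ordered_pairs[of "?x a"] by (simp add: edge_weight_def sum_distrib_left)
  qed
  then have "2 * (\<Sum>e\<in>complete_edges n. \<Sum>a=1..k. edge_weight n W e a * ln (edge_weight n W e a)) =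
      (\<Sum>a=1..k. \<Sum>u=1..n. \<Sum>v=1..n. if u \<noteq> v then ?x a u v else 0)"
    by (subst sum.swap) (simp add: sum_distrib_left)
  also have "\<dots> \<le> (\<Sum>a=1..k. \<Sum>u=1..n. \<Sum>v=1..n. ?x a u v + (if u = v then 1 else 0))"
  proof (intro sum_mono)
    fix a u v assume auv: "a \<in> {1..k}" "u \<in> {1..n}" "v \<in> {1..n}"
    have "-1 \<le> ?x a u v" by (intro xlnx_bounds block_mean_simplex(1,2)[OF W auv(2,3,1)])
    then show "(if u \<noteq> v then ?x a u v else 0) \<le> ?x a u v + (if u = v then 1 else 0)" by auto
  qed
  also have "\<dots> = (\<Sum>a=1..k. \<Sum>u=1..n. \<Sum>v=1..n. ?x a u v) + real n * real k"
    by (simp add: sum.distrib)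
  also have "\<dots> \<le> (real n)\<^sup>2 * entropy k W + real n * real k"
    using sum_block_mean_xlnx_le[OF W n] by simp
  finally show ?thesis .
qed

lemma continuous_map_class_dist:
  assumes T: "continuous_map (graphon_topology k) euclideanreal T" and A: "A \<in> graphon_space k" and e: "e > 0"
  obtains d where "d > 0" "\<And>B. B \<in> graphon_space k \<Longrightarrow> class_dist k A B < d \<Longrightarrow> \<bar>T B - T A\<bar> < e"
proof -
  have "openin (graphon_topology k) {B \<in> topspace (graphon_topology k). T B \<in> ball (T A) e}"
    by (rule openin_continuous_map_preimage[OF T]) simp
  then have "openin (GS.mtopology k) {B \<in> graphon_space k. T B \<in> ball (T A) e}"
    unfolding graphon_topology_def by simp
  then obtain d where d: "d > 0" "GS.mball k A d \<subseteq> {B \<in> graphon_space k. T B \<in> ball (T A) e}"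
    unfolding GS.openin_mtopology using A e by force
  have "\<bar>T B - T A\<bar> < e" if "B \<in> graphon_space k" "class_dist k A B < d" for B
  proof -
    have "B \<in> GS.mball k A d" using that A by simp
    then have "T B \<in> ball (T A) e" using d(2) by blast
    then show ?thesis by (simp add: dist_real_def abs_minus_commute)
  qed
  then show thesis using d(1) that by blast
qed

text \<open>Gibbs' inequality is applied to the law of the sampled colouring. Continuity at the
  class of \<open>W\<close> controls \<open>T\<close> on near samples and boundedness controls it on
  far ones; these two errors and the diagonal entropy term get \<eta>/3 each.\<close>

lemma log_partition_lower:
  assumes k: "k \<ge> 1" and T: "continuous_map (graphon_topology k) euclideanreal T"
    and C: "\<And>A. A \<in> graphon_space k \<Longrightarrow> \<bar>T A\<bar> \<le> C"
    and W: "W \<in> graphons k" and \<eta>: "\<eta> > 0"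
  shows "\<forall>\<^sub>F n in sequentially. T (graphon_class k W) - 1 / 2 * entropy k W - \<eta> \<le> log_partition k T n"
proof -
  define A where "A = graphon_class k W"
  have A: "A \<in> graphon_space k" unfolding A_def by (rule graphon_class_in[OF W])
  have C0: "0 \<le> C" using C[OF A] by linarith
  obtain d where d: "d > 0" "\<And>B. B \<in> graphon_space k \<Longrightarrow> class_dist k A B < d \<Longrightarrow> \<bar>T B - T A\<bar> < \<eta> / 3"
    using continuous_map_class_dist[OF T A, of "\<eta> / 3"] \<eta> by auto
  \<comment> \<open>The bound k \<delta> \<le> d/2 leaves the other half of \<open>d\<close> to the
    grid errors \<open>L n\<close>; the minimum with 1 keeps \<delta> in the range of the tail
    bound.\<close>
  define \<delta> where "\<delta> = min 1 (d / (2 * real k))"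
  have \<delta>: "0 < \<delta>" "\<delta> \<le> 2" "real k * \<delta> \<le> d / 2"
  proof -
    show "0 < \<delta>" "\<delta> \<le> 2" using d(1) k by (auto simp: \<delta>_def)
    have "real k * \<delta> \<le> real k * (d / (2 * real k))" unfolding \<delta>_def by (intro mult_left_mono) auto
    then show "real k * \<delta> \<le> d / 2" using k by simp
  qed
  define L where "L n = (\<Sum>a=1..k. 1 / real n + (\<integral>p. \<bar>W a p - step_kernel n (block_mean n (W a)) p\<bar> \<partial>square_measure))" for n
  define F where "F n = 2 * C * (2 * real k * (2 ^ n * 2 ^ n * exp (- (\<delta>\<^sup>2 / 8) * (real n)\<^sup>2)))" for n
  have "L \<longlonglongrightarrow> (\<Sum>a=1..k. 0 + 0)"
    unfolding L_def by (intro tendsto_sum tendsto_add block_mean_L1_convergence graphon_integrable[OF W] lim_1_over_n)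
  then have L: "\<forall>\<^sub>F n in sequentially. L n < d / 2"
    using d(1) by (intro order_tendstoD(2)) auto
  have "\<delta>\<^sup>2 / 8 > 0" using \<delta> by simp
  then have "F \<longlonglongrightarrow> 0" unfolding F_def by real_asymp
  then have F: "\<forall>\<^sub>F n in sequentially. F n < \<eta> / 3" using \<eta> by (intro order_tendstoD(2)) auto
  have "(\<lambda>n. real k / (2 * real n)) \<longlonglongrightarrow> 0" by real_asymp
  then have K: "\<forall>\<^sub>F n in sequentially. real k / (2 * real n) < \<eta> / 3" using \<eta> by (intro order_tendstoD(2)) auto
  show ?thesis
    using L F K eventually_ge_at_top[of 1]
  proof eventually_elim
    case (elim n)
    then have n: "n \<ge> 1" by simp
    define P where "P = product_weight (complete_edges n) (edge_weight n W)"
    define t where "t X = T (graphon_class k (empirical_graphon k n X))" for X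
    have XM: "graphon_class k (empirical_graphon k n X) \<in> graphon_space k" if "X \<in> colorings k n" for X
      by (rule graphon_class_in[OF empirical_graphon_in[OF k that]])
    have P0: "0 \<le> P X" if "X \<in> colorings k n" for X
      using that edge_weight_simplex[OF W] unfolding colorings_def P_def
      by (intro product_weight_nonneg[where C = "{1..k}"]) auto
    have P1: "(\<Sum>X\<in>colorings k n. P X) = 1"
      unfolding P_def colorings_def using edge_weight_simplex[OF W] by (intro sum_product_weight) auto
    have near: "T A - \<eta> / 3 \<le> t X" if X: "X \<in> colorings k n" "\<not> far_sample k n W \<delta> X" for X
    proof -
      note E = empirical_graphon_in[OF k X(1)]
      have "class_dist k A (graphon_class k (empirical_graphon k n X)) = cut_dist k (empirical_graphon k n X) W"
        unfolding A_def class_dist_class[OF W E] by (rule cut_dist_sym[OF W E])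
      also have "\<dots> \<le> (\<Sum>a=1..k. cut_norm (\<lambda>p. empirical_graphon k n X a p - W a p))"
        by (rule cut_dist_le_cut_norm[OF E W])
      also have "\<dots> \<le> (\<Sum>a=1..k. \<delta> + (1 / real n + (\<integral>p. \<bar>W a p - step_kernel n (block_mean n (W a)) p\<bar> \<partial>square_measure)))"
        by (intro sum_mono near_sample_cut_norm[OF k n W _ X(2)])
      also have "\<dots> = real k * \<delta> + L n" unfolding L_def by (subst sum.distrib) simp
      also have "\<dots> < d" using \<delta>(3) elim(1) by simp
      finally have "class_dist k A (graphon_class k (empirical_graphon k n X)) < d" .
      from d(2)[OF XM[OF X(1)] this] show ?thesis unfolding t_def by linarith
    qed
    \<comment> \<open>Since \<open>T\<close> takes values in [-C, C], a far sample loses at most 2 C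
      against \<open>T A\<close>.\<close>
    have low: "T A - \<eta> / 3 - 2 * C * of_bool (far_sample k n W \<delta> X) \<le> t X" if X: "X \<in> colorings k n" for X
    proof (cases "far_sample k n W \<delta> X")
      case True
      have "- C \<le> t X" "T A \<le> C" using C[OF XM[OF X]] C[OF A] unfolding t_def by linarith+
      then show ?thesis using True \<eta> by simp
    qed (use near[OF X] in simp)
    have mean: "T A - \<eta> / 3 - F n \<le> (\<Sum>X\<in>colorings k n. P X * t X)"
    proof -
      have far: "(\<Sum>X\<in>colorings k n. P X * of_bool (far_sample k n W \<delta> X)) \<le>
          2 * real k * (2 ^ n * 2 ^ n * exp (- (\<delta>\<^sup>2 / 8) * (real n)\<^sup>2))"
      proof -
        have "(\<Sum>X\<in>colorings k n. P X * of_bool (far_sample k n W \<delta> X)) = (\<Sum>X\<in>{X \<in> colorings k n. far_sample k n W \<delta> X}. P X)"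
          by (simp add: of_bool_def sum.inter_filter if_distrib cong: if_cong)
        then show ?thesis using far_sample_probability[OF W, of \<delta> n] \<delta> unfolding P_def by simp
      qed
      have "T A - \<eta> / 3 - F n \<le> (T A - \<eta> / 3) - 2 * C * (\<Sum>X\<in>colorings k n. P X * of_bool (far_sample k n W \<delta> X))"
        unfolding F_def using mult_left_mono[OF far, of "2 * C"] C0 by linarith
      also have "\<dots> = (\<Sum>X\<in>colorings k n. P X * (T A - \<eta> / 3 - 2 * C * of_bool (far_sample k n W \<delta> X)))"
      proof -
        have "P X * (T A - \<eta> / 3 - 2 * C * of_bool (far_sample k n W \<delta> X)) =
            P X * (T A - \<eta> / 3) - 2 * C * (P X * of_bool (far_sample k n W \<delta> X))" for X
          by (simp add: right_diff_distrib)
        then show ?thesis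
          by (simp only: sum_subtractf sum_distrib_left[symmetric] sum_distrib_right[symmetric] P1) simp
      qed
      also have "\<dots> \<le> (\<Sum>X\<in>colorings k n. P X * t X)"
        by (intro sum_mono mult_left_mono low P0)
      finally show ?thesis .
    qed
    have gibbs: "(real n)\<^sup>2 * (\<Sum>X\<in>colorings k n. P X * t X) - (\<Sum>X\<in>colorings k n. P X * ln (P X)) \<le> (real n)\<^sup>2 * log_partition k T n"
    proof -
      have "(\<Sum>X\<in>colorings k n. P X * ((real n)\<^sup>2 * t X)) - (\<Sum>X\<in>colorings k n. P X * ln (P X)) \<le>
          ln (\<Sum>X\<in>colorings k n. exp ((real n)\<^sup>2 * t X))"
        by (intro Gibbs_variational_le P0 P1 finite_colorings)
      also have "\<dots> = (real n)\<^sup>2 * log_partition k T n" using n by (simp add: log_partition_def t_def)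
      finally show ?thesis by (simp add: sum_distrib_left mult.left_commute)
    qed
    have ent: "2 * (\<Sum>X\<in>colorings k n. P X * ln (P X)) \<le> (real n)\<^sup>2 * entropy k W + real n * real k"
    proof -
      have "(\<Sum>X\<in>colorings k n. P X * ln (P X)) =
          (\<Sum>e\<in>complete_edges n. \<Sum>a=1..k. edge_weight n W e a * ln (edge_weight n W e a))"
        unfolding P_def colorings_def using edge_weight_simplex[OF W] by (intro product_weight_entropy) auto
      then show ?thesis using edge_weight_entropy_le[OF W n] by simp
    qed
    have mean': "(real n)\<^sup>2 * (T A - \<eta> / 3 - F n) \<le> (real n)\<^sup>2 * (\<Sum>X\<in>colorings k n. P X * t X)"
      using mean by (intro mult_left_mono) auto
    have "x - e / 2 \<le> z" if "x \<le> y" "y - h \<le> z" "2 * h \<le> e" for x y z e h :: real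
      using that by linarith
    from this[OF mean' gibbs ent] have "(real n)\<^sup>2 * (T A - \<eta> / 3 - F n) - ((real n)\<^sup>2 * entropy k W + real n * real k) / 2 \<le> (real n)\<^sup>2 * log_partition k T n" .
    moreover have "(real n)\<^sup>2 * (T A - \<eta> / 3 - F n) - ((real n)\<^sup>2 * entropy k W + real n * real k) / 2 =
        (real n)\<^sup>2 * (T A - \<eta> / 3 - F n - 1 / 2 * entropy k W - real k / (2 * real n))"
      using n by (simp add: field_simps power2_eq_square)
    ultimately have "T A - \<eta> / 3 - F n - 1 / 2 * entropy k W - real k / (2 * real n) \<le> log_partition k T n"
      using n by simp
    then show ?case using elim(2,3) unfolding A_def by linarith
  qed
qed

theorem theorem3p3:
  fixes k :: nat and T :: "kernel set \<Rightarrow> real"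
  assumes "k \<ge> 2"
    and "bounded (T ` graphon_space k)"
    and "continuous_map (graphon_topology k) euclideanreal T"
  shows "(\<lambda>n. log_partition k T n) \<longlonglongrightarrow>
    (SUP A\<in>graphon_space k. T A - 1 / 2 * class_entropy k A)"
proof -
  have k: "k \<ge> 1" using assms(1) by simp
  note T = assms(3)
  obtain C where "\<forall>x\<in>T ` graphon_space k. norm x \<le> C" using assms(2) unfolding bounded_iff by blast
  then have C: "\<bar>T A\<bar> \<le> C" if "A \<in> graphon_space k" for A using that by auto
  define f where "f A = T A - 1 / 2 * class_entropy k A" for A
  have bdd: "bdd_above (f ` graphon_space k)"
  proof (rule bdd_aboveI2)
    fix A assume A: "A \<in> graphon_space k"
    have "- real k \<le> class_entropy k A"
      unfolding class_entropy_def by (rule entropy_lower_bound[OF representative_in(2)[OF A]])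
    then show "f A \<le> C + real k / 2" using C[OF A] unfolding f_def by simp
  qed
  obtain X0 where "X0 \<in> colorings k 1" using colorings_nonempty[OF k] by blast
  then have ne: "graphon_space k \<noteq> {}" using graphon_class_in[OF empirical_graphon_in[OF k]] by blast
  have "log_partition k T \<longlonglongrightarrow> (SUP A\<in>graphon_space k. f A)"
  proof (rule order_tendstoI)
    fix b assume "b < (SUP A\<in>graphon_space k. f A)"
    then obtain A where A: "A \<in> graphon_space k" "b < f A" using less_cSUP_iff[OF ne bdd] by auto
    \<comment> \<open>Half of the gap \<open>f A - b\<close> is spent as the error, so the eventual
      lower bound still exceeds \<open>b\<close>.\<close>
    have "\<forall>\<^sub>F n in sequentially. T (graphon_class k (representative A)) - 1 / 2 * entropy k (representative A) - (f A - b) / 2 \<le> log_partition k T n"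
      using A by (intro log_partition_lower[OF k T C] representative_in(2)) auto
    then show "\<forall>\<^sub>F n in sequentially. b < log_partition k T n"
      by eventually_elim (use A in \<open>simp add: representative_in(3) f_def class_entropy_def field_simps\<close>)
  next
    fix b assume b: "(SUP A\<in>graphon_space k. f A) < b"
    show "\<forall>\<^sub>F n in sequentially. log_partition k T n < b"
    proof (rule ccontr)
      assume nev: "\<not> (\<forall>\<^sub>F n in sequentially. log_partition k T n < b)"
      \<comment> \<open>If the values are at least \<open>b\<close> infinitely often, the upper
        estimate with error 1/(m+1) supplies for every m a colouring and a graphon. Their limit
        point is a class at which the functional is at least \<open>b\<close>, although its supremum
        is below \<open>b\<close>.\<close>
      define good where "good m n X V \<longleftrightarrow> n \<ge> 1 \<and> X \<in> colorings k n \<and> V \<in> graphons k \<and>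
          b \<le> T (graphon_class k (empirical_graphon k n X)) - 1 / 2 * entropy k V + 1 / real (Suc m) \<and>
          (\<forall>a\<in>{1..k}. cut_norm (\<lambda>p. empirical_graphon k n X a p - V a p) \<le> 1 / real (Suc m))"
        for m n X V
      have "\<exists>n X V. good m n X V" for m
      proof -
        obtain n0 where n0: "\<forall>n\<ge>n0. \<exists>X\<in>colorings k n. \<exists>V\<in>graphons k.
            log_partition k T n \<le> T (graphon_class k (empirical_graphon k n X)) - 1 / 2 * entropy k V + 1 / real (Suc m) \<and>
            (\<forall>a\<in>{1..k}. cut_norm (\<lambda>p. empirical_graphon k n X a p - V a p) \<le> 1 / real (Suc m))"
          using log_partition_upper[OF k, of "1 / real (Suc m)" T] by auto
        obtain n where n: "n \<ge> max 1 n0" "b \<le> log_partition k T n"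
          using nev unfolding eventually_sequentially by (meson not_less)
        then obtain X V where "X \<in> colorings k n" "V \<in> graphons k"
            "log_partition k T n \<le> T (graphon_class k (empirical_graphon k n X)) - 1 / 2 * entropy k V + 1 / real (Suc m)"
            "\<forall>a\<in>{1..k}. cut_norm (\<lambda>p. empirical_graphon k n X a p - V a p) \<le> 1 / real (Suc m)"
          using n0[rule_format, of n] by auto
        then have "good m n X V" unfolding good_def using n by auto
        then show ?thesis by blast
      qed
      then obtain n X V where good: "\<And>m. good m (n m) (X m) (V m)" by metis
      have "\<exists>A\<in>graphon_space k. b \<le> T A - 1 / 2 * class_entropy k A"
      proof (rule empirical_limit_point[OF k T, where n = n and X = X and V = V and \<eta> = "\<lambda>m. 1 / real (Suc m)"])
        show "(\<lambda>m. 1 / real (Suc m)) \<longlonglongrightarrow> 0" by real_asymp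
      qed (use good in \<open>simp_all add: good_def del: of_nat_Suc\<close>)
      then obtain A where A: "A \<in> graphon_space k" "b \<le> f A" unfolding f_def by blast
      have "f A \<le> (SUP A\<in>graphon_space k. f A)" using bdd A(1) by (rule cSUP_upper2) simp
      then show False using A(2) b by simp
    qed
  qed
  then show ?thesis unfolding f_def .
qed

end
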